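(* Let $0<\sigma<1$ and $t>0$. The Riemann zeta function satisfies $$\frac{t}{\pi}\oint_{-\infty}^{\infty}\Re\left\{\frac{\Gamma(it-i\tau t)}{\Gamma(\sigma+it)}\,\Gamma(\sigma+i\tau t)\right\}\left|\zeta(\sigma+i\tau t)\right|^2\,d\tau+\mathcal{G}(\sigma,t)=0,$$ where $\oint$ denotes the principal value integral with respect to $\tau=1$.
   Context: $\Gamma$ is the gamma function and $\zeta$ the Riemann zeta function (analytically continued). The principal value with respect to $\tau=1$ is $\oint_{-\infty}^{\infty}=\lim_{\varepsilon\to0^+}\left(\int_{-\infty}^{1-\varepsilon}+\int_{1+\varepsilon}^{\infty}\right)$. With $s=\sigma+it$, $\bar s=\sigma-it$, the function $\mathcal{G}$ is defined for $\sigma\neq\frac12$ by $$\mathcal{G}(\sigma,t)=\zeta(2\sigma)+\left(\frac{\Gamma(1-\bar s)}{\Gamma(s)}+\frac{\Gamma(1-s)}{\Gamma(\bar s)}\right)\Gamma(2\sigma-1)\zeta(2\sigma-1)+\frac{2(\sigma-1)\zeta(2\sigma-1)}{(\sigma-1)^2+t^2},$$ and for $\sigma=\frac12$ by $$\mathcal{G}\left(\tfrac12,t\right)=\Re\left(\Psi\left(\tfrac12+it\right)\right)+2\gamma-\ln 2\pi+\frac{2}{1+4t^2},$$ where $\Psi(z)=\Gamma'(z)/\Gamma(z)$ is the digamma function and $\gamma$ is the Euler constant. *)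

theory Defs
  imports "HOL-Analysis.Analysis"
begin

text \<open>
  The analytic continuation of the Dirichlet series to the complex plane without 1; the
  meaningless value at the pole 1 is set to 0, which makes the function unique.
\<close>
definition riemann_zeta :: "complex \<Rightarrow> complex" where
  "riemann_zeta =
     (THE f. f holomorphic_on (- {1}) \<and>
             (\<forall>s. Re s > 1 \<longrightarrow> (\<lambda>n. of_nat (Suc n) powr (- s)) sums f s) \<and>
             f 1 = 0)"

text \<open>
  Principal value over the real line with respect to the single point \<open>c\<close>. Existence is part of
  the predicate: the integrals away from \<open>c\<close> converge absolutely and the limit exists.
\<close>
definition has_pv_integral :: "(real \<Rightarrow> real) \<Rightarrow> real \<Rightarrow> real \<Rightarrow> bool" where
  "has_pv_integral f c I \<longleftrightarrow>
     (\<forall>\<epsilon>>0. set_integrable lborel {..c - \<epsilon>} f \<and> set_integrable lborel {c + \<epsilon>..} f) \<and>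
     ((\<lambda>\<epsilon>. (LINT \<tau>:{..c - \<epsilon>}|lborel. f \<tau>) + (LINT \<tau>:{c + \<epsilon>..}|lborel. f \<tau>)) \<longlongrightarrow> I)
       (at_right 0)"

definition G_fun :: "real \<Rightarrow> real \<Rightarrow> complex" where
  "G_fun \<sigma> t =
     (let s = Complex \<sigma> t in
      if \<sigma> = 1/2 then
        of_real (Re (Digamma (1/2 + \<i> * of_real t)) + 2 * euler_mascheroni - ln (2 * pi)
                 + 2 / (1 + 4 * t\<^sup>2))
      else
        riemann_zeta (of_real (2 * \<sigma>))
        + (Gamma (1 - cnj s) / Gamma s + Gamma (1 - s) / Gamma (cnj s))
            * Gamma (of_real (2 * \<sigma> - 1)) * riemann_zeta (of_real (2 * \<sigma> - 1))
        + 2 * (of_real \<sigma> - 1) * riemann_zeta (of_real (2 * \<sigma> - 1))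
            / of_real ((\<sigma> - 1)\<^sup>2 + t\<^sup>2))"

text \<open>
  The library sets \<open>Gamma 0 = 0\<close>, which affects the integrand only at the excluded point \<open>\<tau> = 1\<close>.
\<close>
definition zeta_integrand :: "real \<Rightarrow> real \<Rightarrow> real \<Rightarrow> real" where
  "zeta_integrand \<sigma> t \<tau> =
     Re (Gamma (\<i> * of_real t - \<i> * of_real \<tau> * of_real t) / Gamma (of_real \<sigma> + \<i> * of_real t)
           * Gamma (of_real \<sigma> + \<i> * of_real \<tau> * of_real t))
     * (cmod (riemann_zeta (of_real \<sigma> + \<i> * of_real \<tau> * of_real t)))\<^sup>2"

end

theory Submission
  imports Defs "HOL-Complex_Analysis.Complex_Analysis" "HOL-Probability.Probability"
begin

text \<open>
  Put \<open>s = \<sigma> + i t\<close> and \<open>\<phi>(z) = \<Gamma>(z) \<Gamma>(s - z) \<zeta>(z) \<zeta>(2\<sigma> - z) / \<Gamma>(s)\<close>. With \<open>z = \<sigma> + i \<tau> t\<close> the integrand is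
  \<open>Re \<phi>(z)\<close>. The residue of \<open>\<phi>\<close> at \<open>z = s\<close> is the real number \<open>-|\<zeta>(s)|\<^sup>2\<close>, so for
  \<open>Re z = \<sigma>\<close>, \<open>y = Im z\<close> the singular part \<open>-|\<zeta>(s)|\<^sup>2 / (i (y - t))\<close> is purely imaginary and the
  principal value is an ordinary Lebesgue integral. Moving the line to \<open>Re z = c\<close> with
  \<open>-1 < c < min 0 (2\<sigma> - 1)\<close> yields the residues at \<open>0\<close> and \<open>2\<sigma> - 1\<close> (which merge into a double
  pole when \<open>\<sigma> = 1/2\<close>, whence the different formula) and half of the residue at \<open>s\<close>.
  On the new line \<open>\<zeta>(2\<sigma> - z)\<close> is a Dirichlet series, and the Mellin--Barnes integral for
  \<open>(1 + x) powr (-a)\<close> turns the integral into \<open>\<Sum>m\<ge>1. m powr (-cnj s) * T m s\<close>, where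
  \<open>T m s\<close> is the Euler--Maclaurin remainder of \<open>\<zeta>(s)\<close> at \<open>m\<close>. Adding the conjugate series gives the
  regularised form of Atkinson's dissection
  \<open>\<zeta>(u) \<zeta>(v) = \<zeta>(u + v) + \<Sum>\<^sub>m\<^sub><\<^sub>n (m powr (-u) n powr (-v) + m powr (-v) n powr (-u))\<close>, which can be summed
  in closed form by elementary telescoping.
\<close>

section \<open>Analytic continuation of the zeta function\<close>

text \<open>The choice of \<open>c\<close> serves several ends. With -1 < c < 0 the line lies in the
  strip where \<zeta>(z) is a single Euler--Maclaurin integral over (0, \<infinity>) with prefactor
  -z(z + 1); this prefactor moves the Gamma product to the abscissa c + 2 > 0, where the
  Mellin--Barnes formula holds. With c < 2\<sigma> - 1 the other zeta factor converges absolutely.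
  The obstacle is that Atkinson's double sums diverge for Re u = Re v = \<sigma> < 1 and would need
  a continuation in two variables. With Euler--Maclaurin remainders in place of the inner sums every
  series converges and no such continuation occurs. The shifted integral J is never evaluated alone;
  only J + cnj J is, which is enough because the integrand is a real part. |\<zeta>(s)|^2 enters
  twice with opposite signs, as half a residue at s and as the product \<zeta>(u) \<zeta>(v), and so
  drops out of the result.\<close>

lemma holomorphic_suminf:
  fixes f :: "nat \<Rightarrow> complex \<Rightarrow> complex"
  assumes S: "open S" and hol: "\<And>n. f n holomorphic_on S"
    and bound: "\<And>x. x \<in> S \<Longrightarrow> \<exists>d>0. \<exists>M. summable M \<and>
                  (\<forall>n. \<forall>y \<in> cball x d \<inter> S. norm (f n y) \<le> M n)"
  shows "(\<lambda>x. \<Sum>n. f n x) holomorphic_on S"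
proof (rule holomorphic_uniform_sequence[OF S])
  show "(\<lambda>x. \<Sum>i<n. f i x) holomorphic_on S" for n
    by (intro holomorphic_intros hol)
  fix x assume x: "x \<in> S"
  then obtain d M where d: "d > 0" "summable M"
    "\<forall>n. \<forall>y \<in> cball x d \<inter> S. norm (f n y) \<le> M n" using bound by blast
  obtain e where e: "e > 0" "cball x e \<subseteq> S" using S x open_contains_cball by blast
  have sub: "cball x (min d e) \<subseteq> cball x d \<inter> S" using e(2) by auto
  have "uniform_limit (cball x (min d e)) (\<lambda>n x. \<Sum>i<n. f i x) (\<lambda>x. \<Sum>i. f i x) sequentially"
    using d sub by (intro Weierstrass_m_test[where M = M]) auto
  then show "\<exists>d>0. cball x d \<subseteq> S \<and>
       uniform_limit (cball x d) (\<lambda>n x. \<Sum>i<n. f i x) (\<lambda>x. \<Sum>i. f i x) sequentially"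
    using d(1) e sub by (intro exI[of _ "min d e"]) auto
qed

text \<open>Complex Taylor formula on the segment from n to n + 1. The derivative of order K + 1 is
  a falling factorial times \<open>x powr (b - K - 1)\<close>; the hypothesis on \<open>Re b\<close>
  keeps its modulus from increasing in x, so the value at n bounds it.\<close>

lemma powr_Taylor_bound:
  fixes b :: complex
  assumes n: "n \<ge> 1" and b: "Re b \<le> real K + 1"
  shows "cmod (of_nat (Suc n) powr b - (\<Sum>i\<le>K. (b gchoose i) * of_nat n powr (b - of_nat i)))
           \<le> cmod (\<Prod>j<Suc K. b - of_nat j) * real n powr (Re b - real K - 1)"
proof -
  define f where "f = (\<lambda>i x. (\<Prod>j<i. b - of_nat j) * x powr (b - of_nat i))"
  let ?S = "closed_segment (of_nat n) (of_nat (Suc n)) :: complex set"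
  have S: "\<exists>r. x = of_real r \<and> r \<ge> real n" if x: "x \<in> ?S" for x
  proof -
    obtain r where "r \<in> closed_segment (real n) (real (Suc n))" "x = of_real r"
      using x closed_segment_of_real[of "real n" "real (Suc n)", where 'a = complex] by auto
    then show ?thesis by (auto simp: closed_segment_eq_real_ivl)
  qed
  have der: "(f i has_field_derivative f (Suc i) x) (at x within ?S)" if "x \<in> ?S" for i x
  proof -
    obtain r where r: "x = of_real r" "r \<ge> real n" using S \<open>x \<in> ?S\<close> by blast
    then have "x \<notin> \<real>\<^sub>\<le>\<^sub>0" using n by (auto simp: complex_nonpos_Reals_iff)
    then have "(f i has_field_derivative f (Suc i) x) (at x)"
      unfolding f_def by (auto intro!: derivative_eq_intros simp: algebra_simps)
    then show ?thesis by (rule has_field_derivative_at_within)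
  qed
  have bd: "cmod (f (Suc K) x) \<le> cmod (\<Prod>j<Suc K. b - of_nat j) * real n powr (Re b - real K - 1)"
    if x: "x \<in> ?S" for x
  proof -
    obtain r where r: "x = of_real r" "r \<ge> real n" using S x by blast
    then have "cmod (x powr (b - of_nat (Suc K))) = r powr (Re b - real K - 1)"
      using n by (subst norm_powr_real_powr) (auto simp: algebra_simps)
    also have "\<dots> \<le> real n powr (Re b - real K - 1)"
      using r n b by (intro powr_mono2') auto
    finally show ?thesis unfolding f_def norm_mult by (intro mult_left_mono) auto
  qed
  have "cmod (f 0 (of_nat (Suc n)) - (\<Sum>i\<le>K. f i (of_nat n) * (of_nat (Suc n) - of_nat n) ^ i / fact i))
     \<le> cmod (\<Prod>j<Suc K. b - of_nat j) * real n powr (Re b - real K - 1)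
         * cmod (of_nat (Suc n) - of_nat n) ^ Suc K / fact K"
    by (rule complex_Taylor[where S = ?S]) (use der bd in auto)
  also have "\<dots> = cmod (\<Prod>j<Suc K. b - of_nat j) * real n powr (Re b - real K - 1) / fact K"
    by simp
  also have "\<dots> \<le> cmod (\<Prod>j<Suc K. b - of_nat j) * real n powr (Re b - real K - 1)"
    using divide_left_mono[of 1 "fact K" "cmod (\<Prod>j<Suc K. b - of_nat j) * real n powr (Re b - real K - 1)"]
    by (simp only: div_by_1 fact_ge_1) simp
  finally show ?thesis
    by (simp add: f_def gbinomial_prod_rev atLeast0LessThan)
qed

lemma zeta_series_sums:
  assumes "Re s > 1"
  shows "(\<lambda>n. of_nat (Suc n) powr (- s)) sums (\<Sum>n. of_nat (Suc n) powr (- s) :: complex)"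
proof (rule summable_sums, rule summable_norm_cancel)
  have "summable (\<lambda>n. real (Suc n) powr (- Re s))"
    using assms by (subst summable_Suc_iff) (simp add: summable_real_powr_iff)
  then show "summable (\<lambda>n. norm (of_nat (Suc n) powr (- s) :: complex))"
    by (subst norm_powr_real_powr) auto
qed

lemma holomorphic_zeta_series:
  "(\<lambda>s. \<Sum>n. of_nat (Suc n) powr (- s) :: complex) holomorphic_on {s. Re s > 1}"
proof (rule holomorphic_suminf)
  show "open {s. Re s > 1}" by (rule open_halfspace_Re_gt)
  show "(\<lambda>s. of_nat (Suc n) powr (- s)) holomorphic_on {s. Re s > 1}" for n
    by (intro holomorphic_intros)
  fix s :: complex assume s: "s \<in> {s. Re s > 1}"
  define d where "d = (Re s - 1) / 2"
  have d: "d > 0" "Re s - d > 1" using s by (auto simp: d_def field_simps)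
  have "summable (\<lambda>n. real n powr (- (Re s - d)))"
    using d by (simp add: summable_real_powr_iff)
  then have "summable (\<lambda>n. real (Suc n) powr (- (Re s - d)))" by (subst summable_Suc_iff)
  moreover have "norm (of_nat (Suc n) powr (- y)) \<le> real (Suc n) powr (- (Re s - d))"
    if "y \<in> cball s d" for n y
  proof -
    have "\<bar>Re s - Re y\<bar> \<le> d" using that abs_Re_le_cmod[of "s - y"] by (auto simp: dist_norm)
    then have "real (Suc n) powr - Re y \<le> real (Suc n) powr (- (Re s - d))"
      by (intro powr_mono) auto
    then show ?thesis by (subst norm_powr_real_powr) auto
  qed
  ultimately show "\<exists>d>0. \<exists>M. summable M \<and> (\<forall>n. \<forall>y \<in> cball s d \<inter> {s. Re s > 1}.
        norm (of_nat (Suc n) powr (- y) :: complex) \<le> M n)"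
    using d(1) by blast
qed

definition zeta_cont :: "nat \<Rightarrow> (complex \<Rightarrow> complex) \<Rightarrow> bool" where
  "zeta_cont j Z \<longleftrightarrow> Z holomorphic_on {s. Re s > 1 - real j} \<and>
     (\<forall>s. Re s > 1 \<longrightarrow> Z s = (s - 1) * (\<Sum>n. of_nat (Suc n) powr (- s)))"

text \<open>
  The recursion comes from summing the Taylor expansion of \<open>(n + 1) powr (1 - s)\<close> around \<open>n\<close> over all
  \<open>n\<close>: the left-hand side telescopes, and the \<open>k\<close>-th Taylor term contributes a multiple of
  \<open>\<zeta>(s + k - 1)\<close>. Working with \<open>(s - 1) \<zeta>(s)\<close> makes every coefficient entire.
\<close>
lemma zeta_cont_step:
  assumes "zeta_cont j Z"
  shows "\<exists>Z'. zeta_cont (Suc j) Z'"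
proof -
  \<comment> \<open>With K = j + 1 the Taylor remainders are O(n powr (- Re s - K)), which is
    summable exactly for Re s > -j, the new half-plane.\<close>
  define K where "K = Suc j"
  define R :: "nat \<Rightarrow> complex \<Rightarrow> complex" where "R = (\<lambda>n s. of_nat (Suc (Suc n)) powr (1 - s)
      - (\<Sum>i\<le>K. ((1 - s) gchoose i) * of_nat (Suc n) powr (1 - s - of_nat i)))"
  define Z' where "Z' = (\<lambda>s. 1 + (\<Sum>n. R n s)
      - (\<Sum>k=1..<K. ((1 - s) gchoose k) / of_nat (Suc k) * Z (s + of_nat k)))"
  let ?S = "{s. Re s > - real j}"
  have S: "open ?S" by (rule open_halfspace_Re_gt)
  have Rb: "norm (R n s) \<le> cmod (\<Prod>j<Suc K. 1 - s - of_nat j) * real (Suc n) powr (- Re s - real K)"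
    if "s \<in> ?S" for n s
  proof -
    have "Re (1 - s) \<le> real K + 1" using that by (simp add: K_def)
    from powr_Taylor_bound[OF _ this, of "Suc n"] show ?thesis
      unfolding R_def by (simp del: sum.atMost_Suc prod.lessThan_Suc of_nat_Suc)
  qed
  have Rball: "\<exists>d>0. \<exists>M. summable M \<and> (\<forall>n. \<forall>y \<in> cball s d \<inter> ?S. norm (R n y) \<le> M n)"
    if s: "s \<in> ?S" for s
  proof -
    define d where "d = (Re s + real j) / 2"
    have d: "d > 0" "Re s - d > - real j" using s by (auto simp: d_def field_simps)
    have "compact ((\<lambda>s. \<Prod>j<Suc K. 1 - s - of_nat j) ` cball s d)"
      by (intro compact_continuous_image continuous_intros) auto
    then obtain C where C: "\<And>y. y \<in> cball s d \<Longrightarrow> cmod (\<Prod>j<Suc K. 1 - y - of_nat j) \<le> C"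
      by (meson bounded_iff compact_imp_bounded imageI)
    have C0: "C \<ge> 0" using C[of s] d norm_ge_zero order_trans by (metis centre_in_cball less_imp_le)
    have "summable (\<lambda>n. real n powr (- (Re s - d) - real K))"
      using d by (simp add: summable_real_powr_iff K_def)
    then have "summable (\<lambda>n. C * real (Suc n) powr (- (Re s - d) - real K))"
      by (intro summable_mult) (subst summable_Suc_iff)
    moreover have "norm (R n y) \<le> C * real (Suc n) powr (- (Re s - d) - real K)"
      if "y \<in> cball s d \<inter> ?S" for n y
    proof -
      have "\<bar>Re s - Re y\<bar> \<le> d" using that abs_Re_le_cmod[of "s - y"] by (auto simp: dist_norm)
      then have "real (Suc n) powr (- Re y - real K) \<le> real (Suc n) powr (- (Re s - d) - real K)"
        by (intro powr_mono) auto
      then show ?thesis using C[of y] that C0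
        by (intro order.trans[OF Rb] mult_mono) auto
    qed
    ultimately show ?thesis using d(1) by blast
  qed
  have "(\<lambda>s. \<Sum>n. R n s) holomorphic_on ?S"
  proof (rule holomorphic_suminf[OF S _ Rball])
    show "R n holomorphic_on ?S" for n
      unfolding R_def gbinomial_prod_rev by (intro holomorphic_intros) auto
  qed auto
  moreover have "(\<lambda>s. Z (s + of_nat k)) holomorphic_on ?S" if "k \<ge> 1" for k
  proof -
    have "Z holomorphic_on {s. Re s > 1 - real j}" using assms by (simp add: zeta_cont_def)
    then have "Z \<circ> (\<lambda>s. s + of_nat k) holomorphic_on ?S"
      by (intro holomorphic_on_compose_gen[where t = "{s. Re s > 1 - real j}"] holomorphic_intros)
         (use that in auto)
    then show ?thesis by (simp add: o_def)
  qed
  ultimately have hol: "Z' holomorphic_on ?S"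
    unfolding Z'_def gbinomial_prod_rev by (intro holomorphic_intros) auto
  have "Z' s = (s - 1) * (\<Sum>n. of_nat (Suc n) powr (- s))" if s: "Re s > 1" for s
  proof -
    define z where "z = (\<lambda>s. \<Sum>n. of_nat (Suc n) powr (- s) :: complex)"
    have zs: "(\<lambda>n. of_nat (Suc n) powr (- w)) sums z w" if "Re w > 1" for w
      unfolding z_def by (rule zeta_series_sums[OF that])
    have sm: "summable (\<lambda>n. R n s)"
    proof -
      have sS: "s \<in> ?S" using s by simp
      obtain d M where d: "d > 0" and M: "summable M"
        and *: "\<forall>n. \<forall>y \<in> cball s d \<inter> ?S. norm (R n y) \<le> M n"
        using Rball[OF sS] by metis
      have "s \<in> cball s d \<inter> ?S" using sS d by simp
      with * have "norm (R n s) \<le> M n" for n by blast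
      then show ?thesis by (rule summable_comparison_test'[OF M])
    qed
    have lim: "(\<lambda>n. of_nat (Suc n) powr (1 - s) :: complex) \<longlonglongrightarrow> 0"
    proof -
      have "(\<lambda>n. real (Suc n) powr (1 - Re s)) \<longlonglongrightarrow> 0"
        using s by real_asymp
      then show ?thesis by (subst tendsto_norm_zero_iff[symmetric], subst norm_powr_real_powr) auto
    qed
    have "(\<lambda>n. of_nat (Suc (Suc n)) powr (1 - s) - of_nat (Suc n) powr (1 - s) :: complex) sums (0 - of_nat (Suc 0) powr (1 - s))"
      by (rule telescope_sums[OF lim])
    moreover have "of_nat (Suc (Suc n)) powr (1 - s) - of_nat (Suc n) powr (1 - s)
       = R n s + (\<Sum>i=1..K. ((1 - s) gchoose i) * of_nat (Suc n) powr (- (s + of_nat i - 1)))" for n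
      unfolding R_def atMost_atLeast0
      by (subst sum.atLeast_Suc_atMost[of 0 K]) (auto simp: algebra_simps)
    ultimately have "(\<lambda>n. R n s + (\<Sum>i=1..K. ((1 - s) gchoose i) * of_nat (Suc n) powr (- (s + of_nat i - 1)))) sums (-1)"
      by simp
    moreover have "(\<lambda>n. R n s + (\<Sum>i=1..K. ((1 - s) gchoose i) * of_nat (Suc n) powr (- (s + of_nat i - 1))))
       sums (suminf (\<lambda>n. R n s) + (\<Sum>i=1..K. ((1 - s) gchoose i) * z (s + of_nat i - 1)))"
      by (intro sums_add summable_sums[OF sm] sums_sum sums_mult zs) (use s in auto)
    ultimately have eq: "-1 = (\<Sum>n. R n s) + (\<Sum>i=1..K. ((1 - s) gchoose i) * z (s + of_nat i - 1))"
      using sums_unique2 by blast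
    have "(\<Sum>i=1..K. ((1 - s) gchoose i) * z (s + of_nat i - 1))
        = (\<Sum>k<K. ((1 - s) gchoose Suc k) * z (s + of_nat k))"
      by (simp add: sum.atLeast1_atMost_eq)
    also have "\<dots> = (1 - s) * z s + (\<Sum>k=1..<K. ((1 - s) gchoose Suc k) * z (s + of_nat k))"
      unfolding lessThan_atLeast0 by (subst sum.atLeast_Suc_lessThan[of 0 K]) (auto simp: K_def)
    also have "(\<Sum>k=1..<K. ((1 - s) gchoose Suc k) * z (s + of_nat k))
        = (\<Sum>k=1..<K. - (((1 - s) gchoose k) / of_nat (Suc k) * Z (s + of_nat k)))"
    proof (rule sum.cong)
      fix k assume k: "k \<in> {1..<K}"
      \<comment> \<open>The new factor 1 - s - k of the binomial coefficient is minus the factor s +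
        k - 1 that turns \<zeta>(s + k) into \<open>Z (s + of_nat k)\<close>, so the pole
        cancels.\<close>
      have b: "((1 - s) gchoose Suc k) = ((1 - s) gchoose k) * (1 - s - of_nat k) / of_nat (Suc k)"
        using gbinomial_mult_1[of "1 - s" k]
        by (simp add: field_simps del: of_nat_Suc)
      have Zk: "Z (s + of_nat k) = (s + of_nat k - 1) * z (s + of_nat k)"
        using assms s k by (simp add: zeta_cont_def z_def)
      show "((1 - s) gchoose Suc k) * z (s + of_nat k) = - (((1 - s) gchoose k) / of_nat (Suc k) * Z (s + of_nat k))"
      proof -
        define y where "y = s + of_nat k - 1"
        have "1 - s - of_nat k = - y" by (simp add: y_def)
        then show ?thesis unfolding b Zk y_def[symmetric] by (simp add: mult_ac)
      qed
    qed auto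
    finally have S: "(\<Sum>i=1..K. ((1 - s) gchoose i) * z (s + of_nat i - 1)) = (1 - s) * z s
        - (\<Sum>k=1..<K. ((1 - s) gchoose k) / of_nat (Suc k) * Z (s + of_nat k))"
      by (simp only: sum_negf) simp
    have "1 + r - w = (s - 1) * y" if "-1 = r + t" "t = (1 - s) * y - w" for r t w y :: complex
      using that by algebra
    from this[OF eq S] have "Z' s = (s - 1) * z s" unfolding Z'_def .
    then show ?thesis by (simp only: z_def)
  qed
  then have "zeta_cont (Suc j) Z'" using hol by (simp add: zeta_cont_def)
  then show ?thesis by blast
qed

text \<open>The continuations to the half-planes Re s > 1 - j agree on overlaps by the identity
  theorem, so they glue to an entire function.\<close>

lemma zeta_entire_exists:
  "\<exists>Z. Z holomorphic_on UNIV \<and>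
     (\<forall>s. Re s > 1 \<longrightarrow> Z s = (s - 1) * (\<Sum>n. of_nat (Suc n) powr (- s)))"
proof -
  have "\<exists>Z. zeta_cont j Z" for j
  proof (induction j)
    case 0
    have "zeta_cont 0 (\<lambda>s. (s - 1) * (\<Sum>n. of_nat (Suc n) powr (- s)))"
      unfolding zeta_cont_def using holomorphic_zeta_series by (auto intro!: holomorphic_intros)
    then show ?case by blast
  next
    case (Suc j)
    then show ?case using zeta_cont_step by blast
  qed
  then obtain F where F: "\<And>j. zeta_cont j (F j)" by metis
  have agree: "F i s = F j s" if "i \<le> j" "Re s > 1 - real i" for i j s
  proof (rule analytic_continuation_open[of "{s. Re s > 1}" "{s. Re s > 1 - real i}" "F i" "F j"])
    show "{s::complex. Re s > 1} \<noteq> {}" by (auto intro!: exI[of _ 2])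
    show "connected {s. Re s > 1 - real i}" by (intro convex_connected convex_halfspace_Re_gt)
    show "F j holomorphic_on {s. Re s > 1 - real i}"
      by (rule holomorphic_on_subset[where s = "{s. Re s > 1 - real j}"])
         (use F[of j] that in \<open>auto simp: zeta_cont_def\<close>)
  qed (use F that in \<open>auto simp: zeta_cont_def open_halfspace_Re_gt\<close>)
  \<comment> \<open>Any index j with Re s > 1 - j would do. This one always satisfies that
    inequality, also for large Re s, where \<open>nat\<close> truncates it to 0.\<close>
  define Z where "Z = (\<lambda>s. F (nat \<lceil>2 - Re s\<rceil>) s)"
  have Z: "Z s = F j s" if "Re s > 1 - real j" for s j
  proof -
    have "Re s > 1 - real (nat \<lceil>2 - Re s\<rceil>)" by linarith
    then show ?thesis unfolding Z_def using agree[of _ _ s] that by (metis linear)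
  qed
  have "Z field_differentiable (at s)" for s
  proof -
    define j where "j = nat \<lceil>2 - Re s\<rceil>"
    have s: "Re s > 1 - real j" unfolding j_def by linarith
    have "F j holomorphic_on {s. Re s > 1 - real j}" using F by (simp add: zeta_cont_def)
    then have "Z holomorphic_on {s. Re s > 1 - real j}"
      by (rule holomorphic_transform) (use Z in auto)
    then show ?thesis using s open_halfspace_Re_gt[of "1 - real j"]
      by (intro holomorphic_on_imp_differentiable_at) auto
  qed
  then have "Z holomorphic_on UNIV" by (simp add: holomorphic_on_def)
  moreover have "Z s = (s - 1) * (\<Sum>n. of_nat (Suc n) powr (- s))" if "Re s > 1" for s
    using Z[of 0 s] F[of 0] that by (auto simp: zeta_cont_def)
  ultimately show ?thesis by blast
qed

section \<open>Uniqueness of the continuation, conjugation symmetry and the simple pole\<close>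

lemma connected_minus_one: "connected (- {1::complex})"
  using connected_punctured_universe[of "1::complex"] by simp

text \<open>This gives the definite description in \<open>riemann_zeta\<close> its meaning.
  Uniqueness is the identity theorem on the connected punctured plane, with the point 1 settled by
  the convention \<open>f 1 = 0\<close>.\<close>

lemma zeta_characterization:
  "\<exists>!f. f holomorphic_on (- {1}) \<and>
        (\<forall>s. Re s > 1 \<longrightarrow> (\<lambda>n. of_nat (Suc n) powr (- s)) sums f s) \<and> f 1 = 0"
proof (rule ex_ex1I)
  obtain Z where Z: "Z holomorphic_on UNIV"
     "\<And>s. Re s > 1 \<Longrightarrow> Z s = (s - 1) * (\<Sum>n. of_nat (Suc n) powr (- s))"
    using zeta_entire_exists by blast
  show "\<exists>f. f holomorphic_on (- {1}) \<and>
        (\<forall>s. Re s > 1 \<longrightarrow> (\<lambda>n. of_nat (Suc n) powr (- s)) sums f s) \<and> f 1 = 0"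
  proof (intro exI[of _ "\<lambda>s. Z s / (s - 1)"] conjI allI impI)
    show "(\<lambda>s. Z s / (s - 1)) holomorphic_on (- {1})"
      by (intro holomorphic_intros holomorphic_on_subset[OF Z(1)]) auto
    show "(\<lambda>n. of_nat (Suc n) powr (- s)) sums (Z s / (s - 1))" if "Re s > 1" for s
    proof -
      have "s - 1 \<noteq> 0" using that by auto
      then have "Z s / (s - 1) = (\<Sum>n. of_nat (Suc n) powr (- s))" using Z(2)[OF that] by simp
      then show ?thesis using zeta_series_sums[OF that] by (simp only:)
    qed
  qed simp
next
  fix f g :: "complex \<Rightarrow> complex"
  assume f: "f holomorphic_on (- {1}) \<and>
        (\<forall>s. Re s > 1 \<longrightarrow> (\<lambda>n. of_nat (Suc n) powr (- s)) sums f s) \<and> f 1 = 0"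
    and g: "g holomorphic_on (- {1}) \<and>
        (\<forall>s. Re s > 1 \<longrightarrow> (\<lambda>n. of_nat (Suc n) powr (- s)) sums g s) \<and> g 1 = 0"
  show "f = g"
  proof
    fix s
    show "f s = g s"
    proof (cases "s = 1")
      case False
      show ?thesis
      proof (rule analytic_continuation_open[of "{s. Re s > 1}" "- {1}" f g])
        show "{s::complex. Re s > 1} \<noteq> {}" by (auto intro!: exI[of _ 2])
        show "f z = g z" if "z \<in> {s. Re s > 1}" for z
          using f g that sums_unique2 by blast
      qed (use f g False connected_minus_one in \<open>auto simp: open_halfspace_Re_gt\<close>)
    qed (use f g in auto)
  qed
qed

lemma riemann_zeta_props:
  shows holomorphic_riemann_zeta: "riemann_zeta holomorphic_on (- {1})"
    and riemann_zeta_sums: "Re s > 1 \<Longrightarrow> (\<lambda>n. of_nat (Suc n) powr (- s)) sums riemann_zeta s"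
    and riemann_zeta_1: "riemann_zeta 1 = 0"
  using theI'[OF zeta_characterization] unfolding riemann_zeta_def by blast+

text \<open>The function \<open>cnj \<circ> riemann_zeta \<circ> cnj\<close> has the same three
  characterising properties, so uniqueness identifies the two.\<close>

lemma riemann_zeta_cnj: "riemann_zeta (cnj s) = cnj (riemann_zeta s)"
proof -
  have "(cnj \<circ> riemann_zeta \<circ> cnj) holomorphic_on (- {1})"
  proof (rule holomorphic_on_compose_cnj_cnj)
    have "cnj ` (- {1}) = - {1}"
      by (auto intro!: image_eqI[of _ cnj "cnj _"])
    then show "riemann_zeta holomorphic_on cnj ` (- {1})" by (simp add: holomorphic_riemann_zeta)
  qed auto
  moreover have "(\<lambda>n. of_nat (Suc n) powr (- s)) sums (cnj \<circ> riemann_zeta \<circ> cnj) s" if "Re s > 1" for s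
  proof -
    have "(\<lambda>n. cnj (of_nat (Suc n) powr (- cnj s))) sums cnj (riemann_zeta (cnj s))"
      by (subst sums_cnj) (rule riemann_zeta_sums, use that in simp)
    moreover have "cnj (of_nat (Suc n) powr (- cnj s)) = of_nat (Suc n) powr (- s)" for n
      by (subst cnj_powr) auto
    ultimately show ?thesis by simp
  qed
  moreover have "(cnj \<circ> riemann_zeta \<circ> cnj) 1 = 0" by (simp add: riemann_zeta_1)
  ultimately have "cnj \<circ> riemann_zeta \<circ> cnj = riemann_zeta"
    unfolding riemann_zeta_def[symmetric] using zeta_characterization riemann_zeta_props by blast
  then show ?thesis by (metis comp_apply complex_cnj_cnj)
qed

lemma riemann_zeta_entire:
  obtains Z where "Z holomorphic_on UNIV" "\<And>s. s \<noteq> 1 \<Longrightarrow> riemann_zeta s = Z s / (s - 1)"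
proof -
  obtain Z where Z: "Z holomorphic_on UNIV"
     "\<And>s. Re s > 1 \<Longrightarrow> Z s = (s - 1) * (\<Sum>n. of_nat (Suc n) powr (- s))"
    using zeta_entire_exists by blast
  have "riemann_zeta s = Z s / (s - 1)" if "s \<noteq> 1" for s
  proof (rule analytic_continuation_open[of "{s. Re s > 1}" "- {1}" riemann_zeta])
    show "{s::complex. Re s > 1} \<noteq> {}" by (auto intro!: exI[of _ 2])
    show "(\<lambda>s. Z s / (s - 1)) holomorphic_on (- {1})"
      by (intro holomorphic_intros holomorphic_on_subset[OF Z(1)]) auto
    show "riemann_zeta z = Z z / (z - 1)" if "z \<in> {s. Re s > 1}" for z
    proof -
      have "Re z > 1" using that by simp
      from sums_unique[OF riemann_zeta_sums[OF this]] show ?thesis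
        using Z(2)[OF \<open>Re z > 1\<close>] \<open>Re z > 1\<close> by auto
    qed
  qed (use that holomorphic_riemann_zeta connected_minus_one in \<open>auto simp: open_halfspace_Re_gt\<close>)
  with Z(1) show ?thesis using that by blast
qed

section \<open>Euler--Maclaurin summation\<close>

text \<open>
  A primitive of \<open>frac x - 1 / 2\<close>, normalised to vanish at the integers so that no boundary terms
  arise when Euler--Maclaurin summation is carried to second order.
\<close>
definition P2 :: "real \<Rightarrow> real" where "P2 x = frac x * (frac x - 1) / 2"

lemma P2_measurable [measurable]: "P2 \<in> borel_measurable borel"
  unfolding P2_def frac_def by measurable

lemma P2_bound: "\<bar>P2 x\<bar> \<le> 1 / 8"
proof -
  have "0 \<le> (frac x - 1/2)\<^sup>2" by simp
  then have "frac x * (1 - frac x) \<le> 1 / 4" by (simp add: power2_eq_square field_simps)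
  moreover have "0 \<le> frac x * (1 - frac x)"
    using frac_ge_0[of x] frac_lt_1[of x] by (intro mult_nonneg_nonneg) auto
  moreover have "\<bar>P2 x\<bar> = frac x * (1 - frac x) / 2"
    using calculation by (simp add: P2_def abs_if field_simps)
  ultimately show ?thesis by simp
qed

text \<open>Near 0 this linear bound gains the power of x that makes the kernel integrable down to 0
  when Re v < 0.\<close>

lemma P2_bound_id: "x \<ge> 0 \<Longrightarrow> \<bar>P2 x\<bar> \<le> x"
proof -
  assume x: "x \<ge> 0"
  have "frac x \<le> x" using x by (simp add: frac_def)
  moreover have "frac x * (1 - frac x) \<le> frac x * 1"
    using frac_ge_0[of x] by (intro mult_left_mono) auto
  moreover have "0 \<le> frac x * (1 - frac x)"
    using frac_ge_0[of x] frac_lt_1[of x] by (intro mult_nonneg_nonneg) auto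
  moreover have "\<bar>P2 x\<bar> = frac x * (1 - frac x) / 2"
    using calculation by (simp add: P2_def abs_if field_simps)
  ultimately show ?thesis using frac_ge_0[of x] by linarith
qed

lemma P2_add_nat: "P2 (real m + x) = P2 x"
  by (simp add: P2_def frac_def)

text \<open>The right endpoint, where \<open>frac\<close> jumps, is included because the parabola
  vanishes there just as \<open>P2\<close> does. The fundamental theorem can then be used on closed
  unit intervals.\<close>

lemma P2_eq: "real n \<le> x \<Longrightarrow> x \<le> real n + 1 \<Longrightarrow> P2 x = (x - real n) * (x - real n - 1) / 2"
proof (cases "x = real n + 1")
  case False
  assume "real n \<le> x" "x \<le> real n + 1"
  with False have "frac x = x - real n" by (auto simp: frac_unique_iff)
  then show ?thesis by (simp add: P2_def)
qed (simp add: P2_def frac_def)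

text \<open>The second derivative of x powr (-v) is v (v + 1) x powr (-v - 2). The constant v (v +
  1) stays outside the kernel: its zero at v = 0 yields the value of zeta at 0, and it is the factor
  that shifts the argument of Gamma by 2.\<close>

definition em_ker :: "complex \<Rightarrow> real \<Rightarrow> complex" where
  "em_ker v x = of_real (P2 x) * of_real x powr (- v - 2)"

section \<open>Integrability of the remainder kernel\<close>

lemma em_ker_measurable [measurable]: "em_ker v \<in> borel_measurable borel"
  unfolding em_ker_def by measurable

lemma norm_em_ker: "x > 0 \<Longrightarrow> norm (em_ker v x) = \<bar>P2 x\<bar> * x powr (- Re v - 2)"
  unfolding em_ker_def norm_mult by (subst norm_powr_real_powr) auto

lemma norm_em_ker_le: "x > 0 \<Longrightarrow> norm (em_ker v x) \<le> 1 / 8 * x powr (- Re v - 2)"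
  unfolding norm_em_ker by (intro mult_right_mono P2_bound) auto

text \<open>Nonnegativity upgrades a gauge integral to an absolutely convergent one, hence to a
  Lebesgue integral over \<open>lborel\<close> with the same value.\<close>

lemma set_integrable_lborelI:
  fixes f :: "real \<Rightarrow> real"
  assumes "(f has_integral I) S" "\<And>x. x \<in> S \<Longrightarrow> f x \<ge> 0"
    and [measurable]: "S \<in> sets borel" "f \<in> borel_measurable borel"
  shows "set_integrable lborel S f" "(LINT x:S|lborel. f x) = I"
proof -
  have "f absolutely_integrable_on S"
    using assms(1,2) by (intro nonnegative_absolutely_integrable_1) (auto simp: integrable_on_def)
  then show *: "set_integrable lborel S f"
    unfolding set_integrable_def by (subst (asm) integrable_completion) measurable
  show "(LINT x:S|lborel. f x) = I"
    using set_borel_integral_eq_integral(2)[OF *] assms(1) by (simp add: integral_unique)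
qed

lemma set_integrable_powr_at_top:
  assumes "e < -1" "a > 0"
  shows "set_integrable lborel {a<..} (\<lambda>x::real. x powr e)"
    and "(LINT x:{a<..}|lborel. x powr e) = - (a powr (e + 1)) / (e + 1)"
proof -
  have "((\<lambda>x. x powr e) has_integral - (a powr (e + 1)) / (e + 1)) {a<..}"
    using has_integral_powr_to_inf[OF assms]
    by (subst has_integral_spike_set_eq[of _ "{a..}"]) (auto intro: negligible_subset[of "{a}"])
  then show "set_integrable lborel {a<..} (\<lambda>x::real. x powr e)"
    and "(LINT x:{a<..}|lborel. x powr e) = - (a powr (e + 1)) / (e + 1)"
    by (auto intro!: set_integrable_lborelI)
qed

lemma set_integrable_powr_at_0:
  assumes "e > -1" "a \<ge> 0"
  shows "set_integrable lborel {0<..a} (\<lambda>x::real. x powr e)"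
proof -
  have "((\<lambda>x. x powr e) has_integral (a powr (e + 1)) / (e + 1)) {0<..a}"
    using has_integral_powr_from_0[OF assms]
    by (subst has_integral_spike_set_eq[of _ "{0..a}"]) (auto intro: negligible_subset[of "{0}"])
  then show ?thesis by (auto intro!: set_integrable_lborelI)
qed

lemma set_integrable_em_ker_pos:
  assumes "a > 0" "Re v > -1"
  shows "set_integrable lborel {a<..} (em_ker v)"
proof (rule set_integrable_bound[where f = "\<lambda>x. 1/8 * x powr (- Re v - 2)"])
  show "set_integrable lborel {a<..} (\<lambda>x. 1 / 8 * x powr (- Re v - 2))"
    using assms by (intro set_integrable_mult_right set_integrable_powr_at_top) auto
  show "AE x in lborel. x \<in> {a<..} \<longrightarrow> norm (em_ker v x) \<le> norm (1 / 8 * x powr (- Re v - 2))"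
    using assms by (intro always_eventually allI impI order.trans[OF norm_em_ker_le]) auto
qed (auto simp: set_borel_measurable_def)

text \<open>At infinity \<open>P2\<close> is merely bounded, which requires Re v > -1. At 0 the
  bound \<open>P2_bound_id\<close> leaves x powr (- Re v - 1), integrable for Re v < 0. Hence the
  strip -1 < Re v < 0 when the lower limit is 0.\<close>

lemma set_integrable_em_ker:
  assumes "a \<ge> 0" "Re v > -1" "a = 0 \<Longrightarrow> Re v < 0"
  shows "set_integrable lborel {a<..} (em_ker v)"
proof (cases "a = 0")
  case True
  have "set_integrable lborel {0<..1} (em_ker v)"
  proof (rule set_integrable_bound[where f = "\<lambda>x. x powr (- Re v - 1)"])
    show "set_integrable lborel {0<..1} (\<lambda>x. x powr (- Re v - 1))"
      using assms True by (intro set_integrable_powr_at_0) auto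
    have "norm (em_ker v x) \<le> x powr (- Re v - 1)" if "x > 0" for x
    proof -
      have "norm (em_ker v x) \<le> x * x powr (- Re v - 2)"
        using that by (subst norm_em_ker) (auto intro!: mult_right_mono P2_bound_id)
      also have "\<dots> = x powr 1 * x powr (- Re v - 2)" using that by simp
      also have "\<dots> = x powr (- Re v - 1)"
      proof -
        have "- Re v - 1 = 1 + (- Re v - 2)" by simp
        then show ?thesis by (simp only: powr_add)
      qed
      finally show ?thesis .
    qed
    then show "AE x in lborel. x \<in> {0<..1} \<longrightarrow> norm (em_ker v x) \<le> norm (x powr (- Re v - 1))"
      by (intro always_eventually allI impI) auto
  qed (auto simp: set_borel_measurable_def)
  moreover have "set_integrable lborel {1<..} (em_ker v)"
    using assms by (intro set_integrable_em_ker_pos) auto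
  ultimately have "set_integrable lborel ({0<..1} \<union> {1<..}) (em_ker v)"
    by (rule set_integrable_Un) auto
  moreover have "{0<..1} \<union> {1<..} = {0::real<..}" by auto
  ultimately show ?thesis using True by simp
qed (use assms set_integrable_em_ker_pos in auto)

definition em_int :: "complex \<Rightarrow> real \<Rightarrow> complex" where
  "em_int v a = (LINT x:{a<..}|lborel. em_ker v x)"

text \<open>
  \<open>em_term v n\<close> is the error of the trapezoidal rule for \<open>x powr (-v)\<close> on \<open>[n, n + 1]\<close>, and
  \<open>em_rem v m\<close> is its sum over \<open>n \<ge> m\<close>. For \<open>m = 0\<close> and \<open>Re v < 0\<close> the value \<open>0 powr (-v) = 0\<close> is the
  correct one.
\<close>
definition em_rem :: "complex \<Rightarrow> nat \<Rightarrow> complex" where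
  "em_rem v m = - v * (v + 1) * em_int v (real m)"

definition em_term :: "complex \<Rightarrow> nat \<Rightarrow> complex" where
  "em_term v n = (of_nat n powr (- v) + of_nat (Suc n) powr (- v)) / 2
     + (of_nat (Suc n) powr (1 - v) - of_nat n powr (1 - v)) / (v - 1)"

lemma em_int_bound:
  assumes "a > 0" "Re v > -1"
  shows "norm (em_int v a) \<le> a powr (- Re v - 1) / (8 * (Re v + 1))"
proof -
  have "norm (em_int v a) \<le> (LINT x:{a<..}|lborel. 1/8 * x powr (- Re v - 2))"
    unfolding em_int_def
  proof (rule order.trans[OF set_integral_norm_bound])
    show "set_integrable lborel {a<..} (em_ker v)" using assms by (intro set_integrable_em_ker) auto
    then have "set_integrable lborel {a<..} (\<lambda>x. norm (em_ker v x))" by (rule set_integrable_norm)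
    then show "(LINT x:{a<..}|lborel. norm (em_ker v x)) \<le> (LINT x:{a<..}|lborel. 1/8 * x powr (- Re v - 2))"
      using assms
      by (intro set_integral_mono set_integrable_mult_right set_integrable_powr_at_top)
         (auto intro!: norm_em_ker_le[simplified])
  qed
  also have "\<dots> = 1/8 * (- (a powr (- Re v - 2 + 1)) / (- Re v - 2 + 1))"
    using assms by (subst set_integral_mult_right, subst set_integrable_powr_at_top) auto
  also have "\<dots> = a powr (- Re v - 1) / (8 * (Re v + 1))"
  proof -
    define r where "r = Re v + 1"
    have e: "- Re v - 2 + 1 = - r" "- Re v - 1 = - r" "Re v + 1 = r" by (simp_all add: r_def)
    show ?thesis unfolding e by simp
  qed
  finally show ?thesis .
qed

lemma em_ker_FTC:
  assumes "Re v > -1" "n = 0 \<Longrightarrow> Re v < 0" "v \<noteq> 1"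
  shows "((\<lambda>x. v * (v + 1) * em_ker v x) has_integral - em_term v n) {real n..real (Suc n)}"
proof -
  let ?n = "of_nat n :: complex"
  define c where "c = 1 / (v - 1)"
  define h where "h = - v / 2"
  define k where "k = (1/2 :: complex)"
  have c: "c * (1 - v) = -1" using assms by (simp add: c_def field_simps)
  \<comment> \<open>Two integrations by parts. With p(x) = (x - n)(x - n - 1) / 2 and f(x) = x powr
    (-v), this is p f' - p' f plus a primitive of f, and its derivative is p f'' because p'' =
    1.\<close>
  define G where "G = (\<lambda>x::complex. h * ((x - ?n) * (x - ?n - 1)) * x powr (- v - 1)
      - (x - ?n - k) * x powr (- v) - c * x powr (1 - v))"
  define p where "p = (\<lambda>x::real. of_real ((x - real n) * (x - real n - 1) / 2) :: complex)"
  have "((\<lambda>x. v * (v + 1) * (p x * of_real x powr (- v - 2))) has_integral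
          G (of_real (real (Suc n))) - G (of_real (real n))) {real n..real (Suc n)}"
  proof (rule fundamental_theorem_of_calculus_interior)
    fix x assume x: "x \<in> {real n<..<real (Suc n)}"
    define z where "z = complex_of_real x"
    have z: "z \<notin> \<real>\<^sub>\<le>\<^sub>0" "z \<noteq> 0" using x by (auto simp: z_def complex_nonpos_Reals_iff)
    have pw: "z powr (- v) = z * z powr (- v - 1)" "z powr (- v - 1) = z * z powr (- v - 2)"
    proof -
      have "z powr (1 + (- v - 1)) = z * z powr (- v - 1)" "z powr (1 + (- v - 2)) = z * z powr (- v - 2)"
        using z(2) by (simp_all only: powr_add) simp_all
      moreover have "1 + (- v - 1) = - v" "1 + (- v - 2) = - v - 1" by simp_all
      ultimately show "z powr (- v) = z * z powr (- v - 1)" "z powr (- v - 1) = z * z powr (- v - 2)"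
        by (simp_all only:)
    qed
    have e: "- v - 1 - 1 = - v - 2" "1 - v - 1 = - v" by simp_all
    have d: "((\<lambda>x. x powr a) has_field_derivative a * z powr (a - 1)) (at z)" for a
      using z by (auto intro!: derivative_eq_intros)
    note d1 = d[of "- v - 1", unfolded e] and d2 = d[of "- v"] and d3 = d[of "1 - v", unfolded e]
    have "(G has_field_derivative
        (h * ((z - ?n - 1) + (z - ?n))) * z powr (- v - 1)
             + h * ((z - ?n) * (z - ?n - 1)) * ((- v - 1) * z powr (- v - 2))
        - (z powr (- v) + (z - ?n - k) * (- v * z powr (- v - 1)))
        - c * ((1 - v) * z powr (- v))) (at z)"
      unfolding G_def by (rule derivative_eq_intros d1 d2 d3 refl)+ (simp add: algebra_simps)
    also have "(h * ((z - ?n - 1) + (z - ?n))) * z powr (- v - 1)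
             + h * ((z - ?n) * (z - ?n - 1)) * ((- v - 1) * z powr (- v - 2))
        - (z powr (- v) + (z - ?n - k) * (- v * z powr (- v - 1)))
        - c * ((1 - v) * z powr (- v))
       = v * (v + 1) * (((z - ?n) * (z - ?n - 1) / 2) * z powr (- v - 2))"
    proof -
      have *: "c * ((1 - v) * z powr (- v)) = - (z powr (- v))"
        using c by (metis mult.assoc mult_minus1)
      show ?thesis unfolding * unfolding pw h_def k_def by (simp add: field_simps)
    qed
    finally have "(G has_field_derivative v * (v + 1) * (p x * of_real x powr (- v - 2))) (at (of_real x))"
      by (simp add: p_def z_def)
    then show "((\<lambda>x. G (of_real x)) has_vector_derivative v * (v + 1) * (p x * of_real x powr (- v - 2))) (at x)"
      by (rule has_vector_derivative_real_field)
  next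
    show "continuous_on {real n..real (Suc n)} (\<lambda>x. G (of_real x))"
    proof (cases "n = 0")
      case False
      then show ?thesis unfolding G_def
        by (intro continuous_intros) (auto simp: subset_iff)
    next
      case True
      \<comment> \<open>At n = 0 the factor x of p absorbs one power of the singular x powr (-v -
        1); what remains is continuous at 0 because Re v < 0.\<close>
      have "continuous_on {0..1::real} (\<lambda>x. h * (of_real x - 1) * of_real x powr (- v)
          - (of_real x - k) * of_real x powr (- v) - c * of_real x powr (1 - v))"
        using assms True by (intro continuous_intros) auto
      moreover have "of_real x powr (- v) = of_real x * of_real x powr (- v - 1)" for x
        using powr_add[of "of_real x" 1 "- v - 1"] by (cases "x = 0") (simp_all add: algebra_simps)
      ultimately show ?thesis unfolding G_def using True
        by (auto elim!: continuous_on_eq simp: algebra_simps)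
    qed
  qed auto
  moreover have "G (of_real (real (Suc n))) - G (of_real (real n)) = - em_term v n"
    by (simp add: G_def em_term_def c_def k_def diff_divide_distrib add_divide_distrib)
  moreover have "v * (v + 1) * em_ker v x = v * (v + 1) * (p x * of_real x powr (- v - 2))"
    if "x \<in> {real n..real (Suc n)}" for x
  proof -
    have "P2 x = (x - real n) * (x - real n - 1) / 2" using that by (intro P2_eq) auto
    then show ?thesis by (simp only: em_ker_def p_def)
  qed
  ultimately show ?thesis by (metis (no_types, lifting) has_integral_eq)
qed

lemma em_rem_step:
  assumes "Re v > -1" "n = 0 \<Longrightarrow> Re v < 0" "v \<noteq> 1"
  shows "em_rem v n - em_rem v (Suc n) = em_term v n"
proof -
  have i: "set_integrable lborel {real n<..} (em_ker v)"
    using assms by (intro set_integrable_em_ker) auto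
  have i1: "set_integrable lborel {real n<..real (Suc n)} (em_ker v)"
    by (rule set_integrable_subset[OF i]) auto
  have i2: "set_integrable lborel {real (Suc n)<..} (em_ker v)"
    by (rule set_integrable_subset[OF i]) auto
  have "em_int v (real n) = (LINT x:{real n<..real (Suc n)} \<union> {real (Suc n)<..}|lborel. em_ker v x)"
    unfolding em_int_def by (rule arg_cong[where f = "\<lambda>A. set_lebesgue_integral lborel A (em_ker v)"]) auto
  also have "\<dots> = (LINT x:{real n<..real (Suc n)}|lborel. em_ker v x) + em_int v (real (Suc n))"
    unfolding em_int_def by (rule set_integral_Un[OF _ i1 i2]) auto
  finally have "v * (v + 1) * (em_int v (real n) - em_int v (real (Suc n)))
      = (LINT x:{real n<..real (Suc n)}|lborel. v * (v + 1) * em_ker v x)" by simp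
  also have "\<dots> = integral {real n<..real (Suc n)} (\<lambda>x. v * (v + 1) * em_ker v x)"
    by (intro set_borel_integral_eq_integral set_integrable_mult_right i1)
  also have "\<dots> = integral {real n..real (Suc n)} (\<lambda>x. v * (v + 1) * em_ker v x)"
    by (intro integral_subset_negligible) (auto intro: negligible_subset[of "{real n}"])
  also have "\<dots> = - em_term v n" using em_ker_FTC[OF assms] by (rule integral_unique)
  finally show ?thesis by (simp add: em_rem_def algebra_simps)
qed

lemma em_rem_bound:
  assumes "m > 0" "Re v > -1"
  shows "norm (em_rem v m) \<le> norm v * norm (v + 1) * (real m powr (- Re v - 1) / (8 * (Re v + 1)))"
  unfolding em_rem_def norm_mult norm_minus_cancel
  using assms by (intro mult_left_mono em_int_bound) auto

lemma em_term_bound: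
  assumes "n > 0" "Re v > -1" "v \<noteq> 1"
  shows "norm (em_term v n) \<le> norm v * norm (v + 1) * real n powr (- Re v - 2)"
proof -
  have "norm (- em_term v n) \<le> (norm v * norm (v + 1) * real n powr (- Re v - 2)) * measure lborel {real n..real (Suc n)}"
  proof (rule has_integral_bound_real[OF _ finite.emptyI em_ker_FTC])
    fix x assume x: "x \<in> {real n..real (Suc n)} - {}"
    have "norm (em_ker v x) \<le> 1 * real n powr (- Re v - 2)"
    proof -
      have "\<bar>P2 x\<bar> \<le> 1" using P2_bound[of x] by linarith
      moreover have "x powr (- Re v - 2) \<le> real n powr (- Re v - 2)"
        using x assms by (intro powr_mono2') auto
      ultimately have "\<bar>P2 x\<bar> * x powr (- Re v - 2) \<le> 1 * real n powr (- Re v - 2)"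
        by (rule mult_mono) auto
      then show ?thesis using x assms by (subst norm_em_ker) auto
    qed
    then show "norm (v * (v + 1) * em_ker v x) \<le> norm v * norm (v + 1) * real n powr (- Re v - 2)"
      by (simp add: norm_mult mult_left_mono)
  qed (use assms in auto)
  then show ?thesis by simp
qed

section \<open>The Euler--Maclaurin formula for zeta, continued to Re v > -1\<close>

lemma em_rem_tendsto:
  assumes "Re v > -1"
  shows "(\<lambda>m. em_rem v (Suc m)) \<longlonglongrightarrow> 0"
proof (rule Lim_null_comparison)
  show "\<forall>\<^sub>F m in sequentially. norm (em_rem v (Suc m))
     \<le> norm v * norm (v + 1) * (real (Suc m) powr (- Re v - 1) / (8 * (Re v + 1)))"
    using assms by (intro always_eventually allI em_rem_bound) auto
  have "(\<lambda>m. real (Suc m) powr (- Re v - 1)) \<longlonglongrightarrow> 0" using assms by real_asymp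
  then show "(\<lambda>m. norm v * norm (v + 1) * (real (Suc m) powr (- Re v - 1) / (8 * (Re v + 1)))) \<longlonglongrightarrow> 0"
    by (intro tendsto_mult_right_zero tendsto_divide_zero)
qed

lemma em_term_sums:
  assumes "Re v > -1" "v \<noteq> 1"
  shows "(\<lambda>n. em_term v (Suc n)) sums em_rem v 1"
proof -
  have "(\<lambda>n. em_rem v (Suc n) - em_rem v (Suc (Suc n))) sums (em_rem v (Suc 0) - 0)"
    by (rule telescope_sums'[OF em_rem_tendsto[OF assms(1)]])
  then show ?thesis using assms by (simp add: em_rem_step)
qed

text \<open>Summed over n, the endpoint averages contribute (\<zeta>(v) + \<zeta>(v) - 1) / 2 and
  the integrals telescope to -1 / (v - 1).\<close>

lemma riemann_zeta_em_term_series: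
  assumes "Re v > 1"
  shows "riemann_zeta v = 1 / (v - 1) + 1 / 2 + (\<Sum>n. em_term v (Suc n))"
proof -
  have z: "(\<lambda>n. of_nat (Suc n) powr (- v)) sums riemann_zeta v" by (rule riemann_zeta_sums[OF assms])
  then have z1: "(\<lambda>n. of_nat (Suc (Suc n)) powr (- v)) sums (riemann_zeta v - 1)"
    by (subst sums_Suc_iff) simp
  have lim: "(\<lambda>n. of_nat (Suc n) powr (1 - v) :: complex) \<longlonglongrightarrow> 0"
  proof -
    have "(\<lambda>n. real (Suc n) powr (1 - Re v)) \<longlonglongrightarrow> 0"
      using assms by real_asymp
    then show ?thesis by (subst tendsto_norm_zero_iff[symmetric], subst norm_powr_real_powr) auto
  qed
  have "(\<lambda>n. of_nat (Suc (Suc n)) powr (1 - v) - of_nat (Suc n) powr (1 - v) :: complex) sums (0 - of_nat (Suc 0) powr (1 - v))"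
    by (rule telescope_sums[OF lim])
  then have "(\<lambda>n. em_term v (Suc n)) sums ((riemann_zeta v + (riemann_zeta v - 1)) / 2 + (0 - of_nat (Suc 0) powr (1 - v)) / (v - 1))"
    unfolding em_term_def by (intro sums_add sums_divide z z1)
  then show ?thesis by (simp add: sums_iff field_simps)
qed

text \<open>Each trapezoidal error is O(n powr (- Re v - 2)), so their series is holomorphic for Re
  v > -1 away from 1, and the identity theorem extends the formula from Re v > 1.\<close>

lemma riemann_zeta_em1:
  assumes "Re v > -1" "v \<noteq> 1"
  shows "riemann_zeta v = 1 / (v - 1) + 1 / 2 + em_rem v 1"
proof -
  let ?S = "{v. Re v > -1} - {1::complex}"
  have oS: "open ?S" by (intro open_Diff open_halfspace_Re_gt) auto
  have "(\<lambda>v. \<Sum>n. em_term v (Suc n)) holomorphic_on ?S"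
  proof (rule holomorphic_suminf[OF oS])
    show "(\<lambda>v. em_term v (Suc n)) holomorphic_on ?S" for n
      unfolding em_term_def by (intro holomorphic_intros) auto
    fix s assume s: "s \<in> ?S"
    define d where "d = (Re s + 1) / 2"
    have d: "d > 0" "Re s - d > - 1" using s by (auto simp: d_def field_simps)
    have "compact ((\<lambda>v. v * (v + 1)) ` cball s d)"
      by (intro compact_continuous_image continuous_intros) auto
    then obtain C where C: "\<And>y. y \<in> cball s d \<Longrightarrow> norm (y * (y + 1)) \<le> C"
      by (meson bounded_iff compact_imp_bounded imageI)
    have C0: "C \<ge> 0" using C[of s] d norm_ge_zero order_trans by (metis centre_in_cball less_imp_le)
    have "summable (\<lambda>n. real n powr (- (Re s - d) - 2))"
      using d by (simp add: summable_real_powr_iff)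
    then have "summable (\<lambda>n. C * real (Suc n) powr (- (Re s - d) - 2))"
      by (intro summable_mult) (subst summable_Suc_iff)
    moreover have "norm (em_term y (Suc n)) \<le> C * real (Suc n) powr (- (Re s - d) - 2)"
      if y: "y \<in> cball s d \<inter> ?S" for n y
    proof -
      have "\<bar>Re s - Re y\<bar> \<le> d" using y abs_Re_le_cmod[of "s - y"] by (auto simp: dist_norm)
      then have "real (Suc n) powr (- Re y - 2) \<le> real (Suc n) powr (- (Re s - d) - 2)"
        by (intro powr_mono) auto
      moreover have "norm y * norm (y + 1) \<le> C" using C[of y] y by (simp add: norm_mult)
      moreover have "norm (em_term y (Suc n)) \<le> norm y * norm (y + 1) * real (Suc n) powr (- Re y - 2)"
        using y by (intro em_term_bound) auto
      ultimately show ?thesis using C0 by (meson mult_mono order_trans powr_ge_zero)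
    qed
    ultimately show "\<exists>d>0. \<exists>M. summable M \<and> (\<forall>n. \<forall>y \<in> cball s d \<inter> ?S. norm (em_term y (Suc n)) \<le> M n)"
      using d(1) by blast
  qed
  then have hol: "(\<lambda>v. 1 / (v - 1) + 1 / 2 + (\<Sum>n. em_term v (Suc n))) holomorphic_on ?S"
    by (intro holomorphic_intros) auto
  have "riemann_zeta v = 1 / (v - 1) + 1 / 2 + (\<Sum>n. em_term v (Suc n))"
  proof (rule analytic_continuation_open[OF _ oS _ _ _ _ hol, of "{s. Re s > 1}"])
    show "{s::complex. Re s > 1} \<noteq> {}" by (auto intro!: exI[of _ 2])
    show "connected ?S"
      by (intro connected_open_delete convex_connected convex_halfspace_Re_gt open_halfspace_Re_gt) auto
    show "riemann_zeta holomorphic_on ?S"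
      by (rule holomorphic_on_subset[OF holomorphic_riemann_zeta]) auto
  qed (use assms riemann_zeta_em_term_series in \<open>auto simp: open_halfspace_Re_gt\<close>)
  then show ?thesis using em_term_sums[OF assms] by (simp add: sums_iff)
qed

lemma riemann_zeta_em:
  assumes "Re v > -1" "v \<noteq> 1" "m \<ge> 1"
  shows "riemann_zeta v = (\<Sum>k=1..m. of_nat k powr (- v)) + of_nat m powr (1 - v) / (v - 1)
           - of_nat m powr (- v) / 2 + em_rem v m"
  using assms(3)
proof (induction m rule: dec_induct)
  case base
  then show ?case using riemann_zeta_em1[OF assms(1,2)] by simp
next
  case (step m)
  have "em_rem v m - em_rem v (Suc m) = em_term v m"
    using step assms by (intro em_rem_step) auto
  then have *: "em_rem v m = em_rem v (Suc m) + em_term v m" by (simp add: algebra_simps)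
  show ?case unfolding step.IH * using step.hyps
    by (simp add: em_term_def add_divide_distrib diff_divide_distrib del: of_nat_Suc)
qed

text \<open>Both 0 powr (-v) and 0 powr (1 - v) vanish, so \<open>em_term v 0\<close> equals 1 / (v
  - 1) + 1 / 2 and absorbs the elementary terms. On this strip zeta is therefore, up to the factor
  -v (v + 1), a pure Mellin transform of \<open>P2\<close>.\<close>

lemma riemann_zeta_em0:
  assumes "Re v > -1" "Re v < 0"
  shows "riemann_zeta v = em_rem v 0"
proof -
  have v: "v \<noteq> 1" using assms by auto
  have "em_rem v 0 = em_rem v 1 + em_term v 0"
    using em_rem_step[of v 0] assms v by (simp add: algebra_simps)
  also have "em_term v 0 = 1 / (v - 1) + 1 / 2"
    using assms v by (simp add: em_term_def)
  finally show ?thesis using riemann_zeta_em1[OF assms(1) v] by simp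
qed

text \<open>By periodicity of \<open>P2\<close>, the number m survives only in the power. This is
  the shape in which Mellin--Barnes delivers the integral.\<close>

lemma em_int_shift:
  "em_int v (real m) = (LINT x:{0<..}|lborel. of_real (P2 x) * of_real (real m + x) powr (- v - 2))"
proof -
  have "em_int v (real m) = (LBINT x. indicator {real m<..} (real m + x) *\<^sub>R em_ker v (real m + x))"
    unfolding em_int_def set_lebesgue_integral_def
    by (subst lborel_integral_real_affine[where c = 1 and t = "real m"]) auto
  also have "\<dots> = (LBINT x. indicator {0<..} x *\<^sub>R (of_real (P2 x) * of_real (real m + x) powr (- v - 2)))"
    by (intro Bochner_Integration.integral_cong) (auto simp: em_ker_def P2_add_nat indicator_def)
  finally show ?thesis unfolding set_lebesgue_integral_def .
qed

section \<open>Special values and growth of the zeta function\<close>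

text \<open>The remainder carries the factor v and so vanishes at v = 0.\<close>

lemma riemann_zeta_0: "riemann_zeta 0 = - 1 / 2"
  using riemann_zeta_em1[of 0] by (simp add: em_rem_def)

text \<open>The quadratic growth is that of the factor v (v + 1) in front of the remainder integral.
  This crude bound suffices because Gamma decays vertically to any power.\<close>

lemma riemann_zeta_growth:
  assumes "a > -1"
  shows "\<exists>C\<ge>0. \<forall>v. a \<le> Re v \<and> Re v \<le> b \<and> \<bar>Im v\<bar> \<ge> 1 \<longrightarrow> norm (riemann_zeta v) \<le> C * (Im v)\<^sup>2"
proof -
  define R where "R = \<bar>a\<bar> + \<bar>b\<bar> + 2"
  define C where "C = 3 / 2 + R * R / (8 * (a + 1))"
  have "norm (riemann_zeta v) \<le> C * (Im v)\<^sup>2" if v: "a \<le> Re v" "Re v \<le> b" "\<bar>Im v\<bar> \<ge> 1" for v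
  proof -
    let ?y = "\<bar>Im v\<bar>"
    have v1: "v \<noteq> 1" using v by auto
    have n0: "norm v \<le> R * ?y" "norm (v + 1) \<le> R * ?y"
    proof -
      define A where "A = \<bar>a\<bar> + \<bar>b\<bar> + 1"
      have A: "\<bar>Re v\<bar> \<le> A" "\<bar>Re v + 1\<bar> \<le> A" using v by (auto simp: A_def)
      have "A * 1 \<le> A * ?y" using v by (intro mult_left_mono) (auto simp: A_def)
      moreover have "norm v \<le> \<bar>Re v\<bar> + ?y" "norm (v + 1) \<le> \<bar>Re v + 1\<bar> + ?y"
        using cmod_le[of v] cmod_le[of "v + 1"] by auto
      moreover have "R * ?y = A * ?y + ?y" by (simp add: R_def A_def algebra_simps)
      ultimately have "norm v \<le> R * ?y \<and> norm (v + 1) \<le> R * ?y" using A by (intro conjI) linarith+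
      then show "norm v \<le> R * ?y" "norm (v + 1) \<le> R * ?y" by auto
    qed
    have y2: "1 \<le> ?y\<^sup>2" using v(3) by (rule one_le_power)
    have n1: "norm (1 / (v - 1)) \<le> 1"
    proof -
      have "1 \<le> norm (v - 1)" using v(3) abs_Im_le_cmod[of "v - 1"] by simp
      then show ?thesis unfolding norm_divide norm_one by (intro divide_le_eq_1_pos[THEN iffD2]) auto
    qed
    have "norm (em_rem v 1) \<le> norm v * norm (v + 1) * (real 1 powr (- Re v - 1) / (8 * (Re v + 1)))"
      using v assms by (intro em_rem_bound) auto
    also have "\<dots> \<le> (R * ?y) * (R * ?y) * (1 / (8 * (a + 1)))"
      using v assms n0 by (intro mult_mono) (auto intro!: divide_left_mono simp: R_def)
    also have "\<dots> = R * R / (8 * (a + 1)) * ?y\<^sup>2" by (simp add: power2_eq_square)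
    finally have n2: "norm (em_rem v 1) \<le> R * R / (8 * (a + 1)) * ?y\<^sup>2" .
    have "norm (riemann_zeta v) \<le> norm (1 / (v - 1)) + norm (1 / 2 :: complex) + norm (em_rem v 1)"
      using v assms v1 by (subst riemann_zeta_em1) (auto intro!: order.trans[OF norm_triangle_ineq] add_right_mono norm_triangle_ineq)
    also have "\<dots> \<le> 3 / 2 * ?y\<^sup>2 + R * R / (8 * (a + 1)) * ?y\<^sup>2"
      using n1 n2 y2 by simp
    also have "\<dots> = C * (Im v)\<^sup>2" by (simp add: C_def algebra_simps)
    finally show ?thesis .
  qed
  moreover have "C \<ge> 0" using assms by (simp add: C_def R_def)
  ultimately show ?thesis by blast
qed

text \<open>A way to evaluate derivatives of zeta without differentiating the remainder integral.
  Applied to zeta minus its Euler--Maclaurin formula truncated at level m, it bounds the error in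
  the derivative by a K that tends to 0 as m grows.\<close>

lemma norm_deriv_le:
  fixes f :: "complex \<Rightarrow> complex"
  assumes f: "(f has_field_derivative D) (at x)" and f0: "f x = 0" and d: "d > 0"
    and b: "\<And>z. norm (z - x) < d \<Longrightarrow> z \<noteq> x \<Longrightarrow> norm (f z) \<le> K * norm (z - x)"
  shows "norm D \<le> K"
proof -
  have "((\<lambda>z. (f z - f x) / (z - x)) \<longlongrightarrow> D) (at x)"
    using f by (simp add: has_field_derivative_iff)
  then show ?thesis
  proof (rule Lim_norm_ubound[rotated])
    show "\<forall>\<^sub>F z in at x. norm ((f z - f x) / (z - x)) \<le> K"
      unfolding eventually_at using d b f0
      by (intro exI[of _ d]) (auto simp: dist_norm norm_divide divide_le_eq)
  qed auto
qed

text \<open>The value 1 at the point 1 is the residue of the pole of zeta, so the singularity is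
  genuinely removed.\<close>

definition zeta_Z :: "complex \<Rightarrow> complex" where
  "zeta_Z s = (if s = 1 then 1 else (s - 1) * riemann_zeta s)"

lemma em_rem_bound_near_1:
  assumes "norm (z - 1) < 1" "m \<ge> 1"
  shows "norm (em_rem z m) \<le> 1 / real m"
proof -
  have z: "Re z > 0" using assms abs_Re_le_cmod[of "z - 1"] by auto
  have n: "norm z \<le> 2" "norm (z + 1) \<le> 3"
    using assms(1) norm_triangle_ineq[of "z - 1" 1] norm_triangle_ineq[of "z - 1" 2]
    by (simp_all add: add.commute[of z 1])
  have "norm (em_rem z m) \<le> norm z * norm (z + 1) * (real m powr (- Re z - 1) / (8 * (Re z + 1)))"
    using z assms by (intro em_rem_bound) auto
  also have "\<dots> \<le> (2 * 3) * (real m powr (-1) / 8)"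
    using z assms n by (intro mult_mono frac_le powr_mono) auto
  also have "\<dots> \<le> 1 / real m" using assms by (simp add: powr_minus field_simps)
  finally show ?thesis .
qed

lemma holomorphic_zeta_Z: "zeta_Z holomorphic_on UNIV"
proof -
  obtain Z where Z: "Z holomorphic_on UNIV" "\<And>s. s \<noteq> 1 \<Longrightarrow> riemann_zeta s = Z s / (s - 1)"
    using riemann_zeta_entire by blast
  have eq: "zeta_Z s = Z s" if "s \<noteq> 1" for s using Z(2)[OF that] that by (simp add: zeta_Z_def)
  have "isCont Z 1" using Z(1) by (meson holomorphic_on_imp_differentiable_at open_UNIV UNIV_I field_differentiable_imp_continuous_at)
  then have "(Z \<longlongrightarrow> Z 1) (at 1)" by (simp add: isCont_def)
  \<comment> \<open>The defining property of Z says nothing at the point 1 itself; the value there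
    is the limit read off from the Euler--Maclaurin formula with m = 1.\<close>
  moreover have "(Z \<longlongrightarrow> 1) (at 1)"
  proof -
    have "((\<lambda>z. Z z - 1) \<longlongrightarrow> 0) (at 1)"
    proof (rule Lim_null_comparison)
      show "\<forall>\<^sub>F z in at 1. norm (Z z - 1) \<le> norm (z - 1) * 2"
        unfolding eventually_at
      proof (intro exI[of _ 1] conjI ballI impI)
        fix z :: complex assume z: "z \<noteq> 1 \<and> dist z 1 < 1"
        then have b: "norm (z - 1) < 1" by (simp add: dist_norm)
        then have "Re z > -1" using abs_Re_le_cmod[of "z - 1"] by auto
        then have "Z z - 1 = (z - 1) * (1 / 2 + em_rem z 1)"
        proof -
          have *: "(z - 1) * (q + h + e) - 1 = (z - 1) * (h + e)" if "(z - 1) * q = 1" for q h e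
            using that by algebra
          have "Z z = (z - 1) * riemann_zeta z" using eq[of z] z by (simp add: zeta_Z_def)
          also have "\<dots> = (z - 1) * (1 / (z - 1) + 1 / 2 + em_rem z 1)"
          proof -
            have "riemann_zeta z = 1 / (z - 1) + 1 / 2 + em_rem z 1"
              by (rule riemann_zeta_em1) (use z \<open>Re z > -1\<close> in auto)
            then show ?thesis by (simp only:)
          qed
          finally show ?thesis using *[of "1 / (z - 1)"] z by (simp only:) simp
        qed
        moreover have "norm (1 / 2 + em_rem z 1) \<le> 2"
          using em_rem_bound_near_1[OF b, of 1] norm_triangle_ineq[of "1/2" "em_rem z 1"] by simp
        ultimately show "norm (Z z - 1) \<le> norm (z - 1) * 2"
          by (simp add: norm_mult mult_left_mono)
      qed auto
      show "((\<lambda>z. norm (z - 1) * 2) \<longlongrightarrow> 0) (at (1::complex))"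
        by (auto intro!: tendsto_eq_intros)
    qed
    then show ?thesis by (simp add: LIM_zero_iff)
  qed
  ultimately have "Z 1 = 1" using tendsto_unique trivial_limit_at by blast
  then have "zeta_Z = Z" using eq by (auto simp: zeta_Z_def fun_eq_iff)
  then show ?thesis using Z(1) by simp
qed

section \<open>First-order data of zeta at 1 and at 0\<close>

lemma has_field_derivative_powr_diff:
  "w \<noteq> 0 \<Longrightarrow> ((\<lambda>z. w powr (c - z)) has_field_derivative - (Ln w * w powr (c - x))) (at (x :: complex))"
  unfolding powr_def by (auto intro!: derivative_eq_intros)

lemma has_field_derivative_powr_minus:
  "w \<noteq> 0 \<Longrightarrow> ((\<lambda>z. w powr (- z)) has_field_derivative - (Ln w * w powr (- x))) (at (x :: complex))"
  using has_field_derivative_powr_diff[of w 0] by simp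

text \<open>The formula truncated at level m has derivative H_m - ln m - 1 / (2m) at 1, within 1 / m
  of the true one; the limit is the Euler constant.\<close>

lemma deriv_zeta_Z_1: "deriv zeta_Z 1 = euler_mascheroni"
proof -
  have der: "(zeta_Z has_field_derivative deriv zeta_Z 1) (at 1)"
    using holomorphic_zeta_Z by (intro holomorphic_derivI[of _ UNIV]) auto
  have b: "norm (deriv zeta_Z 1 - (harm m - of_real (ln (real m)) - 1 / (2 * of_nat m))) \<le> 1 / real m" if m: "m \<ge> 1" for m
  proof (rule norm_deriv_le)
    \<comment> \<open>The Euler--Maclaurin formula at level m, multiplied by z - 1 and stripped of
      its remainder.\<close>
    define E :: "complex \<Rightarrow> complex" where "E = (\<lambda>z. (z - 1) * (\<Sum>k=1..m. of_nat k powr (- z)) + of_nat m powr (1 - z) - (z - 1) * (of_nat m powr (- z) / 2))"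
    have m0: "complex_of_nat m \<noteq> 0" using m by simp
    have h: "(\<Sum>k=1..m. of_nat k powr (- 1 :: complex)) = harm m"
      unfolding harm_def by (intro sum.cong) (auto simp: powr_minus inverse_eq_divide)
    have d: "((\<lambda>z. \<Sum>k=1..m. of_nat k powr (- z)) has_field_derivative (\<Sum>k=1..m. - (Ln (of_nat k) * of_nat k powr (- 1)))) (at (1::complex))"
      by (intro DERIV_sum has_field_derivative_powr_minus) auto
    have d1: "((\<lambda>z. of_nat m powr (1 - z)) has_field_derivative - Ln (of_nat m)) (at (1::complex))"
      using has_field_derivative_powr_diff[OF m0, of 1 1] m0 by simp
    have d2: "((\<lambda>z. (z - 1) * (of_nat m powr (- z) / 2)) has_field_derivative of_nat m powr (- 1) / 2) (at (1::complex))"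
      by (rule derivative_eq_intros has_field_derivative_powr_minus[OF m0] refl | simp)+
    have "(E has_field_derivative ((1 - 0) * harm m + (\<Sum>k=1..m. - (Ln (of_nat k) * of_nat k powr (- 1))) * (1 - 1)
        + - Ln (of_nat m) - of_nat m powr (- 1) / 2)) (at 1)"
      unfolding E_def h[symmetric]
      by (intro DERIV_add DERIV_diff DERIV_mult DERIV_ident DERIV_const d d1 d2)
    then have "(E has_field_derivative (harm m - Ln (of_nat m) - of_nat m powr (- 1) / 2)) (at 1)"
      by simp
    moreover have "Ln (of_nat m) = of_real (ln (real m))"
      using m Ln_of_real[of "real m"] by simp
    moreover have "of_nat m powr (- 1 :: complex) / 2 = 1 / (2 * of_nat m)"
      using m0 by (simp add: powr_minus field_simps)
    ultimately have "(E has_field_derivative (harm m - of_real (ln (real m)) - 1 / (2 * of_nat m))) (at 1)"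
      by simp
    then show "((\<lambda>z. zeta_Z z - E z) has_field_derivative (deriv zeta_Z 1 - (harm m - of_real (ln (real m)) - 1 / (2 * of_nat m)))) (at 1)"
      by (intro DERIV_diff der)
    show "zeta_Z 1 - E 1 = 0" using m by (simp add: zeta_Z_def E_def)
    fix z :: complex assume z: "norm (z - 1) < 1" "z \<noteq> 1"
    have "Re z > -1" using z abs_Re_le_cmod[of "z - 1"] by auto
    then have "zeta_Z z - E z = (z - 1) * em_rem z m"
      using z riemann_zeta_em[of z m] m by (simp add: zeta_Z_def E_def field_simps)
    then show "norm (zeta_Z z - E z) \<le> 1 / real m * norm (z - 1)"
      using em_rem_bound_near_1[OF z(1) m] by (simp add: norm_mult mult.commute mult_left_mono del: mult_1)
        (metis mult_left_mono norm_ge_zero times_divide_eq_right mult.right_neutral)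
  qed simp
  have 1: "(\<lambda>m. deriv zeta_Z 1 - (harm m - of_real (ln (real m)) - 1 / (2 * of_nat m))) \<longlonglongrightarrow> 0"
  proof (rule Lim_null_comparison)
    show "\<forall>\<^sub>F m in sequentially. norm (deriv zeta_Z 1 - (harm m - of_real (ln (real m)) - 1 / (2 * of_nat m))) \<le> 1 / real m"
      using b eventually_ge_at_top[of 1] by (rule eventually_mono[rotated])
    show "(\<lambda>m. 1 / real m) \<longlonglongrightarrow> 0" by real_asymp
  qed
  have 2: "(\<lambda>m. deriv zeta_Z 1 - (of_real (harm m - ln (real m)) - 1 / (2 * of_nat m))) \<longlonglongrightarrow> deriv zeta_Z 1 - (of_real euler_mascheroni - 0)"
  proof (intro tendsto_diff tendsto_const tendsto_of_real)
    show "(\<lambda>m. harm m - ln (real m)) \<longlonglongrightarrow> euler_mascheroni" using euler_mascheroni_LIMSEQ by simp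
    have "(\<lambda>m. of_real (1 / (2 * real m)) :: complex) \<longlonglongrightarrow> of_real 0"
      by (intro tendsto_of_real) real_asymp
    then show "(\<lambda>m. 1 / (2 * of_nat m) :: complex) \<longlonglongrightarrow> 0" by simp
  qed
  have "deriv zeta_Z 1 - (of_real euler_mascheroni - 0) = 0"
    by (rule LIMSEQ_unique[OF 2[unfolded of_real_diff of_real_harm] 1])
  then show ?thesis by simp
qed

text \<open>The constant in Stirling's formula, from Wallis' product via \<open>2 a m - a (2 m)\<close>.\<close>
lemma stirling_wallis:
  assumes "(\<lambda>m. - ln (fact m) + real m * ln (real m) - real m + ln (real m) / 2) \<longlonglongrightarrow> L"
  shows "L = - ln (2 * pi) / 2"
proof -
  define a where "a = (\<lambda>m. - ln (fact m) + real m * ln (real m) - real m + ln (real m) / 2)"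
  define W where "W = (\<lambda>m. \<Prod>k=1..m. (4 * real k^2) / (4 * real k^2 - 1))"
  have Wpos: "W m > 0" for m
    unfolding W_def
  proof (intro prod_pos ballI divide_pos_pos)
    fix k assume k: "k \<in> {1..m}"
    then have "1 \<le> (real k)\<^sup>2" by (simp add: one_le_power)
    then show "0 < 4 * real k^2 - 1" "0 < 4 * real k^2" by linarith+
  qed
  \<comment> \<open>Wallis' product in terms of factorials, with denominators cleared so that
    induction and then logarithms apply directly.\<close>
  have W: "W m * ((fact (2 * m))\<^sup>2 * (2 * real m + 1)) = (4 ^ m * (fact m)\<^sup>2)\<^sup>2" for m
  proof (induction m)
    case (Suc m)
    define x where "x = real (Suc m)"
    have x: "x \<ge> 1" by (simp add: x_def)
    define D E where "D = 2 * x - 1" and "E = 2 * x + 1"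
    have DE: "D \<noteq> 0" "E \<noteq> 0" using x by (auto simp: D_def E_def)
    have DE': "4 * x^2 - 1 = D * E" by (simp add: D_def E_def power2_eq_square algebra_simps)
    have "W (Suc m) = W m * ((4 * x^2) / (4 * x^2 - 1))" by (simp add: W_def x_def)
    note 1 = this[unfolded DE']
    have 2: "(fact (2 * Suc m) :: real) = (2 * x) * D * fact (2 * m)"
      by (simp add: x_def D_def algebra_simps)
    have 3: "2 * real (Suc m) + 1 = E" "2 * real m + 1 = D" by (simp_all add: x_def D_def E_def)
    have "W (Suc m) * ((fact (2 * Suc m))\<^sup>2 * (2 * real (Suc m) + 1))
        = 16 * x ^ 4 * (W m * ((fact (2 * m))\<^sup>2 * (2 * real m + 1)))"
      unfolding 1 2 3 using DE by (simp add: field_simps power2_eq_square power4_eq_xxxx)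
    also have "\<dots> = (4 ^ Suc m * (fact (Suc m))\<^sup>2)\<^sup>2"
      unfolding Suc.IH by (simp add: x_def power_mult_distrib power2_eq_square power4_eq_xxxx)
    finally show ?case .
  qed (simp add: W_def)
  have id: "2 * a m - a (2 * m) = - ln (W m) / 2 + ln (real m / (2 * real m + 1)) / 2 - ln 2 / 2" if m: "m \<ge> 1" for m
  proof -
    have "ln (W m * ((fact (2 * m))\<^sup>2 * (2 * real m + 1))) = ln ((4 ^ m * (fact m)\<^sup>2)\<^sup>2)"
      by (simp only: W)
    then have "ln (W m) + (2 * ln (fact (2 * m)) + ln (2 * real m + 1)) = 2 * (real m * ln 4 + 2 * ln (fact m))"
      using Wpos[of m] by (simp add: ln_mult ln_realpow)
    moreover have "ln (4::real) = 2 * ln 2" using ln_realpow[of 2 2] by simp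
    moreover have "ln (real m / (2 * real m + 1)) = ln (real m) - ln (2 * real m + 1)"
      using m by (simp add: ln_div)
    moreover have "ln (real (2 * m)) = ln 2 + ln (real m)" using m by (simp add: ln_mult)
    moreover from this have "a (2 * m) = - ln (fact (2 * m)) + 2 * (real m * ln 2) + 2 * (real m * ln (real m))
        - 2 * real m + ln 2 / 2 + ln (real m) / 2"
      unfolding a_def by (simp add: algebra_simps)
    moreover have "a m = - ln (fact m) + real m * ln (real m) - real m + ln (real m) / 2"
      by (simp add: a_def)
    ultimately show ?thesis by (simp only:) (simp add: field_simps)
  qed
  have "(\<lambda>m. 2 * a m - a (2 * m)) \<longlonglongrightarrow> 2 * L - L"
    using assms unfolding a_def[symmetric]
    by (intro tendsto_intros) (auto intro: filterlim_compose[OF _ mult_nat_left_at_top])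
  moreover have "(\<lambda>m. - ln (W m) / 2 + ln (real m / (2 * real m + 1)) / 2 - ln 2 / 2)
      \<longlonglongrightarrow> - ln (pi / 2) / 2 + ln (1 / 2) / 2 - ln 2 / 2"
  proof -
    have "W \<longlonglongrightarrow> pi / 2" unfolding W_def by (rule wallis)
    then have 1: "(\<lambda>m. ln (W m)) \<longlonglongrightarrow> ln (pi / 2)" by (rule tendsto_ln) simp
    have "(\<lambda>m. real m / (2 * real m + 1)) \<longlonglongrightarrow> 1 / 2" by real_asymp
    then have 2: "(\<lambda>m. ln (real m / (2 * real m + 1))) \<longlonglongrightarrow> ln (1 / 2)" by (rule tendsto_ln) simp
    show ?thesis by (intro tendsto_diff tendsto_add tendsto_divide tendsto_minus tendsto_const 1 2) auto
  qed
  then have "(\<lambda>m. 2 * a m - a (2 * m)) \<longlonglongrightarrow> - ln (pi / 2) / 2 + ln (1 / 2) / 2 - ln 2 / 2"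
    by (rule Lim_transform_eventually) (use id in \<open>auto intro!: eventually_mono[OF eventually_ge_at_top[of 1]]\<close>)
  ultimately have "2 * L - L = - ln (pi / 2) / 2 + ln (1 / 2) / 2 - ln 2 / 2"
    using LIMSEQ_unique by blast
  then show ?thesis by (simp add: ln_div ln_mult field_simps)
qed

text \<open>The truncated formula has derivative \<open>a m\<close> at 0, the logarithm of
  Stirling's approximation without its constant divided by m!, and \<open>stirling_wallis\<close>
  identifies the limit.\<close>

lemma deriv_zeta_0: "deriv riemann_zeta 0 = of_real (- ln (2 * pi) / 2)"
proof -
  define a where "a = (\<lambda>m. - ln (fact m) + real m * ln (real m) - real m + ln (real m) / 2)"
  have der: "(riemann_zeta has_field_derivative deriv riemann_zeta 0) (at 0)"
    using holomorphic_riemann_zeta by (intro holomorphic_derivI[of _ "- {1}"]) auto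
  have b: "norm (deriv riemann_zeta 0 - of_real (a m)) \<le> real m powr (- 1 / 2)" if m: "m \<ge> 1" for m
  proof (rule norm_deriv_le)
    define E :: "complex \<Rightarrow> complex" where "E = (\<lambda>z. (\<Sum>k=1..m. of_nat k powr (- z)) + of_nat m powr (1 - z) / (z - 1) - of_nat m powr (- z) / 2)"
    have m0: "complex_of_nat m \<noteq> 0" using m by simp
    have Ln: "Ln (of_nat k) = of_real (ln (real k))" if "k \<ge> 1" for k
      using that Ln_of_real[of "real k"] by simp
    have "(\<Sum>k=1..m. - Ln (of_nat k)) = (\<Sum>k=1..m. - complex_of_real (ln (real k)))"
      by (intro sum.cong) (auto simp: Ln)
    also have "\<dots> = of_real (- ln (fact m))"
    proof -
      have "ln (fact m :: real) = (\<Sum>k=1..m. ln (real k))"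
        unfolding fact_prod of_nat_prod by (rule ln_prod) auto
      then show ?thesis by (simp add: sum_negf)
    qed
    finally have s: "(\<Sum>k=1..m. - Ln (of_nat k)) = of_real (- ln (fact m))" .
    have "((\<lambda>z. \<Sum>k=1..m. of_nat k powr (- z)) has_field_derivative (\<Sum>k=1..m. - (Ln (of_nat k) * of_nat k powr (- 0)))) (at (0::complex))"
      by (intro DERIV_sum has_field_derivative_powr_minus) auto
    moreover have "(\<Sum>k=1..m. - (Ln (of_nat k) * of_nat k powr (- 0))) = (\<Sum>k=1..m. - Ln (of_nat k :: complex))"
      by (intro sum.cong) auto
    moreover have "((\<lambda>z. of_nat m powr (1 - z) / (z - 1)) has_field_derivative (of_nat m * Ln (of_nat m) - of_nat m)) (at (0::complex))"
    proof -
      have "((\<lambda>z. of_nat m powr (1 - z) / (z - 1)) has_field_derivative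
          (- (Ln (of_nat m) * of_nat m powr (1 - 0)) * (0 - 1) - of_nat m powr (1 - 0) * (1 - 0)) / ((0 - 1) * (0 - 1))) (at (0::complex))"
        by (intro DERIV_divide has_field_derivative_powr_diff m0 DERIV_diff DERIV_ident DERIV_const) simp
      then show ?thesis using m0 by (simp add: mult.commute)
    qed
    moreover have "((\<lambda>z. of_nat m powr (- z) / 2) has_field_derivative - (Ln (of_nat m) / 2)) (at (0::complex))"
      using DERIV_cdivide[OF has_field_derivative_powr_minus[OF m0, of 0], of 2] m0 by simp
    ultimately have "(E has_field_derivative (of_real (- ln (fact m)) + (of_nat m * Ln (of_nat m) - of_nat m) - (- (Ln (of_nat m) / 2)))) (at 0)"
      unfolding E_def s[symmetric] by (intro DERIV_add DERIV_diff) (simp_all only:)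
    also have "of_real (- ln (fact m)) + (of_nat m * Ln (of_nat m) - of_nat m) - (- (Ln (of_nat m) / 2)) = of_real (a m)"
      unfolding Ln[OF m] a_def by simp
    finally show "((\<lambda>z. riemann_zeta z - E z) has_field_derivative (deriv riemann_zeta 0 - of_real (a m))) (at 0)"
      by (intro DERIV_diff der)
    show "riemann_zeta 0 - E 0 = 0"
      using riemann_zeta_em[of 0 m] m by (simp add: E_def em_rem_def)
    fix z :: complex assume z: "norm (z - 0) < 1 / 2" "z \<noteq> 0"
    have Rz: "\<bar>Re z\<bar> < 1 / 2" using z abs_Re_le_cmod[of z] by auto
    then have z1: "z \<noteq> 1" "Re z > -1" by auto
    have "riemann_zeta z - E z = em_rem z m"
      using z1 riemann_zeta_em[of z m] m by (simp add: E_def)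
    \<comment> \<open>The factor \<open>norm z\<close> is the one that \<open>norm_deriv_le\<close>
      asks for. The radius 1/2 keeps Re z > -1/2, which leaves m powr (-1/2), a quantity tending to
      0.\<close>
    also have "norm \<dots> \<le> norm z * norm (z + 1) * (real m powr (- Re z - 1) / (8 * (Re z + 1)))"
      using z1 m by (intro em_rem_bound) auto
    also have "\<dots> \<le> norm z * 2 * (real m powr (- 1 / 2) / (8 * (1 / 2)))"
      using Rz m z norm_triangle_ineq[of z 1] by (intro mult_mono frac_le powr_mono) auto
    also have "\<dots> \<le> real m powr (- 1 / 2) * norm (z - 0)" by simp
    finally show "norm (riemann_zeta z - E z) \<le> real m powr (- 1 / 2) * norm (z - 0)" .
  qed simp
  have "(\<lambda>m. deriv riemann_zeta 0 - of_real (a m)) \<longlonglongrightarrow> 0"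
  proof (rule Lim_null_comparison)
    show "\<forall>\<^sub>F m in sequentially. norm (deriv riemann_zeta 0 - of_real (a m)) \<le> real m powr (- 1 / 2)"
      using b eventually_ge_at_top[of 1] by (rule eventually_mono[rotated])
    show "(\<lambda>m. real m powr (- 1 / 2)) \<longlonglongrightarrow> 0" by real_asymp
  qed
  then have "(\<lambda>m. deriv riemann_zeta 0 - (deriv riemann_zeta 0 - of_real (a m))) \<longlonglongrightarrow> deriv riemann_zeta 0 - 0"
    by (intro tendsto_intros)
  then have lim: "(\<lambda>m. complex_of_real (a m)) \<longlonglongrightarrow> deriv riemann_zeta 0" by simp
  have "a \<longlonglongrightarrow> Re (deriv riemann_zeta 0)" using tendsto_Re[OF lim] by simp
  then have "Re (deriv riemann_zeta 0) = - ln (2 * pi) / 2" unfolding a_def by (rule stirling_wallis)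
  moreover have "(\<lambda>m. 0 :: real) \<longlonglongrightarrow> Im (deriv riemann_zeta 0)" using tendsto_Im[OF lim] by simp
  then have "Im (deriv riemann_zeta 0) = 0" using LIMSEQ_unique tendsto_const by blast
  ultimately show ?thesis by (simp add: complex_eq_iff)
qed

section \<open>Fourier inversion\<close>

lemma integrable_prod_mult:
  fixes f g :: "real \<Rightarrow> 'a :: {real_normed_field, banach, second_countable_topology}"
  assumes f: "integrable lborel f" and g: "integrable lborel g"
  shows "integrable (lborel \<Otimes>\<^sub>M lborel) (\<lambda>(x, y). f x * g y)"
proof (rule lborel_pair.Fubini_integrable)
  have [measurable]: "f \<in> borel_measurable borel" "g \<in> borel_measurable borel" using f g by auto
  show "(\<lambda>(x, y). f x * g y) \<in> borel_measurable (lborel \<Otimes>\<^sub>M lborel)" by measurable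
  have "integrable lborel (\<lambda>x. norm (f x) * (LBINT y. norm (g y)))"
    using f by (intro integrable_mult_left integrable_norm)
  then show "integrable lborel (\<lambda>x. \<integral>y. norm (case (x, y) of (x, y) \<Rightarrow> f x * g y) \<partial>lborel)"
    by (simp add: norm_mult)
  show "AE x in lborel. integrable lborel (\<lambda>y. case (x, y) of (x, y) \<Rightarrow> f x * g y)"
    using g by simp
qed

text \<open>Read off from the characteristic function of the standard normal distribution by
  rescaling the variable with e.\<close>

lemma gaussian_FT:
  assumes e: "e > (0::real)"
  shows "(LBINT u. of_real (exp (- (e * u)\<^sup>2 / 2)) * exp (\<i> * of_real u * of_real x))
           = of_real (2 * pi / e * std_normal_density (x / e))"
proof -
  have "of_real (exp (- (x / e)\<^sup>2 / 2)) = char std_normal_distribution (x / e)"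
    by (simp add: char_std_normal_distribution)
  also have "\<dots> = (LBINT u. of_real (std_normal_density u) * exp (\<i> * of_real (x / e) * of_real u))"
    unfolding char_def
    by (subst integral_density) (auto simp: scaleR_conv_of_real mult.assoc)
  also have "\<dots> = \<bar>e\<bar> *\<^sub>R (LBINT u. of_real (std_normal_density (0 + e * u)) * exp (\<i> * of_real (x / e) * of_real (0 + e * u)))"
    using e by (subst lborel_integral_real_affine[where c = e and t = 0]) auto
  also have "(LBINT u. of_real (std_normal_density (0 + e * u)) * exp (\<i> * of_real (x / e) * of_real (0 + e * u)))
     = (LBINT u. of_real (1 / sqrt (2 * pi)) * (of_real (exp (- (e * u)\<^sup>2 / 2)) * exp (\<i> * of_real u * of_real x)))"
    using e by (intro Bochner_Integration.integral_cong) (auto simp: std_normal_density_def mult_ac)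
  also have "\<dots> = of_real (1 / sqrt (2 * pi)) * (LBINT u. of_real (exp (- (e * u)\<^sup>2 / 2)) * exp (\<i> * of_real u * of_real x))"
    by simp
  finally have "(LBINT u. of_real (exp (- (e * u)\<^sup>2 / 2)) * exp (\<i> * of_real u * of_real x))
       = of_real (sqrt (2 * pi) / e * exp (- (x / e)\<^sup>2 / 2))"
    using e by (simp add: scaleR_conv_of_real field_simps)
  also have "sqrt (2 * pi) / e * exp (- (x / e)\<^sup>2 / 2) = 2 * pi / e * std_normal_density (x / e)"
  proof -
    define r where "r = sqrt (2 * pi)"
    have "r > 0" "2 * pi = r * r" by (simp_all add: r_def)
    then show ?thesis unfolding std_normal_density_def r_def[symmetric] by (simp add: power_divide)
  qed
  finally show ?thesis .
qed

lemma gaussian_integrable: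
  assumes e: "e > (0::real)"
  shows "integrable lborel (\<lambda>u::real. exp (- (e * u)\<^sup>2 / 2))"
proof -
  have "integrable lborel (\<lambda>u::real. sqrt (2 * pi) * std_normal_density (0 + e * u))"
    using e by (intro integrable_mult_right lborel_integrable_real_affine) auto
  then show ?thesis by (simp add: std_normal_density_def)
qed

lemma norm_exp_i_real [simp]: "norm (exp (\<i> * of_real u * of_real x)) = 1"
  by (simp add: norm_exp_eq_Re)

text \<open>The Gaussian factor makes the double integral absolutely convergent, so Fubini applies.
  The result is the average of f over a normal distribution with mean y and standard deviation
  e.\<close>

lemma gaussian_parseval:
  fixes f :: "real \<Rightarrow> complex"
  assumes f: "integrable lborel f" and e: "e > 0"
  defines "F \<equiv> \<lambda>u. \<integral>x. f x * exp (\<i> * of_real u * of_real x) \<partial>lborel"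
  shows "(LBINT u. of_real (exp (- (e * u)\<^sup>2 / 2)) * F u * exp (- (\<i> * of_real u * of_real y)))
     = 2 * pi * (LBINT w. of_real (std_normal_density w) * f (y + e * w))"
proof -
  let ?g = "\<lambda>u x. of_real (exp (- (e * u)\<^sup>2 / 2)) * (f x * exp (\<i> * of_real u * of_real (x - y)))"
  have [measurable]: "f \<in> borel_measurable borel" using f by auto
  have i: "integrable (lborel \<Otimes>\<^sub>M lborel) (\<lambda>(u, x). ?g u x)"
  proof (rule Bochner_Integration.integrable_bound)
    have "integrable (lborel \<Otimes>\<^sub>M lborel) (\<lambda>(u, x). exp (- (e * u)\<^sup>2 / 2) * norm (f x))"
      using gaussian_integrable[OF e] f
      by (intro integrable_prod_mult integrable_norm)
    then show "integrable (lborel \<Otimes>\<^sub>M lborel) (\<lambda>(u, x). exp (- (e * u)\<^sup>2 / 2) * norm (f x))" .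
  qed (auto simp: norm_mult)
  have "(LBINT u. of_real (exp (- (e * u)\<^sup>2 / 2)) * F u * exp (- (\<i> * of_real u * of_real y)))
      = (LBINT u. (LBINT x. ?g u x))"
  proof (intro Bochner_Integration.integral_cong refl)
    fix u
    have "of_real (exp (- (e * u)\<^sup>2 / 2)) * F u * exp (- (\<i> * of_real u * of_real y))
       = of_real (exp (- (e * u)\<^sup>2 / 2)) * exp (- (\<i> * of_real u * of_real y)) * F u" by simp
    also have "\<dots> = (LBINT x. of_real (exp (- (e * u)\<^sup>2 / 2)) * exp (- (\<i> * of_real u * of_real y)) * (f x * exp (\<i> * of_real u * of_real x)))"
      unfolding F_def by simp
    also have "\<dots> = (LBINT x. ?g u x)"
      by (intro Bochner_Integration.integral_cong refl)
         (simp add: right_diff_distrib exp_diff exp_minus field_simps)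
    finally show "of_real (exp (- (e * u)\<^sup>2 / 2)) * F u * exp (- (\<i> * of_real u * of_real y)) = (LBINT x. ?g u x)" .
  qed
  also have "\<dots> = (LBINT x. (LBINT u. ?g u x))"
    using i by (rule lborel_pair.Fubini_integral[symmetric])
  also have "\<dots> = (LBINT x. f x * of_real (2 * pi / e * std_normal_density ((x - y) / e)))"
  proof (intro Bochner_Integration.integral_cong refl)
    fix x
    have "(LBINT u. ?g u x) = (LBINT u. f x * (of_real (exp (- (e * u)\<^sup>2 / 2)) * exp (\<i> * of_real u * of_real (x - y))))"
      by (intro Bochner_Integration.integral_cong refl) (simp add: mult_ac)
    also have "\<dots> = f x * of_real (2 * pi / e * std_normal_density ((x - y) / e))"
      using gaussian_FT[OF e, of "x - y"] by simp
    finally show "(LBINT u. ?g u x) = f x * of_real (2 * pi / e * std_normal_density ((x - y) / e))" .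
  qed
  also have "\<dots> = \<bar>e\<bar> *\<^sub>R (LBINT w. f (y + e * w) * of_real (2 * pi / e * std_normal_density ((y + e * w - y) / e)))"
    using e by (subst lborel_integral_real_affine[where c = e and t = y]) auto
  also have "\<dots> = 2 * pi * (LBINT w. of_real (std_normal_density w) * f (y + e * w))"
  proof -
    have "(LBINT w. f (y + e * w) * of_real (2 * pi / e * std_normal_density ((y + e * w - y) / e)))
        = (LBINT w. of_real (2 * pi / e) * (of_real (std_normal_density w) * f (y + e * w)))"
      using e by (intro Bochner_Integration.integral_cong refl) (simp add: mult_ac)
    then show ?thesis using e by (simp add: scaleR_conv_of_real)
  qed
  finally show ?thesis .
qed

text \<open>Let e tend to 0 in \<open>gaussian_parseval\<close>. Dominated convergence applies on
  the left because F is integrable, and on the right because f is bounded and continuous.\<close>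

theorem fourier_inversion:
  fixes f :: "real \<Rightarrow> complex"
  assumes f: "integrable lborel f" and b: "\<And>x. norm (f x) \<le> B"
    and c: "\<And>x. isCont f x"
  defines "F \<equiv> \<lambda>u. \<integral>x. f x * exp (\<i> * of_real u * of_real x) \<partial>lborel"
  assumes F: "integrable lborel F"
  shows "(LBINT u. F u * exp (- (\<i> * of_real u * of_real y))) = 2 * pi * f y"
proof -
  define e where "e = (\<lambda>n. 1 / real (Suc n))"
  have e: "e n > 0" for n by (simp add: e_def)
  have e0: "e \<longlonglongrightarrow> 0" unfolding e_def by real_asymp
  have [measurable]: "f \<in> borel_measurable borel" "F \<in> borel_measurable borel" using f F by auto
  have "(\<lambda>n. \<integral>u. of_real (exp (- (e n * u)\<^sup>2 / 2)) * F u * exp (- (\<i> * of_real u * of_real y)) \<partial>lborel)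
       \<longlonglongrightarrow> (LBINT u. F u * exp (- (\<i> * of_real u * of_real y)))"
  proof (rule integral_dominated_convergence[where w = "\<lambda>u. norm (F u)"])
    show "AE u in lborel. (\<lambda>n. of_real (exp (- (e n * u)\<^sup>2 / 2)) * F u * exp (- (\<i> * of_real u * of_real y)))
        \<longlonglongrightarrow> F u * exp (- (\<i> * of_real u * of_real y))"
    proof (intro always_eventually allI)
      fix u
      have "(\<lambda>n. of_real (exp (- (e n * u)\<^sup>2 / 2)) * F u * exp (- (\<i> * of_real u * of_real y)))
          \<longlonglongrightarrow> of_real (exp (- (0 * u)\<^sup>2 / 2)) * F u * exp (- (\<i> * of_real u * of_real y))"
        by (intro tendsto_intros e0) auto
      then show "(\<lambda>n. of_real (exp (- (e n * u)\<^sup>2 / 2)) * F u * exp (- (\<i> * of_real u * of_real y)))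
        \<longlonglongrightarrow> F u * exp (- (\<i> * of_real u * of_real y))" by simp
    qed
    show "AE u in lborel. norm (of_real (exp (- (e n * u)\<^sup>2 / 2)) * F u * exp (- (\<i> * of_real u * of_real y))) \<le> norm (F u)" for n
    proof (intro always_eventually allI)
      fix u
      have "norm (exp (- (\<i> * of_real u * of_real y))) = 1" by (simp add: norm_exp_eq_Re)
      moreover have "exp (- (e n * u)\<^sup>2 / 2) * norm (F u) \<le> 1 * norm (F u)"
        by (intro mult_right_mono) auto
      ultimately show "norm (of_real (exp (- (e n * u)\<^sup>2 / 2)) * F u * exp (- (\<i> * of_real u * of_real y))) \<le> norm (F u)"
        by (simp add: norm_mult)
    qed
  qed (use F in auto)
  moreover have "(\<lambda>n. 2 * pi * (LBINT w. of_real (std_normal_density w) * f (y + e n * w)))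
       \<longlonglongrightarrow> 2 * pi * (LBINT w. of_real (std_normal_density w) * f y)"
  proof (intro tendsto_mult tendsto_const, rule integral_dominated_convergence[where w = "\<lambda>w. std_normal_density w * B"])
    show "integrable lborel (\<lambda>w. std_normal_density w * B)" by simp
    show "AE w in lborel. (\<lambda>n. of_real (std_normal_density w) * f (y + e n * w)) \<longlonglongrightarrow> of_real (std_normal_density w) * f y"
    proof (intro always_eventually allI tendsto_mult tendsto_const)
      fix w
      have "(\<lambda>n. y + e n * w) \<longlonglongrightarrow> y + 0 * w" by (intro tendsto_intros e0)
      then show "(\<lambda>n. f (y + e n * w)) \<longlonglongrightarrow> f y" using c by (intro isCont_tendsto_compose[of y f]) auto
    qed
    show "AE w in lborel. norm (of_real (std_normal_density w) * f (y + e n * w)) \<le> std_normal_density w * B" for n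
      using b by (intro always_eventually allI) (auto simp: norm_mult intro!: mult_left_mono)
  qed auto
  moreover have "(LBINT w. of_real (std_normal_density w) * f y) = f y"
  proof -
    have "(LBINT w. of_real (std_normal_density w) * f y) = of_real (LBINT w. std_normal_density w) * f y"
      by simp
    then show ?thesis by (simp add: integral_normal_density)
  qed
  ultimately show ?thesis
    using gaussian_parseval[OF f e, of _ y] LIMSEQ_unique unfolding F_def by (simp only:) blast
qed

lemma integrable_quadratic_decay:
  fixes g :: "real \<Rightarrow> complex"
  assumes g: "continuous_on UNIV g" and T: "\<And>u. \<bar>u\<bar> \<ge> T \<Longrightarrow> norm (g u) \<le> C / u\<^sup>2"
  shows "integrable lborel g"
proof -
  define T' where "T' = max T 1"
  have "compact (g ` {-T'..T'})"
    by (intro compact_continuous_image continuous_on_subset[OF g]) auto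
  then obtain B where "\<forall>x\<in>g ` {-T'..T'}. norm x \<le> B"
    using compact_imp_bounded bounded_iff by blast
  then have B: "norm (g u) \<le> B" if "\<bar>u\<bar> \<le> T'" for u using that by (auto simp: abs_le_iff)
  have "\<bar>0\<bar> \<le> T'" by (simp add: T'_def)
  then have B0: "B \<ge> 0" using B[of 0] norm_ge_zero[of "g 0"] by linarith
  \<comment> \<open>The first summand covers the compact part, the second the tail, where u^2 \<ge>
    1 gives 1 + u^2 \<le> 2 u^2.\<close>
  define K where "K = B * (1 + T'\<^sup>2) + 2 * \<bar>C\<bar>"
  have K: "norm (g u) \<le> K * inverse (1 + u\<^sup>2)" for u
  proof (cases "\<bar>u\<bar> \<le> T'")
    case True
    have "u\<^sup>2 \<le> T'\<^sup>2" using True by (metis abs_ge_zero power2_abs power_mono)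
    then have "B * (1 + u\<^sup>2) \<le> B * (1 + T'\<^sup>2)" using B0 by (intro mult_left_mono) auto
    then have "B * (1 + u\<^sup>2) \<le> K" by (simp add: K_def)
    moreover have p: "1 + u\<^sup>2 > 0" by (simp add: add_pos_nonneg)
    ultimately have "B \<le> K / (1 + u\<^sup>2)" by (simp add: pos_le_divide_eq)
    then show ?thesis using B[OF True] by (simp add: divide_inverse)
  next
    case False
    then have u: "\<bar>u\<bar> \<ge> T" "\<bar>u\<bar> \<ge> 1" by (auto simp: T'_def)
    have u2: "u\<^sup>2 \<ge> 1" using u(2) by (metis one_power2 power2_abs power_mono zero_le_one)
    have p: "1 + u\<^sup>2 > 0" by (simp add: add_pos_nonneg)
    have "norm (g u) \<le> C / u\<^sup>2" using T u by blast
    also have "\<dots> \<le> \<bar>C\<bar> / u\<^sup>2" using u2 by (intro divide_right_mono) auto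
    also have "\<dots> \<le> (2 * \<bar>C\<bar>) / (1 + u\<^sup>2)"
    proof -
      have "\<bar>C\<bar> * 1 \<le> \<bar>C\<bar> * u\<^sup>2" using u2 by (intro mult_left_mono) auto
      then have "\<bar>C\<bar> * (1 + u\<^sup>2) \<le> 2 * \<bar>C\<bar> * u\<^sup>2" by (simp add: algebra_simps)
      moreover have "u\<^sup>2 > 0" using u2 by linarith
      ultimately show ?thesis
        unfolding pos_divide_le_eq[OF \<open>u\<^sup>2 > 0\<close>] times_divide_eq_left pos_le_divide_eq[OF p] by blast
    qed
    also have "\<dots> \<le> K / (1 + u\<^sup>2)" using B0 p by (intro divide_right_mono) (auto simp: K_def)
    finally show ?thesis by (simp add: divide_inverse)
  qed
  have "set_integrable lborel UNIV (\<lambda>u::real. inverse (1 + u\<^sup>2))"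
    using integrable_inverse_1_plus_square by simp
  then have i: "integrable lborel (\<lambda>u::real. K * inverse (1 + u\<^sup>2))"
    by (simp add: set_integrable_def)
  have "g \<in> borel_measurable borel" using g by (rule borel_measurable_continuous_onI)
  then show ?thesis
    by (intro Bochner_Integration.integrable_bound[OF i])
       (auto intro!: always_eventually order.trans[OF K])
qed

section \<open>Gamma integrals, vertical decay and the exponential substitution\<close>

lemma Gamma_scaled_integral:
  assumes z: "Re z > 0" and k: "k > (0::real)"
  shows "set_integrable lborel {0<..} (\<lambda>t. of_real t powr (z - 1) * of_real (exp (- (k * t))))" (is ?A)
    and "(LINT t:{0<..}|lborel. of_real t powr (z - 1) * of_real (exp (- (k * t)))) = Gamma z * of_real k powr (- z)" (is ?B)
proof -
  define f where "f = (\<lambda>t::real. indicator {0<..} t *\<^sub>R (of_real t powr (z - 1) * complex_of_real (exp (- t))))"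
  have [measurable]: "f \<in> borel_measurable borel" unfolding f_def by measurable
  have 1: "set_integrable lborel {0<..} (\<lambda>t. of_real t powr (z - 1) * complex_of_real (exp (- t)))"
  proof -
    have "set_integrable lebesgue {0<..} (\<lambda>t. of_real t powr (z - 1) * complex_of_real (exp (- t)))"
      using absolutely_integrable_Gamma_integral'[OF z] by (simp add: exp_minus divide_inverse)
    then show ?thesis unfolding set_integrable_def f_def[symmetric] by (simp add: integrable_completion)
  qed
  then have fi: "integrable lborel f" by (simp add: set_integrable_def f_def)
  have fv: "integral\<^sup>L lborel f = Gamma z"
    using set_borel_integral_eq_integral(2)[OF 1] Gamma_integral_complex'[OF z]
    by (simp add: set_lebesgue_integral_def f_def integral_unique exp_minus divide_inverse)
  have fk: "f (0 + k * t) = of_real k powr (z - 1) * (indicator {0<..} t *\<^sub>R (of_real t powr (z - 1) * of_real (exp (- (k * t)))))" for t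
    using k by (auto simp: f_def indicator_def zero_less_mult_iff powr_times_real)
  have kn: "complex_of_real k powr (z - 1) \<noteq> 0" using k by simp
  have "integrable lborel (\<lambda>t. f (0 + k * t))"
    using k fi by (intro lborel_integrable_real_affine) auto
  then have "integrable lborel (\<lambda>t. inverse (of_real k powr (z - 1)) * f (0 + k * t))" by simp
  moreover have "inverse (of_real k powr (z - 1)) * f (0 + k * t)
      = indicator {0<..} t *\<^sub>R (of_real t powr (z - 1) * of_real (exp (- (k * t))))" for t
    unfolding fk mult.assoc[symmetric] left_inverse[OF kn] by simp
  ultimately show ?A unfolding set_integrable_def by (simp only:)
  have "Gamma z = \<bar>k\<bar> *\<^sub>R (LBINT t. f (0 + k * t))"
    using k unfolding fv[symmetric] by (intro lborel_integral_real_affine) auto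
  also have "\<dots> = (of_real k * of_real k powr (z - 1)) * (LINT t:{0<..}|lborel. of_real t powr (z - 1) * of_real (exp (- (k * t))))"
    unfolding fk set_lebesgue_integral_def using k by (simp add: scaleR_conv_of_real)
  also have "of_real k * of_real k powr (z - 1) = of_real k powr z"
    using k powr_add[of "of_real k" 1 "z - 1"] by simp
  finally show ?B using k by (simp add: powr_minus field_simps)
qed

lemma norm_Gamma_le:
  assumes z: "Re z > 0"
  shows "norm (Gamma z) \<le> Gamma (Re z)"
proof -
  let ?g = "\<lambda>z t. of_real t powr (z - 1) * complex_of_real (exp (- (1 * t)))"
  have "norm (LINT t:{0<..}|lborel. ?g z t) \<le> (LINT t:{0<..}|lborel. norm (?g z t))"
    by (intro set_integral_norm_bound Gamma_scaled_integral z) auto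
  also have "\<dots> = (LINT t:{0<..}|lborel. Re (?g (of_real (Re z)) t))"
    by (intro set_lebesgue_integral_cong)
       (auto simp: norm_mult norm_powr_real_powr powr_Reals_eq)
  also have "\<dots> = Re (LINT t:{0<..}|lborel. ?g (of_real (Re z)) t)"
    unfolding set_lebesgue_integral_def
    by (subst integral_Re[symmetric]) (use Gamma_scaled_integral(1)[of "of_real (Re z)" 1] z in \<open>auto simp: set_integrable_def\<close>)
  finally show ?thesis
    using z Gamma_scaled_integral(2)[of z 1] Gamma_scaled_integral(2)[of "of_real (Re z)" 1]
    by (simp add: Gamma_complex_of_real)
qed

text \<open>Decay of any power order takes the place of Stirling's formula. In Gamma(z) = Gamma(z +
  k) / (z)_k each of the k factors of the denominator has modulus at least |Im z|, and the numerator
  is bounded by the real Gamma function on a compact interval.\<close>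

lemma Gamma_vertical_decay:
  fixes \<alpha> \<beta> :: real and k :: nat
  assumes "\<alpha> + real k > 0"
  shows "\<exists>C\<ge>0. \<forall>z. \<alpha> \<le> Re z \<and> Re z \<le> \<beta> \<and> Im z \<noteq> 0 \<longrightarrow> norm (Gamma z) \<le> C / \<bar>Im z\<bar> ^ k"
proof -
  have "compact ((Gamma :: real \<Rightarrow> real) ` {\<alpha> + real k..\<beta> + real k})"
    by (intro compact_continuous_image continuous_intros) (use assms in \<open>auto elim!: nonpos_Ints_cases\<close>)
  then obtain C where "\<forall>x\<in>(Gamma :: real \<Rightarrow> real) ` {\<alpha> + real k..\<beta> + real k}. norm x \<le> C"
    using compact_imp_bounded bounded_iff by blast
  then have C: "\<bar>Gamma x\<bar> \<le> C" if "\<alpha> + real k \<le> x" "x \<le> \<beta> + real k" for x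
    using that by auto
  have "norm (Gamma z) \<le> \<bar>C\<bar> / \<bar>Im z\<bar> ^ k" if z: "\<alpha> \<le> Re z" "Re z \<le> \<beta>" "Im z \<noteq> 0" for z
  proof -
    have nz: "z \<notin> \<int>\<^sub>\<le>\<^sub>0" using z(3) by (auto elim!: nonpos_Ints_cases)
    have "\<bar>Im z\<bar> ^ k = (\<Prod>j<k. \<bar>Im z\<bar>)" by simp
    also have "\<dots> \<le> (\<Prod>j<k. norm (z + of_nat j))"
      by (intro prod_mono) (auto intro: order.trans[OF _ abs_Im_le_cmod])
    also have "\<dots> = norm (pochhammer z k)"
      by (simp add: pochhammer_prod prod_norm lessThan_atLeast0)
    finally have p: "\<bar>Im z\<bar> ^ k \<le> norm (pochhammer z k)" .
    have "norm (Gamma z) * norm (pochhammer z k) = norm (Gamma (z + of_nat k))"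
      using pochhammer_Gamma[OF nz, of k] nz by (simp add: norm_divide Gamma_eq_zero_iff)
    also have "\<dots> \<le> Gamma (Re z + real k)"
      using norm_Gamma_le[of "z + of_nat k"] z assms by simp
    also have "\<dots> \<le> \<bar>C\<bar>" using C[of "Re z + real k"] z by linarith
    finally have "norm (Gamma z) * norm (pochhammer z k) \<le> \<bar>C\<bar>" .
    then have "norm (Gamma z) * \<bar>Im z\<bar> ^ k \<le> \<bar>C\<bar>"
      using p by (meson mult_left_mono norm_ge_zero order_trans)
    then show ?thesis using z by (simp add: pos_le_divide_eq)
  qed
  then show ?thesis by (intro exI[of _ "\<bar>C\<bar>"]) auto
qed

text \<open>The bridge from Mellin integrals over (0, \<infinity>) to Fourier integrals over the
  real line.\<close>

lemma exp_substitution: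
  fixes g :: "real \<Rightarrow> complex"
  assumes gi: "set_integrable lborel {0<..} g" and [measurable]: "g \<in> borel_measurable borel"
  shows "integrable lborel (\<lambda>x. of_real (exp x) * g (exp x))"
    and "(LBINT x. of_real (exp x) * g (exp x)) = (LINT t:{0<..}|lborel. g t)"
proof -
  have im: "exp ` (UNIV::real set) = {0<..}"
    by (auto simp: image_iff) (metis exp_ln)
  have leb: "g absolutely_integrable_on {0<..}"
    using gi unfolding set_integrable_def by (simp add: integrable_completion)
  \<comment> \<open>The change of variables is carried out for real integrands, so g is composed
    with a bounded linear h, to be taken as \<open>Re\<close> and as \<open>Im\<close>.\<close>
  have *: "(\<lambda>x. h (g (exp x)) * exp x) absolutely_integrable_on UNIV \<and>
           integral UNIV (\<lambda>x. h (g (exp x)) * exp x) = integral {0<..} (\<lambda>t. h (g t))"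
    if "bounded_linear h" for h :: "complex \<Rightarrow> real"
  proof -
    have "(\<lambda>t. h (g t)) absolutely_integrable_on {0<..}"
      using absolutely_integrable_linear[OF leb that] by (simp add: o_def)
    then have "(\<lambda>x. \<bar>exp x\<bar> *\<^sub>R h (g (exp x))) absolutely_integrable_on UNIV \<and>
           integral UNIV (\<lambda>x. \<bar>exp x\<bar> *\<^sub>R h (g (exp x))) = integral {0<..} (\<lambda>t. h (g t))"
      using has_absolute_integral_change_of_variables_1'[of UNIV exp exp "\<lambda>t. h (g t)" "integral {0<..} (\<lambda>t. h (g t))"] im
      by (auto intro!: derivative_eq_intros simp: inj_on_def)
    then show ?thesis by (simp add: mult.commute)
  qed
  have R: "integrable lborel (\<lambda>x. h (g (exp x)) * exp x)"
     "(LBINT x. h (g (exp x)) * exp x) = (LINT t:{0<..}|lborel. h (g t))"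
    if h: "bounded_linear h" for h :: "complex \<Rightarrow> real"
  proof -
    have [measurable]: "h \<in> borel_measurable borel"
      using h by (intro borel_measurable_continuous_onI linear_continuous_on)
    show i: "integrable lborel (\<lambda>x. h (g (exp x)) * exp x)"
      using *[OF h] by (simp add: set_integrable_def integrable_completion)
    have hi: "set_integrable lborel {0<..} (\<lambda>t. h (g t))"
      using integrable_bounded_linear[OF h gi[unfolded set_integrable_def]]
        linear_cmul[OF bounded_linear.linear[OF h]] by (simp add: set_integrable_def)
    show "(LBINT x. h (g (exp x)) * exp x) = (LINT t:{0<..}|lborel. h (g t))"
      using *[OF h] i integral_lborel[OF i] set_borel_integral_eq_integral(2)[OF hi] by simp
  qed
  have eq: "of_real (exp x) * g (exp x) = of_real (Re (g (exp x)) * exp x) + \<i> * of_real (Im (g (exp x)) * exp x)" for x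
    by (simp add: complex_eq_iff mult.commute)
  note Ri = R[OF bounded_linear_Re] and Ii = R[OF bounded_linear_Im]
  show "integrable lborel (\<lambda>x. of_real (exp x) * g (exp x))"
    unfolding eq by (intro Bochner_Integration.integrable_add integrable_mult_right integrable_of_real Ri Ii)
  have "(LBINT x. of_real (exp x) * g (exp x))
      = of_real (LINT t:{0<..}|lborel. Re (g t)) + \<i> * of_real (LINT t:{0<..}|lborel. Im (g t))"
    unfolding eq
    by (subst Bochner_Integration.integral_add)
       (auto simp: Ri Ii intro!: integrable_of_real integrable_mult_right simp del: of_real_mult)
  also have "\<dots> = (LINT t:{0<..}|lborel. g t)"
    using gi by (auto simp: complex_eq_iff set_lebesgue_integral_def set_integrable_def simp flip: integral_Re integral_Im)
  finally show "(LBINT x. of_real (exp x) * g (exp x)) = (LINT t:{0<..}|lborel. g t)" .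
qed

section \<open>The Mellin--Barnes integral\<close>

lemma Gamma_scaled_integral_real:
  assumes r: "r > 0" and k: "k > (0::real)"
  shows "(LINT t:{0<..}|lborel. t powr (r - 1) * exp (- (k * t))) = Gamma r * k powr (- r)"
proof -
  have "of_real (LINT t:{0<..}|lborel. t powr (r - 1) * exp (- (k * t)))
      = (LINT t:{0<..}|lborel. complex_of_real (t powr (r - 1) * exp (- (k * t))))"
    unfolding set_lebesgue_integral_def by (simp flip: integral_complex_of_real add: scaleR_conv_of_real)
  also have "\<dots> = (LINT t:{0<..}|lborel. of_real t powr (of_real r - 1) * of_real (exp (- (k * t))))"
    by (intro set_lebesgue_integral_cong) (auto simp: powr_Reals_eq)
  also have "\<dots> = Gamma (of_real r) * of_real k powr (- of_real r)"
    using Gamma_scaled_integral(2)[of "of_real r" k] r k by simp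
  also have "\<dots> = of_real (Gamma r * k powr (- r))"
    using k by (simp add: Gamma_complex_of_real powr_Reals_eq)
  finally show ?thesis by (simp only: of_real_eq_iff)
qed

text \<open>The integrand of the Beta integral with parameters c and a - c after the exponential
  substitution. Its Fourier transform is, up to Gamma(a), the product of two Gamma values on the
  line Re w = c.\<close>

abbreviation beta_density :: "real \<Rightarrow> complex \<Rightarrow> real \<Rightarrow> complex" where
  "beta_density c a x \<equiv> complex_of_real (exp (c * x)) * of_real (1 + exp x) powr (- a)"

text \<open>(1 + e^x) powr (-b) is at most e^(-bx) for x \<ge> 0 and at most 1 for x < 0, giving the
  decay rates b - c and c on the two sides.\<close>

lemma beta_density_bound:
  fixes b c x :: real
  assumes c: "0 < c" "c < b"
  shows "exp (c * x) * (1 + exp x) powr (- b) \<le> exp (- (min c (b - c) * \<bar>x\<bar>))"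
proof (cases "x \<ge> 0")
  case True
  have "(1 + exp x) powr (- b) \<le> exp x powr (- b)"
    using c by (intro powr_mono2') auto
  then have "exp (c * x) * (1 + exp x) powr (- b) \<le> exp (c * x) * exp x powr (- b)" by simp
  also have "\<dots> = exp (- ((b - c) * x))" by (simp add: powr_def exp_add[symmetric] algebra_simps)
  also have "\<dots> \<le> exp (- (min c (b - c) * \<bar>x\<bar>))"
    using True by (auto intro!: mult_right_mono)
  finally show ?thesis .
next
  case False
  have "(1 + exp x) powr (- b) \<le> 1 powr (- b)"
    using c by (intro powr_mono2') auto
  then have "exp (c * x) * (1 + exp x) powr (- b) \<le> exp (c * x)" by simp
  also have "\<dots> \<le> exp (- (min c (b - c) * \<bar>x\<bar>))"
    using False mult_right_mono[of "min c (b - c)" c "- x"] by auto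
  finally show ?thesis .
qed

lemma continuous_on_beta_density:
  "continuous_on UNIV (\<lambda>x. beta_density c a x)"
proof (intro continuous_intros)
  fix x :: real
  have "1 + exp x > 0" by (simp add: add_pos_pos)
  then have "complex_of_real (1 + exp x) \<noteq> 0" unfolding of_real_eq_0_iff by linarith
  then show "complex_of_real (1 + exp x) = 0 \<Longrightarrow> 0 < Re (- a)" by simp
qed (auto simp: add_nonneg_nonneg)

lemma continuous_on_Gamma_compose:
  assumes "continuous_on A f" "\<And>x. x \<in> A \<Longrightarrow> f x \<notin> \<int>\<^sub>\<le>\<^sub>0"
  shows "continuous_on A (\<lambda>x. Gamma (f x) :: complex)"
proof (rule continuous_on_compose2[OF holomorphic_on_imp_continuous_on assms(1)])
  show "Gamma holomorphic_on (- \<int>\<^sub>\<le>\<^sub>0)" by (rule holomorphic_Gamma) auto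
qed (use assms(2) in auto)

lemma nonpos_Ints_Re: "z \<in> \<int>\<^sub>\<le>\<^sub>0 \<Longrightarrow> Im z = 0 \<and> Re z \<in> \<int> \<and> Re z \<le> (0 :: real)"
  by (auto elim!: nonpos_Ints_cases)

lemma integrable_beta_density:
  assumes c: "0 < c" "c < Re a"
  shows "integrable lborel (\<lambda>x. beta_density c a x)"
proof (rule integrable_quadratic_decay)
  show "continuous_on UNIV (\<lambda>x. beta_density c a x)"
    by (rule continuous_on_beta_density)
  define d where "d = min c (Re a - c)"
  have d: "d > 0" using c by (simp add: d_def)
  fix x :: real assume x: "\<bar>x\<bar> \<ge> 1"
  have "norm (beta_density c a x) = exp (c * x) * (1 + exp x) powr (- Re a)"
    unfolding norm_mult by (subst norm_powr_real_powr) (auto simp: add_nonneg_nonneg)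
  also have "\<dots> \<le> exp (- (d * \<bar>x\<bar>))" unfolding d_def by (rule beta_density_bound[OF c])
  also have "\<dots> = 1 / exp (d * \<bar>x\<bar>)" by (simp add: exp_minus inverse_eq_divide)
  also have "\<dots> \<le> 1 / ((d * \<bar>x\<bar>)\<^sup>2 / 2)"
  proof (intro divide_left_mono)
    have "1 + d * \<bar>x\<bar> + (d * \<bar>x\<bar>)\<^sup>2 / 2 \<le> exp (d * \<bar>x\<bar>)"
      using d by (intro exp_lower_Taylor_quadratic) auto
    moreover have "0 \<le> d * \<bar>x\<bar>" using d by simp
    ultimately show "(d * \<bar>x\<bar>)\<^sup>2 / 2 \<le> exp (d * \<bar>x\<bar>)" by linarith
    show "0 < exp (d * \<bar>x\<bar>) * ((d * \<bar>x\<bar>)\<^sup>2 / 2)" using d x by auto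
  qed auto
  also have "\<dots> = (2 / d\<^sup>2) / x\<^sup>2" by (simp add: power_mult_distrib)
  finally show "norm (beta_density c a x) \<le> (2 / d\<^sup>2) / x\<^sup>2" .
qed

text \<open>Write (1 + e^x) powr (-a) as a Gamma integral in l. After the exchange the x-integral is
  again a Gamma integral, with value \<open>Gamma w * of_real l powr (- w)\<close>, and the
  remaining l-integral gives \<open>Gamma (a - w)\<close>.\<close>

lemma beta_transform:
  fixes c u :: real and a :: complex
  assumes c: "0 < c" "c < Re a"
  defines "w \<equiv> Complex c u"
  shows "(LBINT x. beta_density c a x * exp (\<i> * of_real u * of_real x))
     = Gamma w * Gamma (a - w) / Gamma a"
proof -
  have w: "Re w = c" "Re (a - w) > 0" "Re a > 0" using c by (auto simp: w_def)
  define H where "H = (\<lambda>x l. exp (w * of_real x) *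
     (indicator {0<..} l *\<^sub>R (of_real l powr (a - 1) * complex_of_real (exp (- ((1 + exp x) * l))))))"
  have k: "1 + exp x > 0" for x :: real by (simp add: add_pos_pos)
  have Hi: "integrable lborel (H x)" for x
    using Gamma_scaled_integral(1)[OF w(3) k[of x]] unfolding H_def set_integrable_def by (rule integrable_mult_right)
  have Hv: "(LBINT l. H x l) = Gamma a * (beta_density c a x * exp (\<i> * of_real u * of_real x))" for x
  proof -
    have "(LBINT l. H x l) = exp (w * of_real x) * (Gamma a * of_real (1 + exp x) powr (- a))"
      using Gamma_scaled_integral(2)[OF w(3) k[of x]] unfolding H_def set_lebesgue_integral_def
      by (simp only: integral_mult_right_zero)
    also have "exp (w * of_real x) = complex_of_real (exp (c * x)) * exp (\<i> * of_real u * of_real x)"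
      unfolding w_def exp_of_real[symmetric] exp_add[symmetric] by (simp add: Complex_eq algebra_simps)
    finally show ?thesis by (simp add: mult_ac)
  qed
  have Hn: "(LBINT l. norm (H x l)) = Gamma (Re a) * (exp (c * x) * (1 + exp x) powr (- Re a))" for x
  proof -
    have "(LBINT l. norm (H x l)) = (LBINT l. exp (c * x) * (indicator {0<..} l *\<^sub>R (l powr (Re a - 1) * exp (- ((1 + exp x) * l)))))"
      using w by (intro Bochner_Integration.integral_cong) (auto simp: H_def norm_mult indicator_def norm_powr_real_powr)
    then show ?thesis
      using Gamma_scaled_integral_real[OF w(3) k[of x]] unfolding set_lebesgue_integral_def by simp
  qed
  have int: "integrable (lborel \<Otimes>\<^sub>M lborel) (\<lambda>(x, l). H x l)"
  proof (rule lborel_pair.Fubini_integrable)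
    show "(\<lambda>(x, l). H x l) \<in> borel_measurable (lborel \<Otimes>\<^sub>M lborel)" unfolding H_def by measurable
    have "integrable lborel (\<lambda>x. norm (beta_density c a x))"
      by (intro integrable_norm integrable_beta_density c)
    moreover have "norm (beta_density c a x) = exp (c * x) * (1 + exp x) powr (- Re a)" for x
      unfolding norm_mult by (subst norm_powr_real_powr) (auto simp: add_nonneg_nonneg)
    ultimately have "integrable lborel (\<lambda>x. exp (c * x) * (1 + exp x) powr (- Re a))" by (simp only:)
    then show "integrable lborel (\<lambda>x. \<integral>l. norm (case (x, l) of (x, l) \<Rightarrow> H x l) \<partial>lborel)"
      unfolding prod.case Hn by (rule integrable_mult_right)
    show "AE x in lborel. integrable lborel (\<lambda>l. case (x, l) of (x, l) \<Rightarrow> H x l)"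
      using Hi by simp
  qed
  have Hx: "(LBINT x. H x l) = Gamma w * (indicator {0<..} l *\<^sub>R (of_real l powr (a - w - 1) * complex_of_real (exp (- (1 * l)))))" for l
  proof (cases "l > 0")
    case True
    define g where "g = (\<lambda>t. of_real t powr (w - 1) * complex_of_real (exp (- (l * t))))"
    have g: "set_integrable lborel {0<..} g" "(LINT t:{0<..}|lborel. g t) = Gamma w * of_real l powr (- w)"
      using Gamma_scaled_integral[of w l] True w c unfolding g_def by auto
    have [measurable]: "g \<in> borel_measurable borel" unfolding g_def by measurable
    have ex: "exp (w * of_real x) = of_real (exp x) * of_real (exp x) powr (w - 1)" for x :: real
    proof -
      have "of_real (exp x) * of_real (exp x) powr (w - 1) = exp (of_real x) * exp ((w - 1) * of_real x)"
        by (simp add: powr_def Ln_of_real flip: exp_of_real)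
      also have "\<dots> = exp (w * of_real x)" by (simp add: exp_add[symmetric] algebra_simps)
      finally show ?thesis by simp
    qed
    have "(LBINT x. H x l) = (LBINT x. (of_real l powr (a - 1) * of_real (exp (- l))) * (of_real (exp x) * g (exp x)))"
    proof (intro Bochner_Integration.integral_cong refl)
      fix x
      have "- ((1 + exp x) * l) = - l + - (l * exp x)" by (simp add: algebra_simps)
      then have "exp (- ((1 + exp x) * l)) = exp (- l) * exp (- (l * exp x))" by (simp only: exp_add)
      then show "H x l = (of_real l powr (a - 1) * of_real (exp (- l))) * (of_real (exp x) * g (exp x))"
        using True unfolding H_def g_def ex by simp
    qed
    also have "\<dots> = (of_real l powr (a - 1) * of_real (exp (- l))) * (Gamma w * of_real l powr (- w))"
      using exp_substitution(2)[OF g(1)] g(2) by simp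
    also have "of_real l powr (a - 1) * of_real (exp (- l)) * (Gamma w * of_real l powr (- w))
       = Gamma w * ((of_real l powr (a - 1) * of_real l powr (- w)) * of_real (exp (- l)))" by (simp add: mult_ac)
    also have "of_real l powr (a - 1) * of_real l powr (- w) = of_real l powr (a - w - 1)"
      unfolding powr_add[symmetric] by (simp add: algebra_simps)
    finally show ?thesis using True by simp
  qed (simp add: H_def)
  have "Gamma a * (LBINT x. beta_density c a x * exp (\<i> * of_real u * of_real x))
      = (\<integral>x. \<integral>l. H x l \<partial>lborel \<partial>lborel)"
    unfolding Hv by simp
  also have "\<dots> = (\<integral>l. \<integral>x. H x l \<partial>lborel \<partial>lborel)"
    using int by (rule lborel_pair.Fubini_integral[symmetric])
  also have "\<dots> = Gamma w * Gamma (a - w)"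
    unfolding Hx integral_mult_right_zero
    using Gamma_scaled_integral(2)[OF w(2), of 1] by (simp add: set_lebesgue_integral_def)
  finally have "Gamma a * (LBINT x. beta_density c a x * exp (\<i> * of_real u * of_real x))
      = Gamma w * Gamma (a - w)" .
  moreover have "Gamma a \<noteq> 0" using w(3) by (auto simp: Gamma_eq_zero_iff dest!: nonpos_Ints_Re)
  moreover have "I = X / g" if "g * I = X" "g \<noteq> 0" for g I X :: complex using that by auto
  ultimately show ?thesis by blast
qed

lemma integrable_Gamma_Gamma:
  assumes c: "0 < c" "c < Re a"
  shows "integrable lborel (\<lambda>u. Gamma (Complex c u) * Gamma (a - Complex c u))"
proof -
  obtain C where C: "C \<ge> 0" "\<And>z. c \<le> Re z \<Longrightarrow> Re z \<le> c \<Longrightarrow> Im z \<noteq> 0 \<Longrightarrow> norm (Gamma z) \<le> C / \<bar>Im z\<bar> ^ 2"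
    using Gamma_vertical_decay[of c 2 c] c by auto
  show ?thesis
  proof (rule integrable_quadratic_decay)
    show "continuous_on UNIV (\<lambda>u. Gamma (Complex c u) * Gamma (a - Complex c u))"
      unfolding Complex_eq using c
      by (intro continuous_intros continuous_on_Gamma_compose) (auto dest!: nonpos_Ints_Re)
    fix u :: real assume u: "\<bar>u\<bar> \<ge> 1"
    have "norm (Gamma (Complex c u) * Gamma (a - Complex c u)) \<le> C / \<bar>u\<bar> ^ 2 * Gamma (Re a - c)"
      unfolding norm_mult using c u C(1) C(2)[of "Complex c u"] norm_Gamma_le[of "a - Complex c u"]
      by (intro mult_mono) auto
    then show "norm (Gamma (Complex c u) * Gamma (a - Complex c u)) \<le> (C * Gamma (Re a - c)) / u\<^sup>2" by simp
  qed
qed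

text \<open>Fourier inversion for \<open>beta_density\<close> at the point ln x; the factor x powr
  (-c) undoes the exponential weight.\<close>

theorem mellin_barnes:
  fixes c x :: real and a :: complex
  assumes c: "0 < c" "c < Re a" and x: "x > (0::real)"
  shows "(LBINT u. Gamma (Complex c u) * Gamma (a - Complex c u) * of_real x powr (- Complex c u))
     = 2 * pi * Gamma a * of_real (1 + x) powr (- a)"
proof -
  define f where "f = (\<lambda>x. beta_density c a x)"
  define y where "y = ln x"
  have ey: "exp y = x" using x by (simp add: y_def)
  have Ga: "Gamma a \<noteq> 0" using c by (auto simp: Gamma_eq_zero_iff elim!: nonpos_Ints_cases)
  have F: "(LBINT x. f x * exp (\<i> * of_real u * of_real x)) = Gamma (Complex c u) * Gamma (a - Complex c u) / Gamma a" for u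
    unfolding f_def by (rule beta_transform[OF c])
  have b: "norm (f x) \<le> 1" for x
  proof -
    have "norm (f x) = exp (c * x) * (1 + exp x) powr (- Re a)"
      unfolding f_def norm_mult by (subst norm_powr_real_powr) (auto simp: add_nonneg_nonneg)
    also have "\<dots> \<le> exp (- (min c (Re a - c) * \<bar>x\<bar>))" by (rule beta_density_bound[OF c])
    also have "\<dots> \<le> 1" using c by simp
    finally show ?thesis .
  qed
  have cont: "isCont f x" for x
  proof -
    have "continuous_on UNIV f" unfolding f_def by (rule continuous_on_beta_density)
    then show ?thesis by (simp add: continuous_on_eq_continuous_at)
  qed
  have "(LBINT u. (LBINT x. f x * exp (\<i> * of_real u * of_real x)) * exp (- (\<i> * of_real u * of_real y))) = 2 * pi * f y"
  proof (rule fourier_inversion[OF _ b cont])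
    show "integrable lborel f" unfolding f_def by (rule integrable_beta_density[OF c])
    show "integrable lborel (\<lambda>u. \<integral>x. f x * exp (\<i> * of_real u * of_real x) \<partial>lborel)"
      unfolding F using integrable_Gamma_Gamma[OF c] by simp
  qed
  then have eq: "(LBINT u. Gamma (Complex c u) * Gamma (a - Complex c u) / Gamma a * exp (- (\<i> * of_real u * of_real y))) = 2 * pi * f y"
    unfolding F .
  have "(LBINT u. Gamma (Complex c u) * Gamma (a - Complex c u) * of_real x powr (- Complex c u))
     = (LBINT u. (Gamma a * of_real (exp (- (c * y)))) * (Gamma (Complex c u) * Gamma (a - Complex c u) / Gamma a * exp (- (\<i> * of_real u * of_real y))))"
  proof (intro Bochner_Integration.integral_cong refl)
    fix u
    have "of_real x powr (- Complex c u) = exp (of_real (- (c * y)) + - (\<i> * of_real u * of_real y))"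
      using x by (simp add: powr_def Ln_of_real y_def Complex_eq algebra_simps)
    also have "\<dots> = of_real (exp (- (c * y))) * exp (- (\<i> * of_real u * of_real y))"
      unfolding exp_add exp_of_real ..
    finally show "Gamma (Complex c u) * Gamma (a - Complex c u) * of_real x powr (- Complex c u)
       = (Gamma a * of_real (exp (- (c * y)))) * (Gamma (Complex c u) * Gamma (a - Complex c u) / Gamma a * exp (- (\<i> * of_real u * of_real y)))"
      using Ga by simp
  qed
  also have "\<dots> = (Gamma a * of_real (exp (- (c * y)))) * (2 * pi * f y)"
    unfolding integral_mult_right_zero eq ..
  also have "\<dots> = 2 * pi * Gamma a * of_real (1 + x) powr (- a)"
  proof -
    have "exp (- (c * y)) * exp (c * y) = 1" by (simp add: exp_add[symmetric])
    then have "complex_of_real (exp (- (c * y))) * of_real (exp (c * y)) = 1" by (metis of_real_1 of_real_mult)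
    then show ?thesis unfolding f_def ey by (simp add: mult_ac)
  qed
  finally show ?thesis .
qed

section \<open>Atkinson's dissection\<close>

text \<open>For v = s this is \<phi> of the overview without its factor \<zeta>(2\<sigma> -
  z).\<close>

abbreviation mb_weight :: "complex \<Rightarrow> complex \<Rightarrow> complex" where
  "mb_weight v z \<equiv> Gamma z * Gamma (v - z) / Gamma v * riemann_zeta z"

lemma zeta_line_integrable:
  assumes c: "-1 < c" "c < 0" and v: "Re v > 0"
  shows "integrable lborel (\<lambda>y. mb_weight v (Complex c y))"
proof -
  \<comment> \<open>Decay of order 4: two powers absorb the growth of zeta, two remain for
    integrability.\<close>
  obtain C where C: "C \<ge> 0" "\<And>z. c \<le> Re z \<Longrightarrow> Re z \<le> c \<Longrightarrow> Im z \<noteq> 0 \<Longrightarrow> norm (Gamma z) \<le> C / \<bar>Im z\<bar> ^ 4"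
    using Gamma_vertical_decay[of c 4 c] c by auto
  obtain D where D: "D \<ge> 0" "\<And>z. c \<le> Re z \<Longrightarrow> Re z \<le> c \<Longrightarrow> \<bar>Im z\<bar> \<ge> 1 \<Longrightarrow> norm (riemann_zeta z) \<le> D * (Im z)\<^sup>2"
    using riemann_zeta_growth[of c c] c by auto
  show ?thesis
  proof (rule integrable_quadratic_decay)
    have "continuous_on UNIV (\<lambda>y. riemann_zeta (Complex c y))"
      by (rule continuous_on_compose2[OF holomorphic_on_imp_continuous_on[OF holomorphic_riemann_zeta]])
         (use c in \<open>auto simp: Complex_eq complex_eq_iff intro!: continuous_intros\<close>)
    moreover have "continuous_on UNIV (\<lambda>y. Gamma (Complex c y))"
    proof (rule continuous_on_Gamma_compose)
      show "continuous_on UNIV (Complex c)" unfolding Complex_eq by (intro continuous_intros)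
      fix y show "Complex c y \<notin> \<int>\<^sub>\<le>\<^sub>0"
        using c by (auto dest!: nonpos_Ints_Re elim!: Ints_cases)
    qed
    moreover have "continuous_on UNIV (\<lambda>y. Gamma (v - Complex c y))"
      unfolding Complex_eq using v c
      by (intro continuous_intros continuous_on_Gamma_compose) (auto dest!: nonpos_Ints_Re)
    ultimately show "continuous_on UNIV (\<lambda>y. mb_weight v (Complex c y))"
      unfolding divide_inverse by (intro continuous_intros)
    fix y :: real assume y: "\<bar>y\<bar> \<ge> 1"
    have y0: "y \<noteq> 0" using y by auto
    have "norm (mb_weight v (Complex c y))
      \<le> C / \<bar>y\<bar> ^ 4 * Gamma (Re v - c) / norm (Gamma v) * (D * y\<^sup>2)"
      unfolding norm_mult norm_divide
      using c v y C(1) D(1) C(2)[of "Complex c y"] D(2)[of "Complex c y"] norm_Gamma_le[of "v - Complex c y"]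
      by (intro mult_mono divide_right_mono) auto
    also have "\<dots> = (C * Gamma (Re v - c) / norm (Gamma v) * D) / y\<^sup>2"
    proof -
      define Y where "Y = y\<^sup>2"
      have "\<bar>y\<bar> ^ 4 = Y * Y" by (simp add: Y_def power2_eq_square power4_eq_xxxx abs_mult[symmetric])
      moreover have "Y \<noteq> 0" using y0 by (simp add: Y_def)
      ultimately show ?thesis unfolding Y_def[symmetric] by (simp add: mult_ac)
    qed
    finally show "norm (mb_weight v (Complex c y))
      \<le> (C * Gamma (Re v - c) / norm (Gamma v) * D) / y\<^sup>2" .
  qed
qed

lemma Gamma_plus2:
  assumes "z \<notin> \<int>\<^sub>\<le>\<^sub>0"
  shows "Gamma (z + 2) = z * (z + 1) * (Gamma z :: complex)"
proof -
  have "z + 1 \<notin> \<int>\<^sub>\<le>\<^sub>0" using assms by (metis plus_one_in_nonpos_Ints_imp)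
  then show ?thesis using Gamma_plus1[OF assms] Gamma_plus1[of "z + 1"] by (simp add: add.assoc)
qed

text \<open>On the line Re z = c, zeta is \<open>em_rem z 0\<close>, and its prefactor z (z + 1)
  turns Gamma(z) into Gamma(z + 2). The abscissa thus becomes c + 2, between 0 and Re v + 2, and
  Fubini leaves a Mellin--Barnes integral with a = v + 2 at x / m. Its value supplies (m + x) powr
  (-v - 2), the kernel of \<open>em_int v m\<close>.\<close>

lemma em_rem_mellin_barnes:
  assumes c: "-1 < c" "c < 0" and v: "Re v > 0" and m: "m \<ge> (1::nat)"
  shows "(LBINT y. mb_weight v (Complex c y)
             * of_nat m powr (Complex c y - v)) = 2 * pi * em_rem v m"
proof -
  let ?w = "\<lambda>y. Complex (c + 2) y"
  define A where "A = (\<lambda>y. Gamma (?w y) * Gamma (v + 2 - ?w y) * of_nat m powr (?w y))"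
  define K where "K = (\<lambda>y x. A y * (indicator {0<..} x *\<^sub>R (complex_of_real (P2 x) * of_real x powr (- ?w y))))"
  have Gv: "Gamma v \<noteq> 0" using v by (auto simp: Gamma_eq_zero_iff dest!: nonpos_Ints_Re)
  have m0: "real m > 0" using m by simp
  have GG: "integrable lborel (\<lambda>y. Gamma (?w y) * Gamma (v + 2 - ?w y))"
    using c v by (intro integrable_Gamma_Gamma) auto
  have nA: "norm (A y) = norm (Gamma (?w y) * Gamma (v + 2 - ?w y)) * real m powr (c + 2)" for y
    unfolding A_def norm_mult by (subst norm_powr_real_powr) auto
  have Am [measurable]: "A \<in> borel_measurable borel"
  proof -
    have "(\<lambda>y. Gamma (?w y) * Gamma (v + 2 - ?w y)) \<in> borel_measurable borel" using GG by auto
    then show ?thesis unfolding A_def Complex_eq by measurable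
  qed
  have iK: "integrable (lborel \<Otimes>\<^sub>M lborel) (\<lambda>(y, x). K y x)"
  proof (rule Bochner_Integration.integrable_bound)
    \<comment> \<open>The modulus of K is a product of a function of y and one of x, since |x powr
      (-w)| depends on Re w only. The x-part is the kernel at the real exponent c, integrable down
      to 0 because -1 < c < 0.\<close>
    show "integrable (lborel \<Otimes>\<^sub>M lborel) (\<lambda>(y, x). norm (A y) * norm (indicator {0<..} x *\<^sub>R em_ker (of_real c) x))"
    proof (rule integrable_prod_mult)
      show "integrable lborel (\<lambda>y. norm (A y))" unfolding nA using GG by (intro integrable_mult_left integrable_norm)
      show "integrable lborel (\<lambda>x. norm (indicator {0<..} x *\<^sub>R em_ker (of_real c) x))"
        using set_integrable_em_ker[of 0 "of_real c"] c unfolding set_integrable_def by (intro integrable_norm) auto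
    qed
    show "(\<lambda>(y, x). K y x) \<in> borel_measurable (lborel \<Otimes>\<^sub>M lborel)"
      unfolding K_def Complex_eq by measurable
    show "AE p in lborel \<Otimes>\<^sub>M lborel. norm (case p of (y, x) \<Rightarrow> K y x)
       \<le> norm (case p of (y, x) \<Rightarrow> norm (A y) * norm (indicator {0<..} x *\<^sub>R em_ker (of_real c) x))"
    proof (intro always_eventually allI)
      fix p :: "real \<times> real"
      show "norm (case p of (y, x) \<Rightarrow> K y x)
       \<le> norm (case p of (y, x) \<Rightarrow> norm (A y) * norm (indicator {0<..} x *\<^sub>R em_ker (of_real c) x))"
      proof (cases p)
        case (Pair y x)
        have "norm (K y x) = norm (A y) * norm (indicator {0<..} x *\<^sub>R em_ker (of_real c) x)"
        proof (cases "x > 0")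
          case True
          have "- c - 2 = - (c + 2)" by simp
          then show ?thesis using True
            by (simp add: K_def norm_mult norm_em_ker norm_powr_real_powr)
        qed (simp add: K_def)
        then show ?thesis by (simp add: Pair)
      qed
    qed
  qed
  have Ky: "(LBINT y. K y x) = 2 * pi * Gamma (v + 2) * of_nat m powr (v + 2)
       * (indicator {0<..} x *\<^sub>R (complex_of_real (P2 x) * of_real (real m + x) powr (- v - 2)))" for x
  proof (cases "x > 0")
    case True
    have pw: "of_real x powr (- ?w y) * of_nat m powr (?w y) = of_real (x / real m) powr (- ?w y)" for y
    proof -
      have "complex_of_real x = of_real (x / real m) * of_real (real m)" using m0 by simp
      then have "of_real x powr (- ?w y) = of_real (x / real m) powr (- ?w y) * of_real (real m) powr (- ?w y)"
        using True m0 powr_times_real[of "of_real (x / real m)" "of_real (real m)" "- ?w y"] by (simp only:) simp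
      then show ?thesis using m0 by (simp add: powr_minus)
    qed
    have "(LBINT y. K y x) = (LBINT y. of_real (P2 x) * (Gamma (?w y) * Gamma (v + 2 - ?w y) * of_real (x / real m) powr (- ?w y)))"
      using True unfolding K_def A_def pw[symmetric]
      by (intro Bochner_Integration.integral_cong refl) (simp add: mult_ac)
    also have "\<dots> = of_real (P2 x) * (2 * pi * Gamma (v + 2) * of_real (1 + x / real m) powr (- (v + 2)))"
      unfolding integral_mult_right_zero using c v True m0 by (subst mellin_barnes) auto
    also have "of_real (1 + x / real m) powr (- (v + 2)) = of_nat m powr (v + 2) * of_real (real m + x) powr (- v - 2)"
    proof -
      have e: "- (v + 2) = - v - 2" by simp
      have "complex_of_real (real m + x) = of_real (1 + x / real m) * of_real (real m)"
        using m0 by (simp add: field_simps)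
      then have "of_real (real m + x) powr (- v - 2) = of_real (1 + x / real m) powr (- v - 2) * of_real (real m) powr (- v - 2)"
        using True m0 powr_times_real[of "of_real (1 + x / real m)" "of_real (real m)" "- v - 2"]
        by (simp only:) simp
      moreover have "of_real (real m) powr (- v - 2) * complex_of_nat m powr (v + 2) = 1"
        unfolding e[symmetric] powr_minus using m0 by simp
      ultimately show ?thesis unfolding e by (simp add: mult_ac)
    qed
    finally show ?thesis using True by (simp add: mult_ac)
  qed (simp add: K_def)
  have Kx: "(LBINT x. K y x) = - (Gamma v * of_nat m powr (v + 2))
       * (mb_weight v (Complex c y) * of_nat m powr (Complex c y - v))" for y
  proof -
    let ?z = "Complex c y"
    have w: "?w y = ?z + 2" by (simp add: complex_eq_iff)
    have nz: "?z \<notin> \<int>\<^sub>\<le>\<^sub>0" using c by (auto dest!: nonpos_Ints_Re elim!: Ints_cases)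
    have e: "- (?z + 2) = - ?z - 2" "v + 2 - (?z + 2) = v - ?z" by simp_all
    have "(LBINT x. K y x) = A y * em_int ?z (real 0)"
      unfolding K_def em_int_def set_lebesgue_integral_def em_ker_def w e
      by (simp only: of_nat_0 mult_scaleR_right[symmetric] integral_mult_right_zero)
    also have "\<dots> = ?z * (?z + 1) * Gamma ?z * Gamma (v - ?z) * of_nat m powr (?z + 2) * em_int ?z (real 0)"
      unfolding A_def w e Gamma_plus2[OF nz] ..
    also have "\<dots> = - (Gamma ?z * Gamma (v - ?z) * of_nat m powr (?z + 2) * em_rem ?z 0)"
      by (simp add: em_rem_def)
    also have "em_rem ?z 0 = riemann_zeta ?z" using c by (subst riemann_zeta_em0) auto
    also have "of_nat m powr (?z + 2) = of_nat m powr (v + 2) * (of_nat m powr (?z - v) :: complex)"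
      unfolding powr_add[symmetric] by (simp add: algebra_simps)
    finally show ?thesis using Gv by simp
  qed
  have "- (Gamma v * of_nat m powr (v + 2)) * (LBINT y. mb_weight v (Complex c y)
             * of_nat m powr (Complex c y - v)) = (\<integral>y. \<integral>x. K y x \<partial>lborel \<partial>lborel)"
    unfolding Kx integral_mult_right_zero ..
  also have "\<dots> = (\<integral>x. \<integral>y. K y x \<partial>lborel \<partial>lborel)"
    using iK by (rule lborel_pair.Fubini_integral[symmetric])
  also have "\<dots> = 2 * pi * Gamma (v + 2) * of_nat m powr (v + 2) * em_int v (real m)"
    unfolding Ky integral_mult_right_zero em_int_shift set_lebesgue_integral_def ..
  also have "Gamma (v + 2) = v * (v + 1) * Gamma v"
    using v by (intro Gamma_plus2) (auto dest!: nonpos_Ints_Re)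
  finally have "- (Gamma v * of_nat m powr (v + 2)) * (LBINT y. mb_weight v (Complex c y)
             * of_nat m powr (Complex c y - v)) = - (Gamma v * of_nat m powr (v + 2)) * (2 * pi * em_rem v m)"
    by (simp add: em_rem_def mult_ac)
  moreover have "- (Gamma v * of_nat m powr (v + 2)) \<noteq> 0" using Gv m0 by simp
  ultimately show ?thesis using mult_left_cancel by blast
qed

text \<open>On this line \<zeta>(u + v - z) is an absolutely convergent Dirichlet series, and each
  term yields an integral from \<open>em_rem_mellin_barnes\<close>. The moduli factor into an
  integrable function of y and a summable sequence, which justifies the exchange.\<close>

lemma em_rem_sums_line_integral:
  assumes c: "-1 < c" "c < 0" and v: "Re v > 0" and uv: "Re (u + v) - c > 1"
  shows "(\<lambda>m. of_nat (Suc m) powr (- u) * em_rem v (Suc m)) sums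
     ((LBINT y. mb_weight v (Complex c y)
            * riemann_zeta (u + v - Complex c y)) / (2 * pi))"
proof -
  define p where "p = (\<lambda>y. mb_weight v (Complex c y))"
  have pi: "integrable lborel p" unfolding p_def by (rule zeta_line_integrable[OF c v])
  have [measurable]: "p \<in> borel_measurable borel" using pi by auto
  define f where "f = (\<lambda>m y. p y * of_nat (Suc m) powr (- (u + v - Complex c y)))"
  have nf: "norm (f m y) = norm (p y) * real (Suc m) powr (- (Re (u + v) - c))" for m y
    unfolding f_def norm_mult by (subst norm_powr_real_powr) auto
  have fi: "integrable lborel (f m)" for m
  proof (rule Bochner_Integration.integrable_bound)
    show "integrable lborel (\<lambda>y. norm (p y) * real (Suc m) powr (- (Re (u + v) - c)))"
      using pi by (intro integrable_mult_left integrable_norm)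
    show "f m \<in> borel_measurable lborel" unfolding f_def Complex_eq by measurable
  qed (auto simp: nf[simplified])
  have sm: "summable (\<lambda>m. real (Suc m) powr (- (Re (u + v) - c)))"
    by (subst summable_Suc_iff) (use uv in \<open>simp add: summable_real_powr_iff\<close>)
  have "(\<lambda>m. integral\<^sup>L lborel (f m)) sums (LBINT y. (\<Sum>m. f m y))"
  proof (rule sums_integral[OF fi])
    show "AE y in lborel. summable (\<lambda>m. norm (f m y))"
      unfolding nf by (intro always_eventually allI summable_mult sm)
    show "summable (\<lambda>m. \<integral>y. norm (f m y) \<partial>lborel)"
      unfolding nf integral_mult_left_zero by (intro summable_mult sm)
  qed
  moreover have "(\<Sum>m. f m y) = p y * riemann_zeta (u + v - Complex c y)" for y
  proof -
    have "Re (u + v - Complex c y) > 1" using uv by simp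
    from sums_mult[OF riemann_zeta_sums[OF this], of "p y"] show ?thesis
      unfolding f_def by (simp add: sums_iff)
  qed
  moreover have "integral\<^sup>L lborel (f m) = 2 * pi * (of_nat (Suc m) powr (- u) * em_rem v (Suc m))" for m
  proof -
    have "integral\<^sup>L lborel (f m) = (LBINT y. of_nat (Suc m) powr (- u) * (p y * of_nat (Suc m) powr (Complex c y - v)))"
    proof (intro Bochner_Integration.integral_cong refl)
      fix y
      have "- (u + v - Complex c y) = - u + (Complex c y - v)" by simp
      then have "of_nat (Suc m) powr (- (u + v - Complex c y)) = of_nat (Suc m) powr (- u) * of_nat (Suc m) powr (Complex c y - v)"
        by (simp only: powr_add)
      then show "f m y = of_nat (Suc m) powr (- u) * (p y * of_nat (Suc m) powr (Complex c y - v))"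
        unfolding f_def by (simp only: mult_ac)
    qed
    then show ?thesis
      unfolding p_def integral_mult_right_zero using em_rem_mellin_barnes[OF c v, of "Suc m"] by (simp only:) (simp add: mult_ac)
  qed
  ultimately have "(\<lambda>m. 2 * pi * (of_nat (Suc m) powr (- u) * em_rem v (Suc m))) sums (LBINT y. p y * riemann_zeta (u + v - Complex c y))"
    by (simp only:)
  then have "(\<lambda>m. 2 * pi * (of_nat (Suc m) powr (- u) * em_rem v (Suc m)) / (2 * pi)) sums ((LBINT y. p y * riemann_zeta (u + v - Complex c y)) / (2 * pi))"
    by (rule sums_divide)
  then show ?thesis unfolding p_def by simp
qed

section \<open>Closed form of the symmetric sum of remainders\<close>

lemma em_rem_times_tendsto:
  assumes "Re v > 0"
  shows "(\<lambda>m. of_nat (Suc m) * em_rem v (Suc m)) \<longlonglongrightarrow> 0"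
proof (rule Lim_null_comparison)
  show "\<forall>\<^sub>F m in sequentially. norm (of_nat (Suc m) * em_rem v (Suc m))
     \<le> norm v * norm (v + 1) / (8 * (Re v + 1)) * real (Suc m) powr (- Re v)"
  proof (intro always_eventually allI)
    fix m
    have "norm (em_rem v (Suc m)) \<le> norm v * norm (v + 1) * (real (Suc m) powr (- Re v - 1) / (8 * (Re v + 1)))"
      using assms by (intro em_rem_bound) auto
    then have "real (Suc m) * norm (em_rem v (Suc m)) \<le> real (Suc m) * (norm v * norm (v + 1) * (real (Suc m) powr (- Re v - 1) / (8 * (Re v + 1))))"
      by (intro mult_left_mono) auto
    also have "\<dots> = norm v * norm (v + 1) / (8 * (Re v + 1)) * (real (Suc m) powr 1 * real (Suc m) powr (- Re v - 1))"
      by simp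
    also have "real (Suc m) powr 1 * real (Suc m) powr (- Re v - 1) = real (Suc m) powr (- Re v)"
      unfolding powr_add[symmetric] by simp
    finally show "norm (of_nat (Suc m) * em_rem v (Suc m)) \<le> norm v * norm (v + 1) / (8 * (Re v + 1)) * real (Suc m) powr (- Re v)"
      by (simp only: norm_mult norm_of_nat)
  qed
  have "(\<lambda>m. real (Suc m) powr (- Re v)) \<longlonglongrightarrow> 0" using assms by real_asymp
  then show "(\<lambda>m. norm v * norm (v + 1) / (8 * (Re v + 1)) * real (Suc m) powr (- Re v)) \<longlonglongrightarrow> 0"
    by (rule tendsto_mult_right_zero)
qed

lemma nat_powr_tendsto_0:
  assumes "Re v > 0"
  shows "(\<lambda>m. complex_of_nat (Suc m) powr (- v)) \<longlonglongrightarrow> 0"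
proof -
  have "(\<lambda>m. real (Suc m) powr (- Re v)) \<longlonglongrightarrow> 0" using assms by real_asymp
  then show ?thesis by (subst tendsto_norm_zero_iff[symmetric], subst norm_powr_real_powr) auto
qed

text \<open>A discrete product rule for the tails \<open>R u M * R v M\<close>. The endpoint term m
  powr (-w) / 2 of Euler--Maclaurin makes each of the two remainder terms carry half of the diagonal
  product m powr (-u - v), so that together they complete the difference of consecutive tail
  products.\<close>

lemma em_rem_symmetric_partial_sum:
  fixes u v :: complex
  assumes u: "Re u > 0" "u \<noteq> 1" and v: "Re v > 0" "v \<noteq> 1"
  defines "R \<equiv> \<lambda>w m. riemann_zeta w - (\<Sum>k=1..m. of_nat k powr (- w))"
  shows "(\<Sum>m=1..M. of_nat m powr (- u) * em_rem v m + of_nat m powr (- v) * em_rem u m)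
     = riemann_zeta u * riemann_zeta v - R u M * R v M
        - (1 / (v - 1) + 1 / (u - 1)) * (\<Sum>m=1..M. of_nat m powr (1 - u - v))"
proof (induction M)
  case 0
  then show ?case by (simp add: R_def)
next
  case (Suc M)
  let ?m = "complex_of_nat (Suc M)"
  have e: "em_rem w (Suc M) = R w (Suc M) - ?m powr (1 - w) * (1 / (w - 1)) + ?m powr (- w) / 2"
    if "Re w > 0" "w \<noteq> 1" for w
    using riemann_zeta_em[of w "Suc M"] that unfolding R_def by simp
  have R: "R w M = R w (Suc M) + ?m powr (- w)" for w by (simp add: R_def)
  have pw: "?m powr (- u) * ?m powr (1 - v) = ?m powr (1 - u - v)" "?m powr (- v) * ?m powr (1 - u) = ?m powr (1 - u - v)"
    unfolding powr_add[symmetric] by (simp_all add: algebra_simps)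
  define a b p q where "a = ?m powr (- u)" and "b = ?m powr (- v)" and "p = 1 / (v - 1)" and "q = 1 / (u - 1)"
  have 1: "a * em_rem v (Suc M) = a * R v (Suc M) - ?m powr (1 - u - v) * p + a * b / 2"
    unfolding e[OF v] a_def b_def p_def pw(1)[symmetric] by (simp add: algebra_simps)
  have 2: "b * em_rem u (Suc M) = b * R u (Suc M) - ?m powr (1 - u - v) * q + a * b / 2"
    unfolding e[OF u] a_def b_def q_def pw(2)[symmetric] by (simp add: algebra_simps)
  have "(\<Sum>m=1..Suc M. of_nat m powr (- u) * em_rem v m + of_nat m powr (- v) * em_rem u m)
     = riemann_zeta u * riemann_zeta v - R u M * R v M - (p + q) * (\<Sum>m=1..M. of_nat m powr (1 - u - v))
       + (a * em_rem v (Suc M) + b * em_rem u (Suc M))"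
    unfolding p_def q_def a_def b_def using Suc.IH by simp
  also have "\<dots> = riemann_zeta u * riemann_zeta v - R u (Suc M) * R v (Suc M)
       - (p + q) * ((\<Sum>m=1..M. of_nat m powr (1 - u - v)) + ?m powr (1 - u - v))"
    unfolding 1 2 R[of u] R[of v] a_def[symmetric] b_def[symmetric] by (simp add: algebra_simps)
  finally show ?case unfolding p_def q_def by simp
qed

text \<open>The tail product and the sum of j powr (1 - u - v) need not converge separately, but
  their combination does. Applying Euler--Maclaurin also at q = u + v - 1, which differs from 1 by
  assumption, exposes the cancellation and leaves only \<zeta>(q).\<close>

lemma em_rem_symmetric_sum:
  fixes u v :: complex
  assumes u: "Re u > 0" "u \<noteq> 1" and v: "Re v > 0" "v \<noteq> 1" and q: "u + v \<noteq> 2"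
    and S: "(\<lambda>m. of_nat (Suc m) powr (- u) * em_rem v (Suc m)) sums S"
    and S': "(\<lambda>m. of_nat (Suc m) powr (- v) * em_rem u (Suc m)) sums S'"
  shows "S + S' = riemann_zeta u * riemann_zeta v - (1 / (v - 1) + 1 / (u - 1)) * riemann_zeta (u + v - 1)"
proof -
  define k where "k = 1 / (v - 1) + 1 / (u - 1)"
  define q where "q = u + v - 1"
  have q1: "Re q > -1" "q \<noteq> 1" using assms by (auto simp: q_def)
  define R where "R = (\<lambda>w m. riemann_zeta w - (\<Sum>k=1..m. of_nat k powr (- w)))"
  \<comment> \<open>The explicit part of the tail \<open>R w\<close>, divided by m. It tends to 0,
    and so does m times a remainder; hence all mixed products vanish in the limit.\<close>
  define b where "b = (\<lambda>w m. of_nat (Suc m) powr (- w) / (w - 1) - of_nat (Suc m) powr (- (w + 1)) / 2 :: complex)"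
  have b0: "b w \<longlonglongrightarrow> 0" if "Re w > 0" for w
  proof -
    have "(\<lambda>m. of_nat (Suc m) powr (- w) / (w - 1) - of_nat (Suc m) powr (- (w + 1)) / 2 :: complex) \<longlonglongrightarrow> 0 / (w - 1) - 0 / 2"
      unfolding divide_inverse using that by (intro tendsto_diff tendsto_mult tendsto_const nat_powr_tendsto_0) auto
    then show ?thesis by (simp add: b_def)
  qed
  have Rm: "R w (Suc m) = of_nat (Suc m) powr (1 - w) / (w - 1) - of_nat (Suc m) powr (- w) / 2 + em_rem w (Suc m)"
    if "Re w > -1" "w \<noteq> 1" for w m
    using riemann_zeta_em[of w "Suc m"] that unfolding R_def by simp
  have Rb: "R w (Suc m) = of_nat (Suc m) * b w m + em_rem w (Suc m)" if "Re w > 0" "w \<noteq> 1" for w m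
  proof -
    let ?m = "complex_of_nat (Suc m)"
    have "?m powr (1 + - w) = ?m * ?m powr (- w)" "?m powr (1 + - (w + 1)) = ?m * ?m powr (- (w + 1))"
      unfolding powr_add by simp_all
    moreover have "1 + - w = 1 - w" "1 + - (w + 1) = - w" by simp_all
    ultimately have "?m powr (1 - w) = ?m * ?m powr (- w)" "?m powr (- w) = ?m * ?m powr (- (w + 1))" by simp_all
    then have "?m powr (1 - w) / (w - 1) - ?m powr (- w) / 2 = ?m * b w m"
      unfolding b_def by (simp only: right_diff_distrib times_divide_eq_right)
    moreover have "Re w > -1" using that by simp
    ultimately show ?thesis using Rm[of w m] that by simp
  qed
  have key: "R u (Suc m) * R v (Suc m) + k * (\<Sum>j=1..Suc m. of_nat j powr (1 - u - v))
     = k * riemann_zeta q - k * em_rem q (Suc m) + of_nat (Suc m) powr (- (u + v)) / 4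
       + b u m * (of_nat (Suc m) * em_rem v (Suc m)) + b v m * (of_nat (Suc m) * em_rem u (Suc m))
       + em_rem u (Suc m) * em_rem v (Suc m)" for m
  proof -
    let ?m = "complex_of_nat (Suc m)"
    have s: "(\<Sum>j=1..Suc m. of_nat j powr (1 - u - v)) = riemann_zeta q - R q (Suc m)"
      unfolding R_def q_def by (simp add: algebra_simps)
    define X where "X = ?m powr (- (u + v))"
    have p1: "?m powr (1 - q) = ?m * ?m * X" "?m powr (- q) = ?m * X"
    proof -
      have "?m powr (1 + 1 + - (u + v)) = ?m * ?m * X" "?m powr (1 + - (u + v)) = ?m * X"
        unfolding X_def powr_add by simp_all
      moreover have "1 + 1 + - (u + v) = 1 - q" "1 + - (u + v) = - q" by (simp_all add: q_def)
      ultimately show "?m powr (1 - q) = ?m * ?m * X" "?m powr (- q) = ?m * X" by (simp_all only:)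
    qed
    define U V where "U = ?m powr (- u)" and "V = ?m powr (- v)"
    have UV: "U * V = X" unfolding U_def V_def X_def powr_add[symmetric] by (simp add: algebra_simps)
    have pU: "?m powr (1 - u) = ?m * U" "?m powr (1 - v) = ?m * V"
    proof -
      have "?m powr (1 + - u) = ?m * U" "?m powr (1 + - v) = ?m * V"
        unfolding U_def V_def powr_add by simp_all
      then show "?m powr (1 - u) = ?m * U" "?m powr (1 - v) = ?m * V" by simp_all
    qed
    define au av where "au = 1 / (u - 1)" and "av = 1 / (v - 1)"
    have nz: "u - 1 \<noteq> 0" "v - 1 \<noteq> 0" "q - 1 \<noteq> 0" using u v q1 by auto
    \<comment> \<open>Partial fractions with q - 1 = (u - 1) + (v - 1). The power m powr (2 - u - v)
      occurs with this same coefficient in the tail product and in k times the tail of \<zeta>(q),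
      so it cancels.\<close>
    have kk: "k / (q - 1) = au * av"
    proof -
      have "au * (u - 1) = 1" "av * (v - 1) = 1" using nz by (simp_all add: au_def av_def)
      then have "av + au = (u - 1 + (v - 1)) * (au * av)" by algebra
      then have "k = (q - 1) * (au * av)" by (simp add: k_def au_def av_def q_def)
      then show ?thesis using nz by simp
    qed
    have bu: "?m * b u m = ?m * U * au - U / 2" and bv: "?m * b v m = ?m * V * av - V / 2"
      using Rb[of u m] Rm[of u m] Rb[of v m] Rm[of v m] u v
      unfolding pU U_def[symmetric] V_def[symmetric] au_def av_def by simp_all
    have "(?m * b u m) * (?m * b v m) = ?m * ?m * X * (au * av) - ?m * X / 2 * (au + av) + X / 4"
      unfolding bu bv UV[symmetric] by (simp add: field_simps)
    also have "\<dots> = ?m * ?m * X * (k / (q - 1)) - ?m * X / 2 * k + X / 4"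
      unfolding kk by (simp add: k_def au_def av_def add.commute)
    finally have prod: "(?m * b u m) * (?m * b v m) = ?m * ?m * X * (k / (q - 1)) - ?m * X / 2 * k + X / 4" .
    have "R u (Suc m) * R v (Suc m) = (?m * b u m) * (?m * b v m) + (?m * b u m) * em_rem v (Suc m) + (?m * b v m) * em_rem u (Suc m) + em_rem u (Suc m) * em_rem v (Suc m)"
      unfolding Rb[OF u] Rb[OF v] by (simp add: algebra_simps)
    moreover have "k * (riemann_zeta q - R q (Suc m)) = k * riemann_zeta q - ?m * ?m * X * (k / (q - 1)) + ?m * X / 2 * k - k * em_rem q (Suc m)"
    proof -
      have *: "k * (z - (P - Q / 2 + e)) = k * z - k * P + Q / 2 * k - k * e" for z P Q e
        by (simp add: algebra_simps)
      show ?thesis unfolding Rm[OF q1] p1 * by (simp add: mult_ac)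
    qed
    moreover have "r + K = kz - ke + x4 + bu * (mm * tv) + bv * (mm * tu) + tt"
      if "r = p + (mm * bu) * tv + (mm * bv) * tu + tt" "K = kz - w + v' - ke" "p = w - v' + x4"
      for r K kz ke x4 bu bv mm tu tv tt w v' p :: complex
      unfolding that by (simp add: algebra_simps)
    ultimately show ?thesis unfolding s using prod unfolding X_def[symmetric] by blast
  qed
  have lim: "(\<lambda>m. k * riemann_zeta q - k * em_rem q (Suc m) + of_nat (Suc m) powr (- (u + v)) / 4
       + b u m * (of_nat (Suc m) * em_rem v (Suc m)) + b v m * (of_nat (Suc m) * em_rem u (Suc m))
       + em_rem u (Suc m) * em_rem v (Suc m)) \<longlonglongrightarrow> k * riemann_zeta q - k * 0 + 0 / 4 + 0 * 0 + 0 * 0 + 0 * 0"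
    using u v q1
    by (intro tendsto_add tendsto_diff tendsto_mult tendsto_divide tendsto_const em_rem_tendsto nat_powr_tendsto_0 em_rem_times_tendsto b0) auto
  have "(\<lambda>m. of_nat (Suc m) powr (- u) * em_rem v (Suc m) + of_nat (Suc m) powr (- v) * em_rem u (Suc m)) sums (S + S')"
    by (rule sums_add[OF S S'])
  then have "(\<lambda>M. \<Sum>m<Suc M. of_nat (Suc m) powr (- u) * em_rem v (Suc m) + of_nat (Suc m) powr (- v) * em_rem u (Suc m)) \<longlonglongrightarrow> S + S'"
    unfolding sums_def by (rule LIMSEQ_Suc)
  moreover have "(\<Sum>m<Suc M. of_nat (Suc m) powr (- u) * em_rem v (Suc m) + of_nat (Suc m) powr (- v) * em_rem u (Suc m))
     = riemann_zeta u * riemann_zeta v - (R u (Suc M) * R v (Suc M) + k * (\<Sum>m=1..Suc M. of_nat m powr (1 - u - v)))" for M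
  proof -
    have "(\<Sum>m<Suc M. of_nat (Suc m) powr (- u) * em_rem v (Suc m) + of_nat (Suc m) powr (- v) * em_rem u (Suc m))
        = (\<Sum>m=1..Suc M. of_nat m powr (- u) * em_rem v m + of_nat m powr (- v) * em_rem u m)"
      by (simp only: One_nat_def sum.atLeast1_atMost_eq)
    also have "\<dots> = riemann_zeta u * riemann_zeta v - R u (Suc M) * R v (Suc M) - k * (\<Sum>m=1..Suc M. of_nat m powr (1 - u - v))"
      unfolding R_def k_def by (rule em_rem_symmetric_partial_sum[OF u v])
    finally show ?thesis by (simp only: diff_diff_eq)
  qed
  ultimately have "(\<lambda>M. riemann_zeta u * riemann_zeta v - (k * riemann_zeta q - k * em_rem q (Suc M) + of_nat (Suc M) powr (- (u + v)) / 4
       + b u M * (of_nat (Suc M) * em_rem v (Suc M)) + b v M * (of_nat (Suc M) * em_rem u (Suc M))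
       + em_rem u (Suc M) * em_rem v (Suc M))) \<longlonglongrightarrow> S + S'"
    by (simp only: key)
  from LIMSEQ_unique[OF this tendsto_diff[OF tendsto_const lim]]
  show ?thesis by (simp add: k_def q_def)
qed

section \<open>Shifting vertical lines of integration\<close>

text \<open>On the vertical line at distance d to the left of s, the real part of A / (z - s) is -A
  times this kernel. The integral does not depend on d and accounts for half of a full residue
  contribution 2 \<pi> A.\<close>

lemma poisson_kernel_integral:
  fixes d t :: real
  assumes d: "d > 0"
  shows "integrable lborel (\<lambda>y. d / (d\<^sup>2 + (y - t)\<^sup>2))"
    and "(LBINT y. d / (d\<^sup>2 + (y - t)\<^sup>2)) = pi"
proof -
  have eq: "d / (d\<^sup>2 + (t + d * x - t)\<^sup>2) = inverse d * inverse (1 + x\<^sup>2)" for x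
  proof -
    have "d\<^sup>2 + (t + d * x - t)\<^sup>2 = d * (d * (1 + x\<^sup>2))" by (simp add: power2_eq_square algebra_simps)
    also have "d / \<dots> = inverse d * inverse (1 + x\<^sup>2)"
    proof -
      have "d / (d * (d * q)) = inverse d * inverse q" for q using d by (simp add: divide_simps)
      then show ?thesis .
    qed
    finally show ?thesis .
  qed
  have i: "integrable lborel (\<lambda>x::real. inverse (1 + x\<^sup>2))"
    using integrable_inverse_1_plus_square by (simp add: set_integrable_def)
  have v: "(LBINT x. inverse (1 + x\<^sup>2)) = pi"
    using LBINT_inverse_1_plus_square by (simp add: interval_lebesgue_integral_def set_lebesgue_integral_def)
  have "integrable lborel (\<lambda>x. d / (d\<^sup>2 + (t + d * x - t)\<^sup>2))"
    unfolding eq using i by (rule integrable_mult_right)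
  then show "integrable lborel (\<lambda>y. d / (d\<^sup>2 + (y - t)\<^sup>2))"
    using d lborel_integrable_real_affine_iff[of d "\<lambda>y. d / (d\<^sup>2 + (y - t)\<^sup>2)" t] by simp
  have "(LBINT y. d / (d\<^sup>2 + (y - t)\<^sup>2)) = \<bar>d\<bar> *\<^sub>R (LBINT x. d / (d\<^sup>2 + (t + d * x - t)\<^sup>2))"
    using d by (intro lborel_integral_real_affine) auto
  then show "(LBINT y. d / (d\<^sup>2 + (y - t)\<^sup>2)) = pi"
    unfolding eq integral_mult_right_zero v using d by simp
qed

text \<open>Dominated convergence: the deleted interval shrinks to a single point, a null
  set.\<close>

lemma has_pv_integral_integrable:
  assumes f: "integrable lborel f"
  shows "has_pv_integral f c (LBINT x. f x)"
  unfolding has_pv_integral_def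
proof (intro conjI allI impI)
  have [measurable]: "f \<in> borel_measurable borel" using f by auto
  have si: "set_integrable lborel A f" if "A \<in> sets borel" for A
    unfolding set_integrable_def using f that by (intro integrable_mult_indicator) auto
  fix e :: real
  show "set_integrable lborel {..c - e} f" "set_integrable lborel {c + e..} f" by (auto intro: si)
next
  have [measurable]: "f \<in> borel_measurable borel" using f by auto
  have si: "set_integrable lborel A f" if "A \<in> sets borel" for A
    unfolding set_integrable_def using f that by (intro integrable_mult_indicator) auto
  show "((\<lambda>e. (LINT x:{..c - e}|lborel. f x) + (LINT x:{c + e..}|lborel. f x)) \<longlongrightarrow> (LBINT x. f x)) (at_right 0)"
  proof (rule tendsto_at_right_sequentially[of 0 1])
    fix S :: "nat \<Rightarrow> real"
    assume S: "\<And>n. 0 < S n" "S \<longlonglongrightarrow> 0"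
    have "(\<lambda>n. \<integral>x. indicator ({..c - S n} \<union> {c + S n..}) x *\<^sub>R f x \<partial>lborel) \<longlonglongrightarrow> (LBINT x. f x)"
    proof (rule integral_dominated_convergence[where w = "\<lambda>x. norm (f x)"])
      have "AE x in lborel. x \<noteq> c" by (rule AE_lborel_singleton)
      then show "AE x in lborel. (\<lambda>n. indicator ({..c - S n} \<union> {c + S n..}) x *\<^sub>R f x) \<longlonglongrightarrow> f x"
      proof eventually_elim
        case (elim x)
        then have "\<bar>x - c\<bar> > 0" by simp
        then have "\<forall>\<^sub>F n in sequentially. S n < \<bar>x - c\<bar>" by (rule order_tendstoD(2)[OF S(2)])
        then have "\<forall>\<^sub>F n in sequentially. indicator ({..c - S n} \<union> {c + S n..}) x *\<^sub>R f x = f x"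
          by eventually_elim (auto simp: indicator_def)
        then show ?case by (rule tendsto_eventually)
      qed
      show "AE x in lborel. norm (indicator ({..c - S n} \<union> {c + S n..}) x *\<^sub>R f x) \<le> norm (f x)" for n
        by (intro always_eventually) (auto simp: indicator_def)
    qed (use f in auto)
    moreover have "(LBINT x. indicator ({..c - S n} \<union> {c + S n..}) x *\<^sub>R f x)
        = (LINT x:{..c - S n}|lborel. f x) + (LINT x:{c + S n..}|lborel. f x)" for n
      unfolding set_lebesgue_integral_def[symmetric]
      using S(1)[of n] by (intro set_integral_Un si) auto
    ultimately show "(\<lambda>n. (LINT x:{..c - S n}|lborel. f x) + (LINT x:{c + S n..}|lborel. f x)) \<longlonglongrightarrow> (LBINT x. f x)"
      by simp
  qed simp
qed

lemma integral_symmetric_interval_tendsto: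
  fixes f :: "real \<Rightarrow> real"
  assumes f: "integrable lborel f"
  shows "(\<lambda>n. integral {- real n..real n} f) \<longlonglongrightarrow> (LBINT x. f x)"
proof -
  have [measurable]: "f \<in> borel_measurable borel" using f by auto
  have "(\<lambda>n. \<integral>x. indicator {- real n..real n} x *\<^sub>R f x \<partial>lborel) \<longlonglongrightarrow> (LBINT x. f x)"
  proof (rule integral_dominated_convergence[where w = "\<lambda>x. norm (f x)"])
    show "AE x in lborel. (\<lambda>n. indicator {- real n..real n} x *\<^sub>R f x) \<longlonglongrightarrow> f x"
    proof (rule always_eventually, rule allI, rule tendsto_eventually)
      fix x
      obtain N where "\<bar>x\<bar> \<le> real N" using real_arch_simple by blast
      then have "indicator {- real n..real n} x *\<^sub>R f x = f x" if "n \<ge> N" for n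
        using that by (auto simp: indicator_def)
      then show "\<forall>\<^sub>F n in sequentially. indicator {- real n..real n} x *\<^sub>R f x = f x"
        unfolding eventually_sequentially by blast
    qed
    show "AE x in lborel. norm (indicator {- real n..real n} x *\<^sub>R f x) \<le> norm (f x)" for n
      by (intro always_eventually) (auto simp: indicator_def)
  qed (use f in auto)
  moreover have "(LBINT x. indicator {- real n..real n} x *\<^sub>R f x) = integral {- real n..real n} f" for n
  proof -
    have "set_integrable lborel {- real n..real n} f"
      unfolding set_integrable_def using f by (intro integrable_mult_indicator) auto
    then show ?thesis using set_borel_integral_eq_integral(2) unfolding set_lebesgue_integral_def by blast
  qed
  ultimately show ?thesis by simp
qed

section \<open>The residue theorem on tall rectangles\<close>

lemma contour_integral_rectpath:
  assumes ab: "a < b" and T: "T > 0"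
    and cont: "continuous_on (path_image (rectpath (Complex a (-T)) (Complex b T))) f"
  shows "contour_integral (rectpath (Complex a (-T)) (Complex b T)) f
     = contour_integral (linepath (Complex a (-T)) (Complex b (-T))) f
     + contour_integral (linepath (Complex b T) (Complex a T)) f
     + \<i> * (integral {-T..T} (\<lambda>y. f (Complex b y)) - integral {-T..T} (\<lambda>y. f (Complex a y)))"
proof -
  let ?a1 = "Complex a (-T)" and ?a2 = "Complex b (-T)" and ?a3 = "Complex b T" and ?a4 = "Complex a T"
  have pi: "path_image (rectpath ?a1 ?a3) = closed_segment ?a1 ?a2 \<union> closed_segment ?a2 ?a3 \<union> closed_segment ?a3 ?a4 \<union> closed_segment ?a4 ?a1"
    by (simp add: rectpath_def Let_def path_image_join Un_assoc)
  have ci: "f contour_integrable_on linepath p q" if "closed_segment p q \<subseteq> path_image (rectpath ?a1 ?a3)" for p q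
    by (rule contour_integrable_continuous_linepath) (rule continuous_on_subset[OF cont that])
  have c1: "f contour_integrable_on linepath ?a1 ?a2" by (rule ci) (unfold pi, blast)
  have c2: "f contour_integrable_on linepath ?a2 ?a3" by (rule ci) (unfold pi, blast)
  have c3: "f contour_integrable_on linepath ?a3 ?a4" by (rule ci) (unfold pi, blast)
  have c4: "f contour_integrable_on linepath ?a4 ?a1" by (rule ci) (unfold pi, blast)
  have "contour_integral (rectpath ?a1 ?a3) f = contour_integral (linepath ?a1 ?a2) f + contour_integral (linepath ?a2 ?a3) f
      + contour_integral (linepath ?a3 ?a4) f + contour_integral (linepath ?a4 ?a1) f"
    unfolding rectpath_def Let_def using c1 c2 c3 c4
    by (simp add: contour_integrable_joinI add.assoc)
  moreover have "contour_integral (linepath ?a2 ?a3) f = \<i> * integral {-T..T} (\<lambda>y. f (Complex b y))"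
    using T by (intro contour_integral_linepath_same_Re) auto
  moreover have "contour_integral (linepath ?a4 ?a1) f = - contour_integral (linepath ?a1 ?a4) f"
    using contour_integral_reversepath[of "linepath ?a1 ?a4" f] by simp
  moreover have "contour_integral (linepath ?a1 ?a4) f = \<i> * integral {-T..T} (\<lambda>y. f (Complex a y))"
    using T by (intro contour_integral_linepath_same_Re) auto
  ultimately show ?thesis by (simp add: algebra_simps)
qed

text \<open>Integrability is assumed for real parts only, because A / (z - s) can contribute an
  imaginary part of order 1 / y along both lines. The residue theorem is therefore applied on
  symmetric rectangles, and the limit of infinite height is taken after passing to real parts;
  \<beta> disposes of the horizontal sides.\<close>

theorem vertical_line_shift:
  fixes E :: "complex \<Rightarrow> complex"
  assumes ab: "a' < a" "a < b" "b < b'"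
    and pts: "finite pts" "\<And>p. p \<in> pts \<Longrightarrow> a < Re p \<and> Re p < b"
    and hol: "E holomorphic_on {z. a' < Re z \<and> Re z < b'} - pts"
    and decay: "\<And>z. a \<le> Re z \<Longrightarrow> Re z \<le> b \<Longrightarrow> \<bar>Im z\<bar> \<ge> T0 \<Longrightarrow> norm (E z) \<le> \<beta> \<bar>Im z\<bar>"
    and \<beta>: "(\<beta> \<longlongrightarrow> 0) at_top"
    and int: "integrable lborel (\<lambda>y. Re (E (Complex a y)))" "integrable lborel (\<lambda>y. Re (E (Complex b y)))"
  shows "(LBINT y. Re (E (Complex b y))) - (LBINT y. Re (E (Complex a y)))
     = 2 * pi * Re (\<Sum>p\<in>pts. residue E p)"
proof -
  let ?R = "\<Sum>p\<in>pts. residue E p"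
  let ?S = "{z. a' < Re z \<and> Re z < b'}"
  have S: "?S = {z. a' < Re z} \<inter> {z. Re z < b'}" by auto
  have oS: "open ?S" unfolding S by (intro open_Int open_halfspace_Re_gt open_halfspace_Re_lt)
  have cS: "connected ?S" unfolding S
    by (intro convex_connected convex_Int convex_halfspace_Re_gt convex_halfspace_Re_lt)
  have contE: "continuous_on (?S - pts) E" using hol by (rule holomorphic_on_imp_continuous_on)
  define I where "I = (\<lambda>x T. integral {-T..T} (\<lambda>y. E (Complex x y)))"
  \<comment> \<open>X and N give a height from which on all poles lie strictly inside the rectangle
    and the decay hypothesis is available on the horizontal sides.\<close>
  define X where "X = Max (insert 0 ((\<lambda>p. \<bar>Im p\<bar>) ` pts))"
  define N where "N = nat \<lceil>max 1 (max T0 (X + 1))\<rceil>"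
  have X: "\<bar>Im p\<bar> \<le> X" if "p \<in> pts" for p
    unfolding X_def using that pts(1) by (intro Max_ge) auto
  have N: "real n \<ge> 1" "real n \<ge> T0" "X < real n" if n: "n \<ge> N" for n
  proof -
    have "real n \<ge> max 1 (max T0 (X + 1))"
      using n unfolding N_def by linarith
    then have "1 \<le> real n \<and> T0 \<le> real n \<and> X + 1 \<le> real n" by simp
    then show "real n \<ge> 1" "real n \<ge> T0" "X < real n" by linarith+
  qed
  have main: "norm (I b (real n) - I a (real n) - 2 * pi * ?R) \<le> 2 * (b - a) * \<beta> (real n)"
    if n: "n \<ge> N" for n
  proof -
    define T where "T = real n"
    have T: "T > 0" "T \<ge> T0" "\<And>p. p \<in> pts \<Longrightarrow> \<bar>Im p\<bar> < T" using N[OF n] X by (fastforce simp: T_def)+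
    let ?a1 = "Complex a (-T)" and ?a3 = "Complex b T"
    let ?g = "rectpath ?a1 ?a3"
    \<comment> \<open>The margins a' < a and b < b' place the closed rectangle inside the open
      strip.\<close>
    have cb: "cbox ?a1 ?a3 \<subseteq> ?S" using ab by (auto simp: in_cbox_complex_iff)
    have bx: "p \<in> box ?a1 ?a3" if "p \<in> pts" for p
      using pts(2)[OF that] T(3)[OF that] by (auto simp: in_box_complex_iff abs_less_iff)
    have pim: "path_image ?g = cbox ?a1 ?a3 - box ?a1 ?a3"
      using ab T by (intro path_image_rectpath_cbox_minus_box) auto
    have pi: "path_image ?g \<subseteq> ?S - pts" using cb bx unfolding pim by blast
    have "contour_integral ?g E = 2 * pi * \<i> * (\<Sum>p\<in>pts. winding_number ?g p * residue E p)"
    proof (rule Residue_theorem[OF oS cS pts(1) hol])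
      show "\<forall>z. z \<notin> ?S \<longrightarrow> winding_number ?g z = 0"
        using cb ab T by (intro allI impI winding_number_rectpath_outside) auto
    qed (use pi in auto)
    also have "(\<Sum>p\<in>pts. winding_number ?g p * residue E p) = ?R"
      using bx by (intro sum.cong) (auto simp: winding_number_rectpath)
    finally have 1: "contour_integral ?g E = 2 * pi * \<i> * ?R" .
    have contg: "continuous_on (path_image ?g) E" by (rule continuous_on_subset[OF contE pi])
    have "norm (E (Complex a T)) \<le> \<beta> T" using decay[of "Complex a T"] ab T by auto
    then have "\<beta> T \<ge> 0" using norm_ge_zero order_trans by blast
    have hor: "norm (contour_integral (linepath (Complex x y) (Complex x' y)) E) \<le> \<beta> T * norm (Complex x' y - Complex x y)"
      if xy: "x \<in> {a, b}" "x' \<in> {a, b}" "x \<noteq> x'" "y \<in> {T, -T}" for x x' y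
    proof (rule contour_integral_bound_linepath)
      have seg: "a \<le> Re z \<and> Re z \<le> b \<and> Im z = y" if "z \<in> closed_segment (Complex x y) (Complex x' y)" for z
        using that xy ab by (auto simp: closed_segment_same_Im closed_segment_eq_real_ivl split: if_splits)
      show "E contour_integrable_on linepath (Complex x y) (Complex x' y)"
      proof (rule contour_integrable_continuous_linepath, rule continuous_on_subset[OF contE])
        show "closed_segment (Complex x y) (Complex x' y) \<subseteq> ?S - pts"
        proof
          fix z assume "z \<in> closed_segment (Complex x y) (Complex x' y)"
          then show "z \<in> ?S - pts" using seg[of z] ab T(3)[of z] xy(4) T(1) by auto
        qed
      qed
      fix z assume "z \<in> closed_segment (Complex x y) (Complex x' y)"
      from seg[OF this] show "norm (E z) \<le> \<beta> T" using decay[of z] xy T by auto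
    qed (use \<open>\<beta> T \<ge> 0\<close> in auto)
    define H where "H = contour_integral (linepath (Complex a (-T)) (Complex b (-T))) E + contour_integral (linepath (Complex b T) (Complex a T)) E"
    have nH: "norm H \<le> 2 * (b - a) * \<beta> T"
    proof -
      have "norm (Complex b (-T) - Complex a (-T)) = b - a" "norm (Complex a T - Complex b T) = b - a"
        using ab by (auto simp: norm_complex_def)
      then have "norm (contour_integral (linepath (Complex a (-T)) (Complex b (-T))) E) \<le> \<beta> T * (b - a)"
        "norm (contour_integral (linepath (Complex b T) (Complex a T)) E) \<le> \<beta> T * (b - a)"
        using hor[of a b "-T"] hor[of b a T] ab by simp_all
      then have "norm H \<le> \<beta> T * (b - a) + \<beta> T * (b - a)"
        unfolding H_def by (intro order.trans[OF norm_triangle_ineq] add_mono)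
      then show ?thesis by (simp add: algebra_simps)
    qed
    have "2 * pi * \<i> * ?R = H + \<i> * (I b T - I a T)"
      using contour_integral_rectpath[OF ab(2) T(1) contg] unfolding 1 H_def I_def by (simp only:)
    then have "\<i> * (I b T - I a T - 2 * pi * ?R) = - H"
      by (simp add: algebra_simps)
    then have "norm (I b T - I a T - 2 * pi * ?R) = norm H"
      by (metis norm_minus_cancel norm_mult norm_ii mult_1)
    then show ?thesis using nH by (simp add: T_def)
  qed
  have ReI: "Re (I x (real n)) = integral {- real n..real n} (\<lambda>y. Re (E (Complex x y)))" if x: "x \<in> {a, b}" for x n
  proof -
    have "continuous_on {- real n..real n} (\<lambda>y. E (Complex x y))"
    proof (rule continuous_on_compose2[OF contE])
      show "continuous_on {- real n..real n} (Complex x)" unfolding Complex_eq by (intro continuous_intros)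
      show "Complex x ` {- real n..real n} \<subseteq> ?S - pts" using x ab pts(2) by fastforce
    qed
    then have "(\<lambda>y. E (Complex x y)) integrable_on {- real n..real n}" by (rule integrable_continuous_real)
    then show ?thesis unfolding I_def
      using integral_linear[OF _ bounded_linear_Re] by (fastforce simp: o_def)
  qed
  have "(\<lambda>n. Re (I b (real n)) - Re (I a (real n)) - 2 * pi * Re ?R) \<longlonglongrightarrow> 0"
  proof (rule Lim_null_comparison)
    show "\<forall>\<^sub>F n in sequentially. norm (Re (I b (real n)) - Re (I a (real n)) - 2 * pi * Re ?R) \<le> 2 * (b - a) * \<beta> (real n)"
      unfolding eventually_sequentially
    proof (intro exI[of _ N] allI impI)
      fix n assume n: "n \<ge> N"
      have "Re (I b (real n)) - Re (I a (real n)) - 2 * pi * Re ?R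
         = Re (I b (real n) - I a (real n) - 2 * pi * ?R)" by simp
      then show "norm (Re (I b (real n)) - Re (I a (real n)) - 2 * pi * Re ?R) \<le> 2 * (b - a) * \<beta> (real n)"
        using order.trans[OF abs_Re_le_cmod main[OF n]] by (simp only: real_norm_def)
    qed
    have "(\<lambda>n. \<beta> (real n)) \<longlonglongrightarrow> 0" by (rule filterlim_compose[OF \<beta> filterlim_real_sequentially])
    then show "(\<lambda>n. 2 * (b - a) * \<beta> (real n)) \<longlonglongrightarrow> 0" by (rule tendsto_mult_right_zero)
  qed
  moreover have "(\<lambda>n. Re (I b (real n)) - Re (I a (real n)) - 2 * pi * Re ?R) \<longlonglongrightarrow>
     (LBINT y. Re (E (Complex b y))) - (LBINT y. Re (E (Complex a y))) - 2 * pi * Re ?R"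
    unfolding ReI[of a, simplified] ReI[of b, simplified]
    by (intro tendsto_diff integral_symmetric_interval_tendsto int tendsto_const)
  ultimately have "(LBINT y. Re (E (Complex b y))) - (LBINT y. Re (E (Complex a y))) - 2 * pi * Re ?R = 0"
    using LIMSEQ_unique by blast
  then show ?thesis by simp
qed

section \<open>The mean value integral\<close>

lemma isCont_riemann_zeta: "z \<noteq> 1 \<Longrightarrow> isCont riemann_zeta z"
  using holomorphic_riemann_zeta
  by (meson field_differentiable_imp_continuous_at holomorphic_on_imp_differentiable_at
      open_Compl closed_singleton ComplI singletonD)

lemma isCont_zeta_Z: "isCont zeta_Z z"
  using holomorphic_zeta_Z
  by (meson field_differentiable_imp_continuous_at holomorphic_on_imp_differentiable_at open_UNIV UNIV_I)

text \<open>Conjugation passes through the Euler--Maclaurin formula, all of whose other terms are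
  visibly compatible with it.\<close>

lemma em_rem_cnj:
  assumes "Re v > -1" "v \<noteq> 1" "m \<ge> 1"
  shows "em_rem (cnj v) m = cnj (em_rem v m)"
proof -
  have p: "cnj (of_nat k powr w) = of_nat k powr cnj w" for k w
    by (subst cnj_powr) auto
  have "cnj v \<noteq> 1" using assms(2) by (metis complex_cnj_cnj complex_cnj_one)
  then have "em_rem (cnj v) m = riemann_zeta (cnj v) - ((\<Sum>k=1..m. of_nat k powr (- cnj v))
      + of_nat m powr (1 - cnj v) / (cnj v - 1) - of_nat m powr (- cnj v) / 2)"
    using riemann_zeta_em[of "cnj v" m] assms by simp
  also have "\<dots> = cnj (riemann_zeta v - ((\<Sum>k=1..m. of_nat k powr (- v))
      + of_nat m powr (1 - v) / (v - 1) - of_nat m powr (- v) / 2))"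
    by (simp add: riemann_zeta_cnj p)
  also have "\<dots> = cnj (em_rem v m)" using riemann_zeta_em[OF assms] by simp
  finally show ?thesis .
qed

lemma not_nonpos_Ints_Re: "Re z > 0 \<Longrightarrow> z \<notin> \<int>\<^sub>\<le>\<^sub>0"
  by (auto dest!: nonpos_Ints_Re)

locale zeta_mean_square =
  fixes \<sigma> t :: real
  assumes sigma_pos: "0 < \<sigma>" and sigma_less: "\<sigma> < 1" and t_pos: "0 < t"
begin

definition s :: complex where "s = Complex \<sigma> t"

definition A :: real where "A = (cmod (riemann_zeta s))\<^sup>2"

definition \<phi> :: "complex \<Rightarrow> complex" where
  "\<phi> z = Gamma z * Gamma (s - z) / Gamma s * riemann_zeta z * riemann_zeta (of_real (2 * \<sigma>) - z)"

text \<open>Since Gamma(s - z + 1) = (s - z) Gamma(s - z), this is (s - z) \<phi>(z) in a form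
  regular at s, where its value is minus the residue of \<phi>.\<close>

definition B :: "complex \<Rightarrow> complex" where
  "B z = Gamma z * Gamma (s - z + 1) / Gamma s * riemann_zeta z * riemann_zeta (of_real (2 * \<sigma>) - z)"

text \<open>
  Off \<open>s\<close> this is \<open>\<phi>(z) + A / (z - s)\<close>, i.e. \<open>\<phi>\<close> with its pole at \<open>s\<close> removed; the form below defines
  the value at \<open>s\<close> as well.
\<close>
definition E :: "complex \<Rightarrow> complex" where
  "E z = - (if z = s then deriv B s else (B z - B s) / (z - s))"

text \<open>The right edge excludes the pole of \<zeta>(z) at 1, the left edge the pole of Gamma(z)
  at -1. Inside, Re (s - z) > -1, so s is the only pole of Gamma(s - z).\<close>

definition S :: "complex set" where "S = {z. -1 < Re z \<and> Re z < 1}"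

text \<open>The poles of Gamma(z) and of \<zeta>(2\<sigma> - z). Being a set, it shrinks to one
  point for \<sigma> = 1/2, so the line shift needs no case distinction.\<close>

definition pts :: "complex set" where "pts = {0, of_real (2 * \<sigma> - 1)}"

section \<open>Holomorphy and decay of the regularised integrand\<close>

lemma Re_s [simp]: "Re s = \<sigma>" and Im_s [simp]: "Im s = t"
  by (simp_all add: s_def)

lemma cnj_s: "of_real (2 * \<sigma>) - s = cnj s"
  by (simp add: complex_eq_iff)

lemma s_plus_cnj: "cnj s + s = of_real (2 * \<sigma>)"
  by (simp add: complex_eq_iff)

lemma s_nonzero: "s \<noteq> 0"
  using t_pos Im_s by (metis less_irrefl zero_complex.sel(2))

lemma Gamma_s: "Gamma s \<noteq> 0"
  using t_pos by (auto simp: Gamma_eq_zero_iff dest!: nonpos_Ints_Re)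

lemma open_S: "open S"
proof -
  have "S = {z. -1 < Re z} \<inter> {z. Re z < 1}" by (auto simp: S_def)
  show ?thesis unfolding \<open>S = _\<close> by (intro open_Int open_halfspace_Re_gt open_halfspace_Re_lt)
qed

lemma s_in: "s \<in> S - pts"
  using sigma_pos sigma_less t_pos by (auto simp: S_def pts_def complex_eq_iff)

lemma B_s: "B s = of_real A"
proof -
  have "B s = riemann_zeta s * cnj (riemann_zeta s)"
    unfolding B_def cnj_s riemann_zeta_cnj using Gamma_s by simp
  then show ?thesis unfolding A_def complex_norm_square .
qed

lemma nonpos_Ints_S: "z \<in> S \<Longrightarrow> z \<noteq> 0 \<Longrightarrow> z \<notin> \<int>\<^sub>\<le>\<^sub>0"
  by (auto simp: S_def elim!: nonpos_Ints_cases)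

lemma B_holomorphic: "B holomorphic_on S - pts"
proof -
  have 1: "Gamma holomorphic_on S - pts"
    by (rule holomorphic_Gamma) (use nonpos_Ints_S in \<open>auto simp: pts_def\<close>)
  have 2: "(\<lambda>z. Gamma (s - z + 1)) holomorphic_on S - pts"
  proof (rule holomorphic_Gamma')
    show "(\<lambda>z. s - z + 1) holomorphic_on S - pts" by (intro holomorphic_intros)
    fix z assume "z \<in> S - pts"
    then have "Re (s - z + 1) > 0" using sigma_pos by (simp add: S_def)
    then show "s - z + 1 \<notin> \<int>\<^sub>\<le>\<^sub>0" by (rule not_nonpos_Ints_Re)
  qed
  have 3: "riemann_zeta holomorphic_on S - pts"
    by (rule holomorphic_on_subset[OF holomorphic_riemann_zeta]) (auto simp: S_def)
  have "riemann_zeta \<circ> (\<lambda>z. of_real (2 * \<sigma>) - z) holomorphic_on S - pts"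
    by (rule holomorphic_on_compose_gen[OF _ holomorphic_riemann_zeta])
       (auto simp: pts_def complex_eq_iff intro!: holomorphic_intros)
  then have 4: "(\<lambda>z. riemann_zeta (of_real (2 * \<sigma>) - z)) holomorphic_on S - pts"
    by (simp add: o_def)
  show ?thesis unfolding B_def divide_inverse by (intro holomorphic_on_mult holomorphic_on_const 1 2 3 4)
qed

lemma open_S_pts: "open (S - pts)"
  using open_S by (rule open_Diff) (simp add: pts_def finite_imp_closed)

lemma E_holomorphic: "E holomorphic_on S - pts"
proof -
  have "(\<lambda>z. if z = s then deriv B s else (B z - B s) / (z - s)) holomorphic_on S - pts"
    by (rule pole_lemma_open[OF B_holomorphic open_S_pts])
  then show ?thesis unfolding E_def by (rule holomorphic_on_minus)
qed

lemma B_eq: "z \<in> S \<Longrightarrow> z \<noteq> s \<Longrightarrow> B z = (s - z) * \<phi> z"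
proof -
  assume z: "z \<in> S" "z \<noteq> s"
  have "s - z \<notin> \<int>\<^sub>\<le>\<^sub>0"
  proof
    assume "s - z \<in> \<int>\<^sub>\<le>\<^sub>0"
    then obtain n where n: "s - z = of_int n" "n \<le> 0" by (auto elim!: nonpos_Ints_cases)
    then have "Re (s - z) = of_int n" by simp
    then have "of_int n > (-1::real)" using z sigma_pos by (simp add: S_def)
    then have "n > -1" by linarith
    with n(2) have "n = 0" by simp
    then show False using n(1) z(2) by simp
  qed
  then show ?thesis using Gamma_plus1[of "s - z"] by (simp add: B_def \<phi>_def)
qed

lemma E_eq: "z \<in> S \<Longrightarrow> z \<noteq> s \<Longrightarrow> E z = \<phi> z + of_real A / (z - s)"
proof -
  assume z: "z \<in> S" "z \<noteq> s"
  then have "E z = - (((s - z) * \<phi> z - of_real A) / (z - s))" by (simp add: E_def B_eq B_s)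
  also have "\<dots> = \<phi> z + of_real A / (z - s)" using z(2) by (simp add: field_simps)
  finally show ?thesis .
qed

lemma B_decay:
  assumes c: "-1 < c"
  shows "\<exists>K\<ge>0. \<forall>z. c \<le> Re z \<and> Re z \<le> \<sigma> \<and> \<bar>Im z\<bar> \<ge> t + 1 \<longrightarrow> norm (B z) \<le> K / (Im z)\<^sup>2"
proof -
  \<comment> \<open>Order 6: two powers for each of the two zeta factors and two to spare. The other
    Gamma factor is merely bounded, hence order 0 below.\<close>
  obtain C1 where C1: "C1 \<ge> 0" "\<And>z. c \<le> Re z \<Longrightarrow> Re z \<le> \<sigma> \<Longrightarrow> Im z \<noteq> 0 \<Longrightarrow> norm (Gamma z) \<le> C1 / \<bar>Im z\<bar> ^ 6"
    using Gamma_vertical_decay[of c 6 \<sigma>] c by auto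
  obtain C2 where C2: "C2 \<ge> 0" "\<And>z. 1 \<le> Re z \<Longrightarrow> Re z \<le> \<sigma> + 1 - c \<Longrightarrow> Im z \<noteq> 0 \<Longrightarrow> norm (Gamma z) \<le> C2 / \<bar>Im z\<bar> ^ 0"
    using Gamma_vertical_decay[of 1 0 "\<sigma> + 1 - c"] by auto
  obtain C3 where C3: "C3 \<ge> 0" "\<And>z. c \<le> Re z \<Longrightarrow> Re z \<le> \<sigma> \<Longrightarrow> \<bar>Im z\<bar> \<ge> 1 \<Longrightarrow> norm (riemann_zeta z) \<le> C3 * (Im z)\<^sup>2"
    using riemann_zeta_growth[of c \<sigma>] c by auto
  obtain C4 where C4: "C4 \<ge> 0" "\<And>z. \<sigma> \<le> Re z \<Longrightarrow> Re z \<le> 2 * \<sigma> - c \<Longrightarrow> \<bar>Im z\<bar> \<ge> 1 \<Longrightarrow> norm (riemann_zeta z) \<le> C4 * (Im z)\<^sup>2"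
    using riemann_zeta_growth[of \<sigma> "2 * \<sigma> - c"] sigma_pos by auto
  define K where "K = C1 * C2 / norm (Gamma s) * C3 * C4"
  have "norm (B z) \<le> K / (Im z)\<^sup>2" if z: "c \<le> Re z" "Re z \<le> \<sigma>" "\<bar>Im z\<bar> \<ge> t + 1" for z
  proof -
    define Y where "Y = (Im z)\<^sup>2"
    have Im0: "Im z \<noteq> 0" "Im z \<noteq> t" using z t_pos by auto
    have Y: "Y > 0" using Im0 by (simp add: Y_def)
    have Y3: "\<bar>Im z\<bar> ^ 6 = Y * Y * Y"
      by (simp add: Y_def power2_eq_square numeral_eq_Suc abs_mult[symmetric])
    have "norm (B z) \<le> C1 / \<bar>Im z\<bar> ^ 6 * (C2 / \<bar>Im (s - z + 1)\<bar> ^ 0) / norm (Gamma s) * (C3 * (Im z)\<^sup>2) * (C4 * (Im (of_real (2 * \<sigma>) - z))\<^sup>2)"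
      unfolding B_def norm_mult norm_divide using z Im0 t_pos C1(1) C2(1) C3(1) C4(1)
      by (intro mult_mono divide_right_mono C1(2) C2(2) C3(2) C4(2)) auto
    also have "\<dots> = K / Y"
      unfolding Y3 K_def using Y by (simp add: Y_def[symmetric] mult_ac)
    finally show ?thesis by (simp add: Y_def)
  qed
  moreover have "K \<ge> 0" using C1 C2 C3 C4 by (simp add: K_def)
  ultimately show ?thesis by blast
qed

lemma continuous_on_E_line:
  assumes "-1 < c" "c < 1" "c \<noteq> 0" "c \<noteq> 2 * \<sigma> - 1"
  shows "continuous_on UNIV (\<lambda>y. E (Complex c y))"
proof (rule continuous_on_compose2[OF holomorphic_on_imp_continuous_on[OF E_holomorphic]])
  show "continuous_on UNIV (Complex c)" unfolding Complex_eq by (intro continuous_intros)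
  show "range (Complex c) \<subseteq> S - pts" using assms by (auto simp: S_def pts_def complex_eq_iff)
qed

lemma phi_decay:
  assumes K: "\<And>z. c \<le> Re z \<Longrightarrow> Re z \<le> \<sigma> \<Longrightarrow> \<bar>Im z\<bar> \<ge> t + 1 \<Longrightarrow> norm (B z) \<le> K / (Im z)\<^sup>2" "K \<ge> 0"
    and z: "-1 < c" "c \<le> Re z" "Re z \<le> \<sigma>" "\<bar>Im z\<bar> \<ge> t + 1"
  shows "norm (\<phi> z) \<le> K / (Im z)\<^sup>2"
proof -
  have zs: "z \<noteq> s" "z \<in> S" using z t_pos sigma_less by (auto simp: S_def)
  have "1 \<le> \<bar>Im (s - z)\<bar>" using z t_pos by auto
  then have 1: "1 \<le> norm (s - z)" using abs_Im_le_cmod[of "s - z"] by linarith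
  have "norm (\<phi> z) \<le> norm (s - z) * norm (\<phi> z)"
    using mult_right_mono[OF 1 norm_ge_zero[of "\<phi> z"]] by simp
  also have "\<dots> = norm (B z)" using B_eq[OF zs(2,1)] by (simp add: norm_mult)
  also have "\<dots> \<le> K / (Im z)\<^sup>2" using z by (intro K) auto
  finally show ?thesis .
qed

lemma Re_E_critical_line:
  assumes "y \<noteq> t"
  shows "Re (E (Complex \<sigma> y)) = Re (\<phi> (Complex \<sigma> y))"
proof -
  have "Complex \<sigma> y \<in> S" "Complex \<sigma> y \<noteq> s"
    using assms sigma_pos sigma_less by (auto simp: S_def s_def)
  then have "E (Complex \<sigma> y) = \<phi> (Complex \<sigma> y) + of_real A / (Complex \<sigma> y - s)" by (rule E_eq)
  moreover have "Re (of_real A / (Complex \<sigma> y - s)) = 0" by (simp add: Re_divide)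
  ultimately show ?thesis by simp
qed

lemma integrable_Re_E_critical_line: "2 * \<sigma> - 1 \<noteq> \<sigma> \<Longrightarrow> integrable lborel (\<lambda>y. Re (E (Complex \<sigma> y)))"
proof -
  obtain K where K: "K \<ge> 0" "\<And>z. 0 \<le> Re z \<Longrightarrow> Re z \<le> \<sigma> \<Longrightarrow> \<bar>Im z\<bar> \<ge> t + 1 \<Longrightarrow> norm (B z) \<le> K / (Im z)\<^sup>2"
    using B_decay[of 0] by auto
  have "integrable lborel (\<lambda>y. complex_of_real (Re (E (Complex \<sigma> y))))"
  proof (rule integrable_quadratic_decay)
    show "continuous_on UNIV (\<lambda>y. complex_of_real (Re (E (Complex \<sigma> y))))"
      by (intro continuous_on_of_real continuous_on_Re continuous_on_E_line) (use sigma_pos sigma_less in auto)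
    fix y assume y: "\<bar>y\<bar> \<ge> t + 1"
    then have "y \<noteq> t" using t_pos by auto
    then have "norm (complex_of_real (Re (E (Complex \<sigma> y)))) = \<bar>Re (\<phi> (Complex \<sigma> y))\<bar>"
      by (simp add: Re_E_critical_line)
    also have "\<dots> \<le> norm (\<phi> (Complex \<sigma> y))" by (rule abs_Re_le_cmod)
    also have "\<dots> \<le> K / (Im (Complex \<sigma> y))\<^sup>2"
      using y sigma_pos by (intro phi_decay[where c = 0] K) auto
    finally show "norm (complex_of_real (Re (E (Complex \<sigma> y)))) \<le> K / y\<^sup>2" by simp
  qed
  then show ?thesis using integrable_Re by fastforce
qed

section \<open>Comparison of the line Re z = \<sigma> with the line Re z = c\<close>

context
  fixes c :: real
  assumes c: "-1 < c" "c < 0" "c < 2 * \<sigma> - 1"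
begin

lemma c_less: "c < \<sigma>" using c sigma_pos by simp

lemma E_left_line:
  "E (Complex c y) = \<phi> (Complex c y) + of_real A / (Complex c y - s)"
  using c c_less by (intro E_eq) (auto simp: S_def s_def)

lemma Re_E_left_line:
  "Re (E (Complex c y)) = Re (\<phi> (Complex c y)) - A * ((\<sigma> - c) / ((\<sigma> - c)\<^sup>2 + (y - t)\<^sup>2))"
proof -
  have "Re (of_real A / (Complex c y - s)) = A * (c - \<sigma>) / ((c - \<sigma>)\<^sup>2 + (y - t)\<^sup>2)"
    by (simp add: Re_divide)
  also have "\<dots> = - (A * ((\<sigma> - c) / ((\<sigma> - c)\<^sup>2 + (y - t)\<^sup>2)))"
    by (simp add: power2_commute[of c] minus_divide_left algebra_simps)
  finally show ?thesis unfolding E_left_line by simp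
qed

lemma integrable_phi_left_line: "integrable lborel (\<lambda>y. \<phi> (Complex c y))"
proof -
  obtain K where K: "K \<ge> 0" "\<And>z. c \<le> Re z \<Longrightarrow> Re z \<le> \<sigma> \<Longrightarrow> \<bar>Im z\<bar> \<ge> t + 1 \<Longrightarrow> norm (B z) \<le> K / (Im z)\<^sup>2"
    using B_decay[of c] c by auto
  show ?thesis
  proof (rule integrable_quadratic_decay)
    have "continuous_on UNIV (\<lambda>y. E (Complex c y) - of_real A / (Complex c y - s))"
      using c c_less by (intro continuous_intros continuous_on_E_line) (auto simp: Complex_eq s_def complex_eq_iff intro!: continuous_intros)
    then show "continuous_on UNIV (\<lambda>y. \<phi> (Complex c y))" unfolding E_left_line by simp
    fix y assume "\<bar>y\<bar> \<ge> t + 1"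
    then have "norm (\<phi> (Complex c y)) \<le> K / (Im (Complex c y))\<^sup>2"
      using c c_less by (intro phi_decay[where c = c] K) auto
    then show "norm (\<phi> (Complex c y)) \<le> K / y\<^sup>2" by simp
  qed
qed

text \<open>The added term A / (z - s) is imaginary on the line through s but contributes -\<pi> A
  on the left line, by the Poisson kernel. This is how half of the residue at s appears.\<close>

lemma line_shift:
  "(LBINT y. Re (E (Complex \<sigma> y)))
     = Re (LBINT y. \<phi> (Complex c y)) - pi * A + 2 * pi * Re (\<Sum>p\<in>pts. residue E p)"
proof -
  obtain K where K: "K \<ge> 0" "\<And>z. c \<le> Re z \<Longrightarrow> Re z \<le> \<sigma> \<Longrightarrow> \<bar>Im z\<bar> \<ge> t + 1 \<Longrightarrow> norm (B z) \<le> K / (Im z)\<^sup>2"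
    using B_decay[of c] c by auto
  have d: "\<sigma> - c > 0" using c_less by simp
  note P = poisson_kernel_integral[OF d, of t]
  have Ri: "integrable lborel (\<lambda>y. Re (\<phi> (Complex c y)))"
    using integrable_phi_left_line by (rule integrable_Re)
  have left_i: "integrable lborel (\<lambda>y. Re (E (Complex c y)))"
    unfolding Re_E_left_line by (intro Bochner_Integration.integrable_diff Ri integrable_mult_right P)
  have left: "(LBINT y. Re (E (Complex c y))) = Re (LBINT y. \<phi> (Complex c y)) - pi * A"
  proof -
    have "integrable lborel (\<lambda>y. A * ((\<sigma> - c) / ((\<sigma> - c)\<^sup>2 + (y - t)\<^sup>2)))"
      by (intro integrable_mult_right P)
    from Bochner_Integration.integral_diff[OF Ri this]
    have "(LBINT y. Re (E (Complex c y))) = (LBINT y. Re (\<phi> (Complex c y))) - A * pi"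
      unfolding Re_E_left_line integral_mult_right_zero P .
    then show ?thesis using integrable_phi_left_line by (simp add: mult.commute)
  qed
  have "(LBINT y. Re (E (Complex \<sigma> y))) - (LBINT y. Re (E (Complex c y))) = 2 * pi * Re (\<Sum>p\<in>pts. residue E p)"
  proof (rule vertical_line_shift[where a' = "-1" and b' = 1])
    show "E holomorphic_on {z. -1 < Re z \<and> Re z < 1} - pts" using E_holomorphic by (simp add: S_def)
    \<comment> \<open>Because of A / (z - s) the decay is only of order 1 / |Im z|, which is enough
      for horizontal sides of fixed length. The threshold t + 1 keeps the denominator at least
      1.\<close>
    show "norm (E z) \<le> (K + A) / (\<bar>Im z\<bar> - t)" if z: "c \<le> Re z" "Re z \<le> \<sigma>" "\<bar>Im z\<bar> \<ge> t + 1" for z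
    proof -
      have zs: "z \<noteq> s" "z \<in> S" using z c sigma_less t_pos by (auto simp: S_def)
      have "1 \<le> (Im z)\<^sup>2" using z(3) t_pos one_le_power[of "\<bar>Im z\<bar>" 2] by simp
      then have "K / (Im z)\<^sup>2 \<le> K / 1" using K(1) by (intro divide_left_mono) auto
      then have "norm (B z) \<le> K" using K(2)[OF z] by simp
      then have "norm (B z - B s) \<le> K + A"
      proof -
        have "norm (B s) = A" unfolding B_s norm_of_real by (simp add: A_def)
        then show ?thesis using norm_triangle_ineq4[of "B z" "B s"] \<open>norm (B z) \<le> K\<close> by linarith
      qed
      moreover have "\<bar>Im z\<bar> - t \<le> norm (z - s)"
        using abs_Im_le_cmod[of "z - s"] t_pos by simp
      ultimately have "norm (B z - B s) / norm (z - s) \<le> (K + A) / (\<bar>Im z\<bar> - t)"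
        using z(3) K(1) by (intro frac_le) (auto simp: A_def)
      then show ?thesis using zs by (simp add: E_def norm_divide)
    qed
    show "((\<lambda>y. (K + A) / (y - t)) \<longlongrightarrow> 0) at_top" by real_asymp
    show "integrable lborel (\<lambda>y. Re (E (Complex \<sigma> y)))" using sigma_less by (intro integrable_Re_E_critical_line) auto
  qed (use c c_less sigma_pos sigma_less left_i in \<open>auto simp: pts_def\<close>)
  then show ?thesis unfolding left by simp
qed

text \<open>The integral is the remainder series with (u, v) = (cnj s, s), and conjugation exchanges
  u and v. Adding the conjugate produces the symmetric sum.\<close>

lemma line_integral_real_part:
  "(LBINT y. \<phi> (Complex c y)) / (2 * pi) + cnj ((LBINT y. \<phi> (Complex c y)) / (2 * pi))
     = of_real A - (1 / (s - 1) + 1 / (cnj s - 1)) * riemann_zeta (of_real (2 * \<sigma> - 1))"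
proof -
  let ?J = "(LBINT y. \<phi> (Complex c y)) / (2 * pi)"
  have s1: "s \<noteq> 1" "cnj s \<noteq> 1" using t_pos by (auto simp: complex_eq_iff)
  have sums: "(\<lambda>m. of_nat (Suc m) powr (- cnj s) * em_rem s (Suc m)) sums ?J"
    using em_rem_sums_line_integral[of c s "cnj s"] c sigma_pos
    unfolding s_plus_cnj \<phi>_def by simp
  then have "(\<lambda>m. cnj (of_nat (Suc m) powr (- cnj s) * em_rem s (Suc m))) sums cnj ?J"
    by (simp only: sums_cnj)
  moreover have "cnj (of_nat (Suc m) powr (- cnj s) * em_rem s (Suc m)) = of_nat (Suc m) powr (- s) * em_rem (cnj s) (Suc m)" for m
    using em_rem_cnj[of s "Suc m"] sigma_pos s1 by (simp add: cnj_powr)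
  ultimately have sums': "(\<lambda>m. of_nat (Suc m) powr (- s) * em_rem (cnj s) (Suc m)) sums cnj ?J"
    by (simp only:)
  have "cnj s + s \<noteq> 2" unfolding s_plus_cnj using sigma_less by (auto simp: complex_eq_iff)
  from em_rem_symmetric_sum[OF _ s1(2) _ s1(1) this sums sums']
  have "?J + cnj ?J = riemann_zeta (cnj s) * riemann_zeta s - (1 / (s - 1) + 1 / (cnj s - 1)) * riemann_zeta (cnj s + s - 1)"
    using sigma_pos by simp
  moreover have "riemann_zeta (cnj s) * riemann_zeta s = of_real A"
    unfolding riemann_zeta_cnj A_def complex_norm_square by (rule mult.commute)
  moreover have "cnj s + s - 1 = of_real (2 * \<sigma> - 1)" unfolding s_plus_cnj by simp
  ultimately show ?thesis by (simp only:)
qed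

end

section \<open>Residues at 0 and at 2\<sigma> - 1\<close>

lemma residue_E_0:
  assumes "\<sigma> \<noteq> 1 / 2"
  shows "residue E 0 = - riemann_zeta (of_real (2 * \<sigma>)) / 2"
proof (rule residue_simple')
  let ?p = "complex_of_real (2 * \<sigma> - 1)"
  have p: "?p \<noteq> 0" using assms by (auto simp: complex_eq_iff)
  show "open (S - {?p})" using open_S by (intro open_Diff) auto
  show "0 \<in> S - {?p}" using p by (auto simp: S_def)
  have "S - {?p} - {0} = S - pts" by (auto simp: pts_def)
  then show "E holomorphic_on S - {?p} - {0}" using E_holomorphic by simp
  \<comment> \<open>This is w E(w) with w Gamma(w) replaced by Gamma(w + 1), hence continuous at 0.
    At w = 0 the term with A drops out.\<close>
  define M where "M = (\<lambda>w. Gamma (w + 1) * Gamma (s - w) / Gamma s * riemann_zeta w * riemann_zeta (of_real (2 * \<sigma>) - w) + of_real A * w / (w - s))"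
  have ne: "s \<noteq> 0" "s \<notin> \<int>\<^sub>\<le>\<^sub>0" "complex_of_real (2 * \<sigma>) \<noteq> 1"
    using t_pos p s_nonzero by (auto dest!: nonpos_Ints_Re)
  have "isCont M 0" unfolding M_def
    using ne Gamma_s
    by (intro continuous_intros isCont_Gamma isCont_o2[OF _ isCont_riemann_zeta]) (auto simp: nonpos_Ints_def)
  then have lim: "(M \<longlongrightarrow> M 0) (at 0)" by (simp add: isCont_def)
  have "\<forall>\<^sub>F w in at 0. w \<in> S - {s}"
    using open_S s_in ne(1) by (intro eventually_at_in_open') (auto simp: S_def)
  then have "\<forall>\<^sub>F w in at 0. M w = E w * (w - 0)"
    using eventually_neq_at_within[of 0 0 UNIV]
  proof eventually_elim
    case (elim w)
    then have "Gamma (w + 1) = w * Gamma w" by (intro Gamma_plus1 nonpos_Ints_S) auto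
    then show ?case using E_eq[of w] elim by (simp add: M_def \<phi>_def algebra_simps)
  qed
  then have "((\<lambda>w. E w * (w - 0)) \<longlongrightarrow> M 0) (at 0)" by (rule Lim_transform_eventually[OF lim])
  moreover have "M 0 = - riemann_zeta (of_real (2 * \<sigma>)) / 2"
    using Gamma_s by (simp add: M_def riemann_zeta_0)
  ultimately show "((\<lambda>w. E w * (w - 0)) \<longlongrightarrow> - riemann_zeta (of_real (2 * \<sigma>)) / 2) (at 0)" by simp
qed

text \<open>The factor \<zeta>(2\<sigma> - w) has residue -1 in w, because its argument is
  reflected. The identity s - p = 1 - cnj s supplies the Gamma quotient of
  \<open>G_fun\<close>.\<close>

lemma residue_E_pole:
  assumes "\<sigma> \<noteq> 1 / 2"
  defines "p \<equiv> complex_of_real (2 * \<sigma> - 1)"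
  shows "residue E p = - (Gamma p * Gamma (1 - cnj s) / Gamma s * riemann_zeta p)"
proof (rule residue_simple')
  have p: "p \<noteq> 0" using assms by (auto simp: complex_eq_iff)
  have pS: "p \<in> S" using sigma_pos sigma_less by (auto simp: S_def p_def)
  show "open (S - {0})" using open_S by (intro open_Diff) auto
  show "p \<in> S - {0}" using p pS by auto
  have "S - {0} - {p} = S - pts" by (auto simp: pts_def p_def)
  then show "E holomorphic_on S - {0} - {p}" using E_holomorphic by simp
  define M where "M = (\<lambda>w. - (Gamma w * Gamma (s - w) / Gamma s * riemann_zeta w * zeta_Z (of_real (2 * \<sigma>) - w)) + of_real A * (w - p) / (w - s))"
  have ne: "p \<noteq> s" "s - p \<notin> \<int>\<^sub>\<le>\<^sub>0" "p \<notin> \<int>\<^sub>\<le>\<^sub>0" "p \<noteq> 1"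
    using t_pos p pS sigma_less nonpos_Ints_S[of p] by (auto simp: p_def complex_eq_iff dest!: nonpos_Ints_Re)
  have "isCont M p" unfolding M_def
    using ne Gamma_s
    by (intro continuous_intros isCont_Gamma isCont_riemann_zeta isCont_o2[OF _ isCont_zeta_Z]) auto
  then have lim: "(M \<longlongrightarrow> M p) (at p)" by (simp add: isCont_def)
  have "\<forall>\<^sub>F w in at p. w \<in> S - {s}"
    using open_S ne pS by (intro eventually_at_in_open') auto
  then have "\<forall>\<^sub>F w in at p. M w = E w * (w - p)"
    using eventually_neq_at_within[of p p UNIV]
  proof eventually_elim
    case (elim w)
    have w: "of_real (2 * \<sigma>) - w - 1 = - (w - p)" by (simp add: p_def)
    moreover have "- (w - p) \<noteq> 0" using elim by simp
    ultimately have "of_real (2 * \<sigma>) - w \<noteq> 1" by (metis right_minus_eq)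
    then have zZ: "zeta_Z (of_real (2 * \<sigma>) - w) = - (w - p) * riemann_zeta (of_real (2 * \<sigma>) - w)"
      unfolding zeta_Z_def w by simp
    have "E w = \<phi> w + of_real A / (w - s)" using elim by (intro E_eq) auto
    moreover have "- (X * (- d * Y)) + a * d / e = (X * Y + a / e) * d" for X Y a d e :: complex
      by (simp add: algebra_simps)
    ultimately show ?case unfolding M_def zZ \<phi>_def by (simp only:)
  qed
  then have "((\<lambda>w. E w * (w - p)) \<longlongrightarrow> M p) (at p)" by (rule Lim_transform_eventually[OF lim])
  moreover have "M p = - (Gamma p * Gamma (1 - cnj s) / Gamma s * riemann_zeta p)"
  proof -
    have "s - p = 1 - cnj s" "of_real (2 * \<sigma>) - p = 1" by (auto simp: p_def complex_eq_iff)
    then show ?thesis by (simp add: M_def zeta_Z_def)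
  qed
  ultimately show "((\<lambda>w. E w * (w - p)) \<longlongrightarrow> - (Gamma p * Gamma (1 - cnj s) / Gamma s * riemann_zeta p)) (at p)" by simp
qed

text \<open>At the double pole w^2 E(w) extends holomorphically, and the residue is its derivative
  at 0. This is where Gamma'(1), \<zeta>'(0) and the derivative of \<open>zeta_Z\<close> at 1 enter;
  each of the first and third contributes an Euler constant.\<close>

lemma residue_E_double:
  assumes \<sigma>: "\<sigma> = 1 / 2"
  shows "residue E 0 = of_real (ln (2 * pi) / 2 - euler_mascheroni) - Digamma s / 2"
proof -
  define M where "M = (\<lambda>w. - (1 / Gamma s) * (((Gamma (w + 1) * Gamma (s - w)) * riemann_zeta w) * zeta_Z (1 - w)) + w ^ 2 * (of_real A / (w - s)))"
  have bl: "\<bar>Re w\<bar> < 1 / 2" if "w \<in> ball 0 (1/2)" for w :: complex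
    using that abs_Re_le_cmod[of w] by auto
  have bS: "w \<in> S" "w \<noteq> s" if "w \<in> ball 0 (1/2)" for w
    using bl[OF that] \<sigma> by (auto simp: S_def)
  have "\<forall>\<^sub>F w in at 0. w \<in> ball 0 (1/2) - {0}" by (intro eventually_at_in_open) auto
  then have "\<forall>\<^sub>F w in at 0. E w = M w / (w - 0) ^ Suc 1"
  proof eventually_elim
    case (elim w)
    then have w: "w \<in> ball 0 (1/2)" "w \<noteq> 0" by auto
    have "Gamma (w + 1) = w * Gamma w" using bS[OF w(1)] w by (intro Gamma_plus1 nonpos_Ints_S) auto
    moreover have "zeta_Z (1 - w) = - w * riemann_zeta (1 - w)" using w by (simp add: zeta_Z_def)
    moreover have "E w = \<phi> w + of_real A / (w - s)" using bS[OF w(1)] by (rule E_eq)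
    moreover have "\<phi> w = Gamma w * Gamma (s - w) / Gamma s * riemann_zeta w * riemann_zeta (1 - w)"
      unfolding \<phi>_def by (simp only: \<sigma>) simp
    ultimately show ?case using w(2) by (simp add: M_def add_divide_distrib power2_eq_square)
  qed
  then have "residue E 0 = residue (\<lambda>w. M w / (w - 0) ^ Suc 1) 0" by (rule residue_cong) simp
  also have "\<dots> = (deriv ^^ 1) M 0 / fact 1"
  proof (rule residue_holomorphic_over_power)
    have 1: "(\<lambda>w. Gamma (w + 1)) holomorphic_on ball 0 (1/2)"
      by (intro holomorphic_Gamma' holomorphic_intros) (use bl in \<open>fastforce dest!: nonpos_Ints_Re\<close>)
    have sw: "Re (s - w) > 0" if "w \<in> ball 0 (1/2)" for w
      using bl[OF that] \<sigma> unfolding minus_complex.sel Re_s by linarith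
    have 2: "(\<lambda>w. Gamma (s - w)) holomorphic_on ball 0 (1/2)"
      by (intro holomorphic_Gamma' holomorphic_intros not_nonpos_Ints_Re sw)
    have 3: "riemann_zeta holomorphic_on ball 0 (1/2)"
      by (rule holomorphic_on_subset[OF holomorphic_riemann_zeta]) auto
    have "zeta_Z \<circ> (\<lambda>w. 1 - w) holomorphic_on ball 0 (1/2)"
      by (rule holomorphic_on_compose_gen[OF _ holomorphic_zeta_Z]) (auto intro!: holomorphic_intros)
    then have 4: "(\<lambda>w. zeta_Z (1 - w)) holomorphic_on ball 0 (1/2)" by (simp add: o_def)
    show "M holomorphic_on ball 0 (1/2)" unfolding M_def
      using bS by (intro holomorphic_intros 1 2 3 4) auto
  qed auto
  also have "\<dots> = deriv M 0" by simp
  also have "deriv M 0 = of_real (ln (2 * pi) / 2 - euler_mascheroni) - Digamma s / 2"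
  proof (rule DERIV_imp_deriv)
    have s0: "s \<noteq> 0" "s \<notin> \<int>\<^sub>\<le>\<^sub>0" using t_pos s_nonzero by (auto dest!: nonpos_Ints_Re)
    have g1: "((\<lambda>w. Gamma (w + 1)) has_field_derivative - euler_mascheroni) (at (0::complex))"
      by (rule derivative_eq_intros refl | simp add: nonpos_Ints_def)+
    have g2: "((\<lambda>w. Gamma (s - w)) has_field_derivative - (Gamma s * Digamma s)) (at 0)"
      using s0 by (auto intro!: derivative_eq_intros)
    have g3: "(riemann_zeta has_field_derivative of_real (- ln (2 * pi) / 2)) (at 0)"
      using holomorphic_derivI[OF holomorphic_riemann_zeta, of 0 UNIV] deriv_zeta_0 by auto
    have "(zeta_Z has_field_derivative euler_mascheroni) (at (1 - 0))"
      using holomorphic_derivI[OF holomorphic_zeta_Z, of 1 UNIV] deriv_zeta_Z_1 by auto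
    then have g4: "((\<lambda>w. zeta_Z (1 - w)) has_field_derivative - euler_mascheroni) (at 0)"
    proof -
      assume "(zeta_Z has_field_derivative euler_mascheroni) (at (1 - 0))"
      from DERIV_chain2[OF this DERIV_diff[OF DERIV_const DERIV_ident]] show ?thesis by simp
    qed
    have g5: "((\<lambda>w. of_real A / (w - s)) has_field_derivative - of_real A / s\<^sup>2) (at 0)"
      using s0 by (auto intro!: derivative_eq_intros simp: power2_eq_square)
    have "(M has_field_derivative
       - (1 / Gamma s) * (((- euler_mascheroni * Gamma (s - 0) + - (Gamma s * Digamma s) * Gamma (0 + 1)) * riemann_zeta 0
             + of_real (- ln (2 * pi) / 2) * (Gamma (0 + 1) * Gamma (s - 0))) * zeta_Z (1 - 0)
             + - euler_mascheroni * ((Gamma (0 + 1) * Gamma (s - 0)) * riemann_zeta 0))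
       + (of_nat 2 * (1 * 0 ^ (2 - Suc 0)) * (of_real A / (0 - s)) + - of_real A / s\<^sup>2 * 0 ^ 2)) (at 0)"
      unfolding M_def
      by (intro DERIV_add DERIV_cmult DERIV_mult DERIV_power DERIV_ident g1 g2 g3 g4 g5)
    also have "- (1 / Gamma s) * (((- euler_mascheroni * Gamma (s - 0) + - (Gamma s * Digamma s) * Gamma (0 + 1)) * riemann_zeta 0
             + of_real (- ln (2 * pi) / 2) * (Gamma (0 + 1) * Gamma (s - 0))) * zeta_Z (1 - 0)
             + - euler_mascheroni * ((Gamma (0 + 1) * Gamma (s - 0)) * riemann_zeta 0))
       + (of_nat 2 * (1 * 0 ^ (2 - Suc 0)) * (of_real A / (0 - s)) + - of_real A / s\<^sup>2 * 0 ^ 2)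
       = of_real (ln (2 * pi) / 2 - euler_mascheroni) - Digamma s / 2"
      using Gamma_s by (simp add: riemann_zeta_0 zeta_Z_def field_simps)
    finally show "(M has_field_derivative of_real (ln (2 * pi) / 2 - euler_mascheroni) - Digamma s / 2) (at 0)" .
  qed
  finally show ?thesis .
qed

lemma zeta_integrand_eq:
  assumes "\<tau> \<noteq> 1"
  shows "zeta_integrand \<sigma> t \<tau> = Re (E (Complex \<sigma> (t * \<tau>)))"
proof -
  let ?z = "Complex \<sigma> (t * \<tau>)"
  have z: "of_real \<sigma> + \<i> * of_real \<tau> * of_real t = ?z" "of_real \<sigma> + \<i> * of_real t = s"
    "\<i> * of_real t - \<i> * of_real \<tau> * of_real t = s - ?z" "of_real (2 * \<sigma>) - ?z = cnj ?z"
    by (simp_all add: complex_eq_iff)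
  have "t * \<tau> \<noteq> t" using assms t_pos by simp
  then have "Re (E ?z) = Re (\<phi> ?z)" by (rule Re_E_critical_line)
  also have "\<phi> ?z = Gamma (s - ?z) / Gamma s * Gamma ?z * of_real ((cmod (riemann_zeta ?z))\<^sup>2)"
    unfolding \<phi>_def z(4) riemann_zeta_cnj complex_norm_square by (simp add: mult_ac)
  also have "Re \<dots> = zeta_integrand \<sigma> t \<tau>"
  proof -
    have "Re (X * of_real r) = Re X * r" for X r by simp
    then show ?thesis unfolding zeta_integrand_def z .
  qed
  finally show ?thesis by simp
qed

lemma zeta_integrand_pv:
  "has_pv_integral (zeta_integrand \<sigma> t) 1 ((LBINT y. Re (E (Complex \<sigma> y))) / t)"
proof -
  define h where "h = (\<lambda>y. Re (E (Complex \<sigma> y)))"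
  have hi: "integrable lborel h" unfolding h_def using sigma_less by (intro integrable_Re_E_critical_line) auto
  then have [measurable]: "h \<in> borel_measurable borel" by auto
  have gi: "integrable lborel (\<lambda>\<tau>. h (0 + t * \<tau>))"
    using t_pos hi by (intro lborel_integrable_real_affine) auto
  have gv: "(LBINT \<tau>. h (0 + t * \<tau>)) = (LBINT y. h y) / t"
    using t_pos lborel_integral_real_affine[of t h 0] by simp
  \<comment> \<open>At \<tau> = 1 the integrand has the conventional value coming from
    \<open>Gamma 0 = 0\<close>, whereas E is continued through s; the single point is split off and
    ignored almost everywhere.\<close>
  have eq: "zeta_integrand \<sigma> t = (\<lambda>\<tau>. if \<tau> = 1 then zeta_integrand \<sigma> t 1 else h (0 + t * \<tau>))"
    by (auto simp: fun_eq_iff h_def zeta_integrand_eq)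
  have m: "zeta_integrand \<sigma> t \<in> borel_measurable borel" by (subst eq) measurable
  have ae: "AE \<tau> in lborel. zeta_integrand \<sigma> t \<tau> = h (0 + t * \<tau>)"
    using AE_lborel_singleton[of 1] by eventually_elim (simp add: h_def zeta_integrand_eq)
  have fi: "integrable lborel (zeta_integrand \<sigma> t)"
    using integrable_cong_AE[OF _ _ ae] gi m by auto
  have fv: "(LBINT \<tau>. zeta_integrand \<sigma> t \<tau>) = (LBINT y. h y) / t"
    using integral_cong_AE[OF _ _ ae] gv m by auto
  show ?thesis using has_pv_integral_integrable[OF fi, of 1] unfolding fv h_def .
qed

lemma sum_inverse_s: "1 / (s - 1) + 1 / (cnj s - 1) = 2 * (of_real \<sigma> - 1) / of_real ((\<sigma> - 1)\<^sup>2 + t\<^sup>2)"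
proof -
  have s1: "s - 1 \<noteq> 0" "cnj s - 1 \<noteq> 0" using t_pos by (auto simp: complex_eq_iff)
  have "(s - 1) * (cnj s - 1) = of_real ((\<sigma> - 1)\<^sup>2 + t\<^sup>2)"
    by (simp add: complex_eq_iff power2_eq_square algebra_simps)
  moreover have "(s - 1) + (cnj s - 1) = 2 * (of_real \<sigma> - 1)" by (simp add: complex_eq_iff)
  moreover have "1 / (s - 1) + 1 / (cnj s - 1) = ((s - 1) + (cnj s - 1)) / ((s - 1) * (cnj s - 1))"
    using s1 by (simp add: add_divide_eq_iff divide_add_eq_iff add.commute)
  ultimately show ?thesis by simp
qed

text \<open>Twice the real part adds to the Gamma quotient its conjugate, which produces the
  symmetric bracket in \<open>G_fun\<close>. For \<sigma> = 1/2 the last term becomes 2 / (1 + 4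
  t^2) because \<zeta>(0) = -1/2.\<close>

lemma G_fun_eq_residues:
  "G_fun \<sigma> t = of_real (- 2 * Re (\<Sum>p\<in>pts. residue E p))
     + (1 / (s - 1) + 1 / (cnj s - 1)) * riemann_zeta (of_real (2 * \<sigma> - 1))"
proof (cases "\<sigma> = 1 / 2")
  case False
  define p where "p = complex_of_real (2 * \<sigma> - 1)"
  have p0: "p \<noteq> 0" using False by (auto simp: p_def complex_eq_iff)
  define R where "R = - riemann_zeta (of_real (2 * \<sigma>)) / 2 - Gamma p * Gamma (1 - cnj s) / Gamma s * riemann_zeta p"
  have "(\<Sum>p\<in>pts. residue E p) = R"
    unfolding pts_def p_def[symmetric] using p0 residue_E_0[OF False] residue_E_pole[OF False]
    by (simp add: R_def p_def)
  moreover have "cnj R = - riemann_zeta (of_real (2 * \<sigma>)) / 2 - Gamma p * Gamma (1 - s) / Gamma (cnj s) * riemann_zeta p"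
  proof -
    have "cnj (riemann_zeta (of_real x)) = riemann_zeta (of_real x)" for x
      by (simp flip: riemann_zeta_cnj)
    then show ?thesis unfolding R_def p_def by (simp add: cnj_Gamma del: of_real_mult of_real_diff)
  qed
  then have "R + cnj R = - (riemann_zeta (of_real (2 * \<sigma>))
      + (Gamma (1 - cnj s) / Gamma s + Gamma (1 - s) / Gamma (cnj s)) * Gamma p * riemann_zeta p)"
    unfolding R_def by (simp add: algebra_simps)
  moreover have "complex_of_real (- 2 * Re R) = - (R + cnj R)" by (simp add: complex_add_cnj)
  moreover have "G_fun \<sigma> t = (riemann_zeta (of_real (2 * \<sigma>))
      + (Gamma (1 - cnj s) / Gamma s + Gamma (1 - s) / Gamma (cnj s)) * Gamma p * riemann_zeta p)
      + (1 / (s - 1) + 1 / (cnj s - 1)) * riemann_zeta p"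
    unfolding G_fun_def Let_def s_def[symmetric] sum_inverse_s p_def using False by simp
  ultimately show ?thesis unfolding p_def[symmetric] by (simp only: minus_minus)
next
  case True
  have "(\<Sum>p\<in>pts. residue E p) = of_real (ln (2 * pi) / 2 - euler_mascheroni) - Digamma s / 2"
  proof -
    have "2 * \<sigma> - 1 = 0" using True by simp
    then have "complex_of_real (2 * \<sigma> - 1) = 0" by (simp only: of_real_0)
    then have "pts = {0}" by (simp add: pts_def)
    then show ?thesis by (simp only: residue_E_double[OF True]) (simp add: residue_E_double[OF True])
  qed
  then have "- 2 * Re (\<Sum>p\<in>pts. residue E p) = Re (Digamma s) + 2 * euler_mascheroni - ln (2 * pi)"
    by (simp only: minus_complex.sel Re_complex_of_real Re_divide_numeral) (simp add: field_simps)
  moreover have "s = 1/2 + \<i> * of_real t" using True by (simp add: complex_eq_iff)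
  moreover have "2 * (complex_of_real \<sigma> - 1) / of_real ((\<sigma> - 1)\<^sup>2 + t\<^sup>2) * riemann_zeta (of_real (2 * \<sigma> - 1)) = of_real (2 / (1 + 4 * t\<^sup>2))"
  proof -
    define X where "X = (\<sigma> - 1)\<^sup>2 + t\<^sup>2"
    define Y where "Y = 1 + 4 * t\<^sup>2"
    have X: "X = Y / 4" unfolding X_def Y_def True by (simp add: power2_eq_square)
    have r: "2 * (\<sigma> - 1) / X * (- 1 / 2) = 2 / (1 + 4 * t\<^sup>2)"
      unfolding X Y_def[symmetric] True by simp
    have "2 * \<sigma> - 1 = 0" using True by simp
    then have z: "riemann_zeta (of_real (2 * \<sigma> - 1)) = of_real (- 1 / 2)"
      by (simp only: of_real_0 riemann_zeta_0) simp
    have "2 * (complex_of_real \<sigma> - 1) / of_real X * of_real (- 1 / 2) = of_real (2 * (\<sigma> - 1) / X * (- 1 / 2))"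
      by simp
    then show ?thesis unfolding z X_def[symmetric] r .
  qed
  moreover have "G_fun \<sigma> t = of_real (Re (Digamma (1/2 + \<i> * of_real t)) + 2 * euler_mascheroni - ln (2 * pi)) + of_real (2 / (1 + 4 * t\<^sup>2))"
    unfolding G_fun_def Let_def by (simp only: if_P[OF True] of_real_add)
  ultimately show ?thesis unfolding sum_inverse_s by (simp only:)
qed

end

theorem theorem2p1:
  fixes \<sigma> t :: real
  assumes "0 < \<sigma>" and "\<sigma> < 1" and "t > 0"
  shows "\<exists>I. has_pv_integral (zeta_integrand \<sigma> t) 1 I \<and>
             complex_of_real (t / pi * I) + G_fun \<sigma> t = 0"
proof -
  interpret zeta_mean_square \<sigma> t by standard (use assms in auto)
  \<comment> \<open>The midpoint between -1 and min 0 (2\<sigma> - 1); the latter exceeds -1 because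
    \<sigma> > 0.\<close>
  define c where "c = (min 0 (2 * \<sigma> - 1) - 1) / 2"
  have c: "-1 < c" "c < 0" "c < 2 * \<sigma> - 1" using assms by (auto simp: c_def min_def)
  define J where "J = (LBINT y. \<phi> (Complex c y)) / (2 * pi)"
  define r where "r = Re (\<Sum>p\<in>pts. residue E p)"
  let ?I = "(LBINT y. Re (E (Complex \<sigma> y))) / t"
  have "Re (LBINT y. \<phi> (Complex c y)) = 2 * pi * Re J" unfolding J_def by simp
  \<comment> \<open>The -A from the half residue meets the +A contained in J + cnj J, and
    |\<zeta>(s)|^2 disappears.\<close>
  then have "t / pi * ?I = 2 * Re J - A + 2 * r"
    using line_shift[OF c] assms unfolding r_def by (simp add: field_simps)
  then have "complex_of_real (t / pi * ?I) = of_real (2 * Re J) - of_real A + of_real (2 * r)" by (simp only: of_real_add of_real_diff)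
  also have "complex_of_real (2 * Re J) = J + cnj J" by (simp add: complex_add_cnj)
  also have "J + cnj J = of_real A - (1 / (s - 1) + 1 / (cnj s - 1)) * riemann_zeta (of_real (2 * \<sigma> - 1))"
    unfolding J_def by (rule line_integral_real_part[OF c])
  finally have "complex_of_real (t / pi * ?I) + G_fun \<sigma> t = 0"
    unfolding G_fun_eq_residues r_def by simp
  with zeta_integrand_pv show ?thesis by blast
qed

end
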